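(* Let $X=(X_t)_{t\in[0,\infty)}$ and $Y=(Y_t)_{t\in[0,\infty)}$ be compound Poisson processes in $\mathbb R^d$ with diffuse locally finite event intensity measures $\lambda$ and $\mu$ on $[0,\infty)$ and increment probability kernels $K$ and $L$ from $[0,\infty)$ into $\mathbb R^d$ such that $K_t(\{0\})=0$ and $L_t(\{0\})=0$ for all $t$. Then for every $\alpha>0$ the R\'enyi divergence of order $\alpha$ of their laws is given by $$R_\alpha(\mathcal L(X)\|\mathcal L(Y))=T_\alpha(\lambda\otimes K\|\mu\otimes L).$$
   Context: Point patterns: for a measurable space $(S,\mathcal S)$, the set of point patterns on $S$ is the set of measures on $(S,\mathcal S)$ that can be written as a countable sum of integer-valued finite measures, equipped with the sigma-algebra generated by the evaluation maps $\eta\mapsto\eta(B)$, $B\in\mathcal S$. For a sigma-finite measure $\Lambda$ on $(S,\mathcal S)$, the Poisson PP distribution $P_\Lambda$ is the unique probability measure on the set of point patterns under which $\eta(B_1),\dots,\eta(B_n)$ are independent for mutually disjoint $B_1,\dots,B_n\in\mathcal S$, and $\eta(B)$ is Poisson distributed with mean $\Lambda(B)$ for every $B\in\mathcal S$ (with $\mathrm{Poi}(0)=\delta_0$, $\mathrm{Poi}(\infty)=\delta_\infty$). A measure $\lambda$ on $[0,\infty)$ is diffuse if $\lambda(\{t\})=0$ for all $t$, and locally finite if $\lambda([0,t])<\infty$ for all $t$. $(\lambda\otimes K)(dt,dx)=\lambda(dt)K_t(dx)$ on $[0,\infty)\times\mathbb R^d$. Compound Poisson process with event intensity measure $\lambda$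 (locally finite) and increment probability kernel $K$: the process $$X_t=\int_{[0,t]\times\mathbb R^d}x\,\eta(ds,dx),\qquad t\in[0,\infty),$$ where $\eta$ is a point pattern on $[0,\infty)\times\mathbb R^d$ sampled from $P_{\lambda\otimes K}$; $P_{\lambda\otimes K}$-almost surely $\eta([0,t]\times\mathbb R^d)<\infty$ for all $t$, so the integral is well defined almost surely. Its law $\mathcal L(X)$ is the pushforward of $P_{\lambda\otimes K}$ under $\eta\mapsto X$, a probability measure on the set of right-continuous piecewise constant functions $[0,\infty)\to\mathbb R^d$ equipped with the sigma-algebra generated by the evaluation maps $X\mapsto X_t$. Conventions: for $\alpha>1$, $f^\alpha g^{1-\alpha}$ is read as $\frac{f^\alpha}{g^{\alpha-1}}$; $\frac00=0$ and $\frac t0=\infty$ for $t>0$; $t\log\frac t0=\infty$ for $t>0$; $0\log\frac0t=0$ for $t\ge0$. Tsallis divergence of sigma-finite measures $\Lambda,\Lambda'$ with densities $f,g$ with respect to a sigma-finite measure $\nu$ (the value does not depend on the choice): $T_\alpha(\Lambda\|\Lambda')=\int\frac{\alpha f+(1-\alpha)g-f^\alpha g^{1-\alpha}}{1-\alpha}\,d\nu$ for $\alpha\notin\{0,1\}$; $T_1(\Lambda\|\Lambda')=\int\left(f\log\frac fg+g-f\right)d\nu$. R\'enyi divergence of probability measures $P,Q$ with densities $p,q$ with respect to a sigma-finite measure $m$ (the value does not depend on the choice), same conventions: $R_\alpha(P\|Q)=\frac1{\alpha-1}\log\int p^\alpha q^{1-\alpha}\,dm$ for $\alpha\notin\{0,1\}$;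 $R_1(P\|Q)=\int p\log\frac pq\,dm$. *)

theory Defs
  imports "HOL-Probability.Probability"
begin

text \<open>A finite sum of finite measures is covered by padding with null measures.\<close>

definition point_patterns :: "'a measure \<Rightarrow> 'a measure set" where
  "point_patterns S = {\<eta>. sets \<eta> = sets S \<and>
     (\<exists>\<xi> :: nat \<Rightarrow> 'a measure.
        (\<forall>i. sets (\<xi> i) = sets S \<and> finite_measure (\<xi> i) \<and>
             (\<forall>B\<in>sets S. \<exists>k :: nat. emeasure (\<xi> i) B = of_nat k)) \<and>
        (\<forall>B\<in>sets S. emeasure \<eta> B = (\<Sum>i. emeasure (\<xi> i) B)))}"

definition point_pattern_space :: "'a measure \<Rightarrow> 'a measure measure" where
  "point_pattern_space S =
     (SUP B\<in>sets S. vimage_algebra (point_patterns S) (\<lambda>\<eta>. emeasure \<eta> B) borel)"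

definition poisson_distr :: "ennreal \<Rightarrow> ennreal measure" where
  "poisson_distr r =
     (if r = 0 then return borel 0
      else if r = \<infinity> then return borel \<infinity>
      else distr (measure_pmf (poisson_pmf (enn2real r))) borel of_nat)"

definition is_poisson_pp_distr :: "'a measure \<Rightarrow> 'a measure measure \<Rightarrow> bool" where
  "is_poisson_pp_distr \<Lambda> P \<longleftrightarrow>
     prob_space P \<and> sets P = sets (point_pattern_space \<Lambda>) \<and>
     (\<forall>(n :: nat) B. (\<forall>i<n. B i \<in> sets \<Lambda>) \<longrightarrow> disjoint_family_on B {..<n} \<longrightarrow>
        prob_space.indep_vars P (\<lambda>_. borel) (\<lambda>i \<eta>. emeasure \<eta> (B i)) {..<n}) \<and>
     (\<forall>B\<in>sets \<Lambda>. distr P borel (\<lambda>\<eta>. emeasure \<eta> B) = poisson_distr (emeasure \<Lambda> B))"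

definition poisson_pp_distr :: "'a measure \<Rightarrow> 'a measure measure" where
  "poisson_pp_distr \<Lambda> = (THE P. is_poisson_pp_distr \<Lambda> P)"

definition kernel_prod :: "'a measure \<Rightarrow> 'b measure \<Rightarrow> ('a \<Rightarrow> 'b measure) \<Rightarrow> ('a \<times> 'b) measure" where
  "kernel_prod M N K =
     measure_of (space (M \<Otimes>\<^sub>M N)) (sets (M \<Otimes>\<^sub>M N))
       (\<lambda>A. \<integral>\<^sup>+ t. emeasure (K t) (Pair t -` A) \<partial>M)"

lemma space_kernel_prod [simp]: "space (kernel_prod M N K) = space (M \<Otimes>\<^sub>M N)"
  unfolding kernel_prod_def by (rule space_measure_of) (rule sets.space_closed)

lemma sets_kernel_prod [simp, measurable_cong]: "sets (kernel_prod M N K) = sets (M \<Otimes>\<^sub>M N)"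
  unfolding kernel_prod_def by (rule sets.sets_measure_of_eq)

lemma emeasure_kernel_prod:
  assumes K [measurable]: "K \<in> M \<rightarrow>\<^sub>M prob_algebra N" and A: "A \<in> sets (M \<Otimes>\<^sub>M N)"
  shows "emeasure (kernel_prod M N K) A = (\<integral>\<^sup>+ t. emeasure (K t) (Pair t -` A) \<partial>M)"
proof (rule emeasure_measure_of[OF kernel_prod_def])
  have K': "K \<in> M \<rightarrow>\<^sub>M subprob_algebra N"
    using K by (rule measurable_prob_algebraD)
  have sets_K: "sets (K t) = sets N" if "t \<in> space M" for t
    using measurable_space[OF K' that] by (simp add: space_subprob_algebra)
  have meas: "(\<lambda>t. emeasure (K t) (Pair t -` A)) \<in> borel_measurable M"
    if "A \<in> sets (M \<Otimes>\<^sub>M N)" for A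
  proof (rule emeasure_measurable_subprob_algebra2[OF _ K'])
    have "(SIGMA t:space M. Pair t -` A) = A"
      using sets.sets_into_space[OF that] by (auto simp: space_pair_measure)
    then show "(SIGMA t:space M. Pair t -` A) \<in> sets (M \<Otimes>\<^sub>M N)"
      using that by simp
  qed
  show "countably_additive (sets (kernel_prod M N K))
          (\<lambda>A. \<integral>\<^sup>+ t. emeasure (K t) (Pair t -` A) \<partial>M)"
  proof (rule countably_additiveI)
    fix B :: "nat \<Rightarrow> _"
    assume B: "range B \<subseteq> sets (kernel_prod M N K)" "disjoint_family B"
    have "(\<Sum>i. \<integral>\<^sup>+ t. emeasure (K t) (Pair t -` B i) \<partial>M)
        = (\<integral>\<^sup>+ t. (\<Sum>i. emeasure (K t) (Pair t -` B i)) \<partial>M)"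
      using B by (intro nn_integral_suminf[symmetric] meas) auto
    also have "\<dots> = (\<integral>\<^sup>+ t. emeasure (K t) (\<Union>i. Pair t -` B i) \<partial>M)"
    proof (intro nn_integral_cong suminf_emeasure)
      fix t assume "t \<in> space M"
      then show "range (\<lambda>i. Pair t -` B i) \<subseteq> sets (K t)"
        using B sets_Pair1[of _ M N t] by (auto simp: sets_K)
      show "disjoint_family (\<lambda>i. Pair t -` B i)"
        using B(2) by (auto simp: disjoint_family_on_def)
    qed
    finally show "(\<Sum>i. \<integral>\<^sup>+ t. emeasure (K t) (Pair t -` B i) \<partial>M)
        = (\<integral>\<^sup>+ t. emeasure (K t) (Pair t -` \<Union> (range B)) \<partial>M)"
      by (simp add: vimage_UN)
  qed
qed (use A sets.space_closed in \<open>auto simp: positive_def\<close>)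

abbreviation time_axis :: "real measure" where
  "time_axis \<equiv> restrict_space borel {0..}"

text \<open>
  Paths are functions on \<open>[0,\<infinity>)\<close>, encoded as functions on the reals that are
  \<^const>\<open>undefined\<close> at negative arguments. Piecewise constant means that on every \<open>[0,T]\<close>
  there are only finitely many break points.
\<close>

definition step_paths :: "(real \<Rightarrow> 'a :: topological_space) set" where
  "step_paths = {x \<in> extensional {0..}.
     (\<forall>t\<ge>0. continuous (at_right t) x) \<and>
     (\<forall>T\<ge>0. \<exists>D. finite D \<and>
        (\<forall>s t. 0 \<le> s \<and> s \<le> t \<and> t \<le> T \<and> {s..t} \<inter> D = {} \<longrightarrow> x s = x t))}"

definition path_space :: "(real \<Rightarrow> 'a :: topological_space) measure" where
  "path_space = restrict_space (PiM {0..} (\<lambda>_. borel)) step_paths"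

text \<open>
  On the null event that \<open>\<eta>\<close> has infinitely many points in some \<open>[0,t] \<times> \<real>\<^sup>d\<close>, where the
  integral is not defined, the path is set to zero.
\<close>

definition compound_path ::
  "(real \<times> 'a :: euclidean_space) measure \<Rightarrow> real \<Rightarrow> 'a" where
  "compound_path \<eta> =
     (if \<forall>t\<ge>0. emeasure \<eta> ({0..t} \<times> UNIV) < \<infinity>
      then (\<lambda>t\<in>{0..}. LINT z:{0..t} \<times> UNIV|\<eta>. snd z)
      else (\<lambda>t\<in>{0..}. 0))"

definition compound_poisson_law ::
  "real measure \<Rightarrow> (real \<Rightarrow> 'a measure) \<Rightarrow> (real \<Rightarrow> 'a :: euclidean_space) measure" where
  "compound_poisson_law \<Lambda> K =
     distr (poisson_pp_distr (kernel_prod \<Lambda> borel K)) path_space compound_path"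

definition common_densities ::
  "'a measure \<Rightarrow> 'a measure \<Rightarrow> 'a measure \<Rightarrow> ('a \<Rightarrow> real) \<Rightarrow> ('a \<Rightarrow> real) \<Rightarrow> bool" where
  "common_densities P Q \<nu> f g \<longleftrightarrow>
     sigma_finite_measure \<nu> \<and>
     f \<in> borel_measurable \<nu> \<and> g \<in> borel_measurable \<nu> \<and>
     (\<forall>x\<in>space \<nu>. 0 \<le> f x \<and> 0 \<le> g x) \<and>
     density \<nu> f = P \<and> density \<nu> g = Q"

text \<open>
  Positive minus negative part. For the integrands below, at least one part is always finite.
\<close>

definition ext_integral :: "'a measure \<Rightarrow> ('a \<Rightarrow> ereal) \<Rightarrow> ereal" where
  "ext_integral M h =
     enn2ereal (\<integral>\<^sup>+ x. e2ennreal (h x) \<partial>M) - enn2ereal (\<integral>\<^sup>+ x. e2ennreal (- h x) \<partial>M)"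

text \<open>
  \<open>f\<^sup>\<alpha> g\<^sup>1\<^sup>-\<^sup>\<alpha>\<close> for \<open>\<alpha> > 0\<close> and \<open>f, g \<ge> 0\<close>. Division on \<^typ>\<open>ereal\<close> satisfies
  \<open>0 / 0 = 0\<close> and \<open>t / 0 = \<infinity>\<close> for \<open>t > 0\<close>.
\<close>

definition power_prod :: "real \<Rightarrow> real \<Rightarrow> real \<Rightarrow> ereal" where
  "power_prod \<alpha> f g =
     (if \<alpha> > 1 then ereal (f powr \<alpha>) / ereal (g powr (\<alpha> - 1))
      else ereal (f powr \<alpha> * g powr (1 - \<alpha>)))"

definition xlog_ratio :: "real \<Rightarrow> real \<Rightarrow> ereal" where
  "xlog_ratio f g =
     (if f = 0 then 0 else if g = 0 then \<infinity> else ereal (f * ln (f / g)))"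

definition ext_log :: "ereal \<Rightarrow> ereal" where
  "ext_log x =
     (if x = \<infinity> then \<infinity> else if x \<le> 0 then -\<infinity> else ereal (ln (real_of_ereal x)))"

definition tsallis_integrand :: "real \<Rightarrow> real \<Rightarrow> real \<Rightarrow> ereal" where
  "tsallis_integrand \<alpha> f g =
     (if \<alpha> = 1 then xlog_ratio f g + ereal g - ereal f
      else (ereal (\<alpha> * f + (1 - \<alpha>) * g) - power_prod \<alpha> f g) / ereal (1 - \<alpha>))"

text \<open>
  The value does not depend on the choice of the dominating measure and the densities, which
  justifies the definite description below. The definitions are meant for \<open>\<alpha> > 0\<close>, for
  sigma-finite measures in the Tsallis case and probability measures in the Renyi case.
\<close>

definition tsallis_div :: "real \<Rightarrow> 'a measure \<Rightarrow> 'a measure \<Rightarrow> ereal" where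
  "tsallis_div \<alpha> P Q =
     (THE r. \<exists>\<nu> f g. common_densities P Q \<nu> f g \<and>
        r = ext_integral \<nu> (\<lambda>x. tsallis_integrand \<alpha> (f x) (g x)))"

definition renyi_div :: "real \<Rightarrow> 'a measure \<Rightarrow> 'a measure \<Rightarrow> ereal" where
  "renyi_div \<alpha> P Q =
     (THE r. \<exists>m p q. common_densities P Q m p q \<and>
        r = (if \<alpha> = 1 then ext_integral m (\<lambda>x. xlog_ratio (p x) (q x))
             else ereal (1 / (\<alpha> - 1)) * ext_log (ext_integral m (\<lambda>x. power_prod \<alpha> (p x) (q x)))))"

end

theory Submission
  imports Defs "HOL-Real_Asymp.Real_Asymp"
begin

text \<open>
  The Tsallis integrand is the supremum of its tangent planes. Hence the Tsallis divergence of finite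
  measures is the supremum, over finite partitions from any generating algebra, of the divergences
  of the discretised measures, and for probability measures the Renyi divergence is an increasing
  function of it. An algebra generating the point pattern space consists of the events that depend
  on the counts of finitely many disjoint sets. Under both Poisson laws these counts are vectors of
  independent Poisson variables, for which a direct computation turns Renyi into Tsallis divergence.
  This proves the identity for the Poisson point processes.
  It passes to the compound Poisson processes because the path almost surely determines every count:
  by diffuseness, sufficiently fine dyadic cells of a time interval contain at most one point each,
  and as there are no jumps of size zero, the nonzero increments over the cells list the points.
\<close>

section \<open>Divergences as suprema over partitions\<close>

text \<open>Both divergences are defined through densities, but two Poisson laws with infinite
  intensities, let alone their path laws, have no convenient ones: the laws may be partly singular
  and the divergence infinite. Partition sums mention neither a dominating measure nor absolute
  continuity, and they turn a pushforward into a smaller algebra of events. They are formed with the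
  Tsallis integrand even for the Poisson laws: it is nonnegative, convex and homogeneous of degree
  one, so Jensen's inequality works piece by piece for every \<alpha> > 0, while the Renyi
  divergence is in general not additive over pieces. The Tsallis divergence of the intensities
  originates in one formula: Poisson laws with means a and b have the Hellinger integral exp (c -
  \<alpha> a - (1 - \<alpha>) b) with \<open>c = a powr \<alpha> * b powr (1 - \<alpha>)\<close>,
  and the exponent is \<alpha> - 1 times the Tsallis integrand at (a, b). An algebra need only
  approximate events up to sets small under both laws, so almost sure identities suffice to pass
  from patterns to paths. Poisson laws and divergences are definite descriptions, which is why
  existence, uniqueness and independence of the densities are proved as well.\<close>

definition tangent_fst :: "real \<Rightarrow> real \<Rightarrow> real" where
  "tangent_fst \<alpha> s = (if \<alpha> = 1 then ln s else \<alpha> * (1 - s powr (\<alpha> - 1)) / (1 - \<alpha>))"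

text \<open>The plane that touches the integrand along the ray x / y = s. Its coefficients are the
  partial derivatives there, and it has no constant term because the integrand is homogeneous of
  degree one. The value \<open>ln s\<close> of \<open>tangent_fst\<close> at \<alpha> = 1 is the
  limit of the other formula.\<close>

definition tangent :: "real \<Rightarrow> real \<Rightarrow> real \<Rightarrow> real \<Rightarrow> real" where
  "tangent \<alpha> s x y = tangent_fst \<alpha> s * x + (1 - s powr \<alpha>) * y"

definition tsallis_fun :: "real \<Rightarrow> real \<Rightarrow> real \<Rightarrow> ennreal" where
  "tsallis_fun \<alpha> x y = e2ennreal (tsallis_integrand \<alpha> x y)"

lemma tsallis_integrand_0_left: "0 < \<alpha> \<Longrightarrow> tsallis_integrand \<alpha> 0 y = ereal y"
  by (auto simp: tsallis_integrand_def xlog_ratio_def power_prod_def zero_ereal_def[symmetric])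

lemma tsallis_integrand_0_right:
  "0 < \<alpha> \<Longrightarrow> 0 < x \<Longrightarrow>
    tsallis_integrand \<alpha> x 0 = (if \<alpha> < 1 then ereal (\<alpha> * x / (1 - \<alpha>)) else \<infinity>)"
  by (auto simp: tsallis_integrand_def xlog_ratio_def power_prod_def divide_ereal_def divide_inverse)

lemma tsallis_integrand_pos:
  assumes "0 < x" "0 < y"
  shows "tsallis_integrand \<alpha> x y = ereal (if \<alpha> = 1 then x * ln (x / y) + y - x
    else (\<alpha> * x + (1 - \<alpha>) * y - x powr \<alpha> * y powr (1 - \<alpha>)) / (1 - \<alpha>))"
proof -
  have "y powr (1 - \<alpha>) = inverse (y powr (\<alpha> - 1))"
    using assms by (simp add: powr_minus[symmetric])
  then show ?thesis
    using assms by (auto simp: tsallis_integrand_def xlog_ratio_def power_prod_def divide_ereal_def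
        divide_inverse)
qed

text \<open>Weighted arithmetic-geometric mean inequality for u and 1.\<close>

lemma powr_le_tangent:
  fixes u :: real
  assumes "0 < u" "0 < \<alpha>" "\<alpha> \<le> 1"
  shows "u powr \<alpha> \<le> \<alpha> * u + (1 - \<alpha>)"
  using Youngs_inequality_0[of \<alpha> "1 - \<alpha>" u 1] assms by simp

text \<open>The concave case with exponent 1 / \<alpha>, applied at the point
  \<open>u powr \<alpha>\<close> and multiplied by \<alpha>.\<close>

lemma powr_ge_tangent:
  fixes u :: real
  assumes "0 < u" "1 \<le> \<alpha>"
  shows "\<alpha> * u + (1 - \<alpha>) \<le> u powr \<alpha>"
proof -
  have "(u powr \<alpha>) powr (1 / \<alpha>) \<le> (1 / \<alpha>) * (u powr \<alpha>) + (1 - 1 / \<alpha>)"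
    using assms by (intro powr_le_tangent) auto
  then have "u \<le> (1 / \<alpha>) * (u powr \<alpha>) + (1 - 1 / \<alpha>)"
    using assms by (simp add: powr_powr)
  then have "\<alpha> * u \<le> \<alpha> * ((1 / \<alpha>) * (u powr \<alpha>) + (1 - 1 / \<alpha>))"
    using assms by (intro mult_left_mono) auto
  then show ?thesis using assms by (simp add: algebra_simps)
qed

text \<open>A convex function lies above its tangent planes. On the axes the conventions for
  division by zero give the value of the integrand; inside the quadrant homogeneity leaves one
  variable, with the logarithm inequality for \<alpha> = 1 and the two power inequalities
  otherwise.\<close>

lemma tangent_le:
  assumes "0 < \<alpha>" "0 < s" "0 \<le> x" "0 \<le> y"
  shows "ereal (tangent \<alpha> s x y) \<le> tsallis_integrand \<alpha> x y"
proof -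
  consider "x = 0" | "0 < x" "y = 0" | "0 < x" "0 < y"
    using assms by linarith
  then show ?thesis
  proof cases
    case 1
    then show ?thesis
      using assms by (simp add: tsallis_integrand_0_left tangent_def algebra_simps)
  next
    case 2
    have "\<alpha> * (1 - s powr (\<alpha> - 1)) * x / (1 - \<alpha>) \<le> \<alpha> * x / (1 - \<alpha>)" if "\<alpha> < 1"
      using that assms by (intro divide_right_mono) (auto simp: algebra_simps)
    with 2 show ?thesis
      using assms by (auto simp: tsallis_integrand_0_right tangent_def tangent_fst_def)
  next
    case 3
    show ?thesis
    proof (cases "\<alpha> = 1")
      case True
      have "ln (s * y / x) \<le> s * y / x - 1"
        using 3 assms by (intro ln_le_minus_one) auto
      then have "x * ln (s * y / x) \<le> x * (s * y / x - 1)"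
        using 3 by (intro mult_left_mono) auto
      then have "x * ln (s * y / x) \<le> s * y - x"
        using 3 by (simp add: algebra_simps)
      then have "tangent \<alpha> s x y \<le> x * ln (x / y) + y - x"
        using True 3 assms by (simp add: tangent_def tangent_fst_def ln_mult ln_div algebra_simps)
      then show ?thesis
        using True 3 by (simp add: tsallis_integrand_pos)
    next
      case False
      \<comment> \<open>u compares the ratio x / y with the ratio s of the touching ray. The gap
        between integrand and plane is a positive multiple of a one-variable gap at u, which
        vanishes at u = 1.\<close>
      define u where "u = x / (s * y)"
      have u: "0 < u" and x: "x = u * s * y" using 3 assms by (auto simp: u_def)
      let ?c = "s powr \<alpha> * y"
      have c: "0 < ?c" using 3 assms by auto
      have 1: "x powr \<alpha> * y powr (1 - \<alpha>) = ?c * u powr \<alpha>"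
        using u 3 assms by (simp add: x powr_mult powr_diff)
      have 2: "s powr (\<alpha> - 1) * x = ?c * u"
        using assms by (simp add: x powr_diff)
      have "(\<alpha> * x + (1 - \<alpha>) * y - x powr \<alpha> * y powr (1 - \<alpha>)) / (1 - \<alpha>) - tangent \<alpha> s x y
          = (?c * (\<alpha> * u + (1 - \<alpha>) - u powr \<alpha>)) / (1 - \<alpha>)"
      proof -
        have "tangent \<alpha> s x y = (\<alpha> * x - \<alpha> * (s powr (\<alpha> - 1) * x)) / (1 - \<alpha>) + y - ?c"
          using False by (simp add: tangent_def tangent_fst_def algebra_simps)
        then show ?thesis
          unfolding 1 2 using False by (simp add: divide_simps) (simp add: algebra_simps)
      qed
      also have "\<dots> \<ge> 0"
      proof (cases "\<alpha> < 1")
        case True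
        then show ?thesis
          using powr_le_tangent[OF u, of \<alpha>] assms c by (intro divide_nonneg_pos mult_nonneg_nonneg) auto
      next
        case F: False
        then show ?thesis
          using powr_ge_tangent[OF u, of \<alpha>] assms c False
          by (intro divide_nonpos_neg mult_nonneg_nonpos) auto
      qed
      finally show ?thesis
        using False 3 by (simp add: tsallis_integrand_pos)
    qed
  qed
qed

text \<open>Euler's identity for homogeneous functions: the plane with s = x / y meets the integrand
  at (x, y).\<close>

lemma tangent_touch:
  assumes "0 < x" "0 < y"
  shows "tsallis_integrand \<alpha> x y = ereal (tangent \<alpha> (x / y) x y)"
proof -
  have "(x / y) powr (\<alpha> - 1) * x = x powr \<alpha> * y powr (1 - \<alpha>)"
    "(x / y) powr \<alpha> * y = x powr \<alpha> * y powr (1 - \<alpha>)"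
    using assms by (simp_all add: powr_divide powr_diff)
  then have *: "x * (x / y) powr (\<alpha> - 1) = x powr \<alpha> * y powr (1 - \<alpha>)"
    "y * (x / y) powr \<alpha> = x powr \<alpha> * y powr (1 - \<alpha>)"
    by (simp_all add: mult.commute)
  have **: "tangent \<alpha> (x / y) x y = \<alpha> * (x - x * (x / y) powr (\<alpha> - 1)) / (1 - \<alpha>) + (y - y * (x / y) powr \<alpha>)"
    if "\<alpha> \<noteq> 1"
    using that by (simp add: tangent_def tangent_fst_def algebra_simps)
  show ?thesis
  proof (cases "\<alpha> = 1")
    case True
    then show ?thesis using assms
      by (simp add: tsallis_integrand_pos tangent_def tangent_fst_def algebra_simps)
  next
    case False
    then show ?thesis
      unfolding **[OF False] * using assms
      by (simp add: tsallis_integrand_pos * divide_simps) (simp add: algebra_simps)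
  qed
qed

text \<open>Countably many planes suffice, so that suprema stay measurable and are exhausted by
  finite maxima.\<close>

abbreviation pos_rats :: "real set" where "pos_rats \<equiv> {s \<in> \<rat>. 0 < s}"

lemma isCont_tangent: "0 < s \<Longrightarrow> isCont (\<lambda>s. tangent \<alpha> s x y) s"
  unfolding tangent_def tangent_fst_def by (cases "\<alpha> = 1") (auto intro!: continuous_intros)

text \<open>The planes depend continuously on s, and the rationals are dense.\<close>

lemma SUP_pos_rats_tangent:
  assumes "0 < s"
  shows "ennreal (tangent \<alpha> s x y) \<le> (SUP s\<in>pos_rats. ennreal (tangent \<alpha> s x y))" (is "_ \<le> ?S")
proof (rule dense_le)
  fix z assume "z < ennreal (tangent \<alpha> s x y)"
  have "isCont (\<lambda>s. ennreal (tangent \<alpha> s x y)) s"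
    using isCont_tangent[OF assms, of \<alpha> x y] by (auto simp: isCont_def intro!: tendsto_ennrealI)
  then have "((\<lambda>s. ennreal (tangent \<alpha> s x y)) \<longlongrightarrow> ennreal (tangent \<alpha> s x y)) (nhds s)"
    using tendsto_at_iff_tendsto_nhds[of "\<lambda>s. ennreal (tangent \<alpha> s x y)" s] by (simp add: isCont_def)
  then have "\<forall>\<^sub>F s in nhds s. z < ennreal (tangent \<alpha> s x y)"
    using \<open>z < _\<close> by (rule order_tendstoD)
  moreover have "\<forall>\<^sub>F s in nhds s. 0 < s"
    using eventually_nhds_in_open[of "{0<..}" s] assms by simp
  ultimately have "\<forall>\<^sub>F s in nhds s. z < ennreal (tangent \<alpha> s x y) \<and> 0 < s"
    by eventually_elim simp
  then obtain d where d: "0 < d" "\<And>r. \<bar>r - s\<bar> < d \<Longrightarrow> z < ennreal (tangent \<alpha> r x y) \<and> 0 < r"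
    by (auto simp: eventually_nhds_metric dist_real_def)
  obtain r where "r \<in> \<rat>" "s < r" "r < s + d"
    using Rats_dense_in_real[of s "s + d"] d by auto
  then show "z \<le> ?S"
    using d(2)[of r] by (intro SUP_upper2[of r]) auto
qed

text \<open>For the points of the axes other than the origin, which no plane with positive s
  touches: there the value is approached only as s tends to 0 or to infinity.\<close>

lemma tendsto_le_SUP_tangent:
  assumes "((\<lambda>s. tangent \<alpha> s x y) \<longlongrightarrow> l) F" "\<forall>\<^sub>F s in F. 0 < s" "F \<noteq> bot"
  shows "ennreal l \<le> (SUP s\<in>pos_rats. ennreal (tangent \<alpha> s x y))"
proof (rule tendsto_upperbound)
  show "((\<lambda>s. ennreal (tangent \<alpha> s x y)) \<longlongrightarrow> ennreal l) F"
    using assms(1) by (rule tendsto_ennrealI)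
  show "\<forall>\<^sub>F s in F. ennreal (tangent \<alpha> s x y) \<le> (SUP s\<in>pos_rats. ennreal (tangent \<alpha> s x y))"
    using assms(2) by eventually_elim (rule SUP_pos_rats_tangent)
qed fact

text \<open>Interior points are touched by the plane of their own ray; points of the axes are
  reached in the limit. \<open>ennreal\<close> cuts the planes off at 0, which keeps them below the
  integrand because the latter is nonnegative.\<close>

lemma tsallis_fun_eq_SUP:
  assumes "0 < \<alpha>" "0 \<le> x" "0 \<le> y"
  shows "tsallis_fun \<alpha> x y = (SUP s\<in>pos_rats. ennreal (tangent \<alpha> s x y))" (is "_ = ?S")
proof (rule antisym)
  show "?S \<le> tsallis_fun \<alpha> x y"
    unfolding tsallis_fun_def ennreal.abs_eq[symmetric]
    using tangent_le[OF assms(1) _ assms(2,3)]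
    by (intro SUP_least) (metis (mono_tags, lifting) e2ennreal_ereal e2ennreal_mono mem_Collect_eq ennreal.abs_eq)
  consider "x = 0" | "0 < x" "y = 0" | "0 < x" "0 < y"
    using assms by linarith
  then show "tsallis_fun \<alpha> x y \<le> ?S"
  proof cases
    case 1
    have "((\<lambda>s. s powr \<alpha>) \<longlongrightarrow> 0) (at_right 0)"
      using assms(1) by (intro tendsto_zero_powrI[where b = \<alpha>] tendsto_intros) (auto simp: eventually_at_right_less eventually_at_filter)
    then have "((\<lambda>s. tangent \<alpha> s x y) \<longlongrightarrow> y) (at_right 0)"
      unfolding tangent_def 1
      using tendsto_mult[OF tendsto_diff[OF tendsto_const] tendsto_const, of _ 0 _ 1 y] by simp
    from tendsto_le_SUP_tangent[OF this] 1 show ?thesis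
      using assms by (simp add: tsallis_fun_def tsallis_integrand_0_left e2ennreal_ereal eventually_at_right_less)
  next
    case 2
    show ?thesis
    proof (cases "\<alpha> < 1")
      case True
      have "((\<lambda>s. s powr (\<alpha> - 1)) \<longlongrightarrow> 0) at_top"
        using True by (intro tendsto_neg_powr filterlim_ident) auto
      then have "((\<lambda>s. tangent \<alpha> s x y) \<longlongrightarrow> \<alpha> * (1 - 0) / (1 - \<alpha>) * x) at_top"
        unfolding tangent_def tangent_fst_def using 2 True
          tendsto_mult[OF tendsto_diff[OF tendsto_const] tendsto_const, of _ 0 _ 1 "\<alpha> / (1 - \<alpha>) * x"]
        by (simp add: mult_ac)
      from tendsto_le_SUP_tangent[OF this] 2 True show ?thesis
        using assms by (simp add: tsallis_fun_def tsallis_integrand_0_right e2ennreal_ereal eventually_gt_at_top)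
    next
      case False
      \<comment> \<open>For \<alpha> \<ge> 1 the slope in x is unbounded as s grows, in accordance
        with the value \<infinity> where y = 0 < x.\<close>
      have "filterlim (\<lambda>s. tangent_fst \<alpha> s * x) at_top at_top"
      proof (cases "\<alpha> = 1")
        case True
        then show ?thesis unfolding tangent_fst_def using 2
          by (simp add: filterlim_at_top_mult_tendsto_pos[OF tendsto_const _ ln_at_top])
      next
        case F: False
        have "filterlim (\<lambda>s::real. s powr (\<alpha> - 1)) at_top at_top"
          using False F by real_asymp
        then have "filterlim (\<lambda>s::real. (\<alpha> / (\<alpha> - 1) * x) * (- 1 + s powr (\<alpha> - 1))) at_top at_top"
          using False F 2 by (intro filterlim_tendsto_pos_mult_at_top[OF tendsto_const] 
              filterlim_tendsto_add_at_top[OF tendsto_const]) auto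
        also have "(\<lambda>s::real. (\<alpha> / (\<alpha> - 1) * x) * (- 1 + s powr (\<alpha> - 1))) = (\<lambda>s. tangent_fst \<alpha> s * x)"
          using False F by (auto simp: tangent_fst_def fun_eq_iff divide_simps) (simp_all add: algebra_simps)
        finally show ?thesis .
      qed
      then have *: "\<forall>\<^sub>F s in at_top. Z \<le> tangent \<alpha> s x y" for Z
        using 2 by (simp add: filterlim_at_top tangent_def)
      have "ennreal (real n) \<le> ?S" for n
      proof -
        have "\<forall>\<^sub>F s in at_top. real n \<le> tangent \<alpha> s x y \<and> 0 < s"
          using *[of n] eventually_gt_at_top[of 0] by eventually_elim simp
        then obtain s where "real n \<le> tangent \<alpha> s x y" "0 < s"
          by (auto simp: eventually_at_top_linorder)
        then show ?thesis
          using SUP_pos_rats_tangent[of s \<alpha> x y] by (meson ennreal_leI order.trans)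
      qed
      then have "?S = \<top>"
        by (metis ennreal_Ex_less_of_nat ennreal_of_nat_eq_real_of_nat less_top leD)
      then show ?thesis by (simp only: top_greatest)
    qed
  next
    case 3
    then show ?thesis
      using SUP_pos_rats_tangent[of "x / y" \<alpha> x y]
      by (simp add: tsallis_fun_def tangent_touch e2ennreal_ereal)
  qed
qed

lemma tangent_le_tsallis_fun:
  "\<lbrakk>0 < \<alpha>; 0 < s; 0 \<le> x; 0 \<le> y\<rbrakk> \<Longrightarrow> ennreal (tangent \<alpha> s x y) \<le> tsallis_fun \<alpha> x y"
  using SUP_pos_rats_tangent by (simp add: tsallis_fun_eq_SUP)

lemma measurable_tangent [measurable]:
  "f \<in> borel_measurable M \<Longrightarrow> g \<in> borel_measurable M \<Longrightarrow>
    (\<lambda>x. tangent \<alpha> s (f x) (g x)) \<in> borel_measurable M"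
  unfolding tangent_def by (intro borel_measurable_add borel_measurable_times borel_measurable_const)

section \<open>Integrals of tangent planes and Jensen's inequality\<close>

lemma ennreal_integral_le_nn_integral:
  fixes u :: "'a \<Rightarrow> real"
  assumes "integrable M u"
  shows "ennreal (integral\<^sup>L M u) \<le> (\<integral>\<^sup>+ x. ennreal (u x) \<partial>M)"
proof -
  have "ennreal (integral\<^sup>L M u) \<le> ennreal (\<integral> x. max 0 (u x) \<partial>M)"
    using assms by (intro ennreal_leI integral_mono integrable_max) auto
  also have "\<dots> = (\<integral>\<^sup>+ x. ennreal (max 0 (u x)) \<partial>M)"
    using assms by (intro nn_integral_eq_integral[symmetric] integrable_max) auto
  also have "\<dots> = (\<integral>\<^sup>+ x. ennreal (u x) \<partial>M)"
    by (simp add: ennreal_max_0)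
  finally show ?thesis .
qed

lemma has_bochner_integral_density_indicator:
  fixes f :: "'a \<Rightarrow> real"
  assumes f: "f \<in> borel_measurable M" "\<And>x. x \<in> space M \<Longrightarrow> 0 \<le> f x"
    and B: "B \<in> sets M" "emeasure (density M f) B < \<infinity>"
  shows "has_bochner_integral M (\<lambda>x. f x * indicator B x) (measure (density M f) B)"
proof (rule has_bochner_integral_nn_integral)
  show "(\<integral>\<^sup>+ x. ennreal (f x * indicator B x) \<partial>M) = ennreal (measure (density M f) B)"
    using B f(1) by (subst emeasure_eq_ennreal_measure[symmetric])
      (auto simp: emeasure_density less_top intro!: nn_integral_cong split: split_indicator)
qed (use assms in \<open>auto simp: indicator_def\<close>)

text \<open>Planes are linear, so integrating one over B along the densities evaluates it at the two
  measures of B; these are finite, hence the integral exists.\<close>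

lemma has_bochner_integral_tangent:
  assumes "common_densities P Q \<nu> f g" and B: "B \<in> sets \<nu>" "emeasure P B < \<infinity>" "emeasure Q B < \<infinity>"
  shows "has_bochner_integral \<nu> (\<lambda>x. tangent \<alpha> s (f x) (g x) * indicator B x)
    (tangent \<alpha> s (measure P B) (measure Q B))"
proof -
  have "has_bochner_integral \<nu> (\<lambda>x. f x * indicator B x) (measure P B)"
    "has_bochner_integral \<nu> (\<lambda>x. g x * indicator B x) (measure Q B)"
    using assms has_bochner_integral_density_indicator[of _ \<nu> B] by (auto simp: common_densities_def)
  from has_bochner_integral_add[OF has_bochner_integral_mult_right[OF this(1), of "tangent_fst \<alpha> s"]
      has_bochner_integral_mult_right[OF this(2), of "1 - s powr \<alpha>"]]
  show ?thesis
    by (simp add: tangent_def algebra_simps)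
qed

text \<open>Jensen's inequality: each plane integrates to its value at the measures of B, and the
  supremum over the planes is taken afterwards.\<close>

lemma tsallis_fun_measure_le:
  assumes "0 < \<alpha>" and PQ: "common_densities P Q \<nu> f g"
    and B: "B \<in> sets \<nu>" "emeasure P B < \<infinity>" "emeasure Q B < \<infinity>"
  shows "tsallis_fun \<alpha> (measure P B) (measure Q B) \<le> (\<integral>\<^sup>+x\<in>B. tsallis_fun \<alpha> (f x) (g x) \<partial>\<nu>)"
proof -
  have "ennreal (tangent \<alpha> s (measure P B) (measure Q B)) \<le> (\<integral>\<^sup>+x\<in>B. tsallis_fun \<alpha> (f x) (g x) \<partial>\<nu>)"
    if "0 < s" for s
  proof -
    note h = has_bochner_integral_tangent[OF PQ B, of \<alpha> s]
    have "ennreal (tangent \<alpha> s (measure P B) (measure Q B)) =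
        ennreal (\<integral>x. tangent \<alpha> s (f x) (g x) * indicator B x \<partial>\<nu>)"
      using h by (simp add: has_bochner_integral_iff)
    also have "\<dots> \<le> (\<integral>\<^sup>+x. ennreal (tangent \<alpha> s (f x) (g x) * indicator B x) \<partial>\<nu>)"
      using h by (intro ennreal_integral_le_nn_integral) (simp add: has_bochner_integral_iff)
    also have "\<dots> \<le> (\<integral>\<^sup>+x\<in>B. tsallis_fun \<alpha> (f x) (g x) \<partial>\<nu>)"
      using assms that by (intro nn_integral_mono)
        (auto simp: common_densities_def split: split_indicator intro!: tangent_le_tsallis_fun)
    finally show ?thesis .
  qed
  then show ?thesis
    using assms(1) by (subst tsallis_fun_eq_SUP) (auto intro!: SUP_least)
qed

section \<open>Partition sums\<close>

lemma mult_le_abs_mult: "\<bar>z\<bar> \<le> d \<Longrightarrow> c * z \<le> \<bar>c\<bar> * (d :: real)"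
  by (rule order.trans[OF abs_ge_self]) (simp add: abs_mult mult_left_mono)

lemma ennreal_add_le: "0 \<le> b \<Longrightarrow> ennreal (a + b) \<le> ennreal a + ennreal b"
  by (cases "0 \<le> a") (auto simp: ennreal_neg intro!: ennreal_leI)

text \<open>The pieces need not cover the space, since further pieces only add nonnegative terms.
  Thus \<A> may consist of sets of finite measure only, on which the real-valued
  \<open>measure\<close> is faithful.\<close>

definition partition_div :: "real \<Rightarrow> 'a set set \<Rightarrow> 'a measure \<Rightarrow> 'a measure \<Rightarrow> ennreal" where
  "partition_div \<alpha> \<A> P Q =
    (SUP (n, B)\<in>{(n :: nat, B). (\<forall>i<n. B i \<in> \<A>) \<and> disjoint_family_on B {..<n}}.
       \<Sum>i<n. tsallis_fun \<alpha> (measure P (B i)) (measure Q (B i)))"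

lemma partition_div_upper:
  fixes n :: nat
  assumes "\<And>i. i < n \<Longrightarrow> B i \<in> \<A>" "disjoint_family_on B {..<n}"
  shows "(\<Sum>i<n. tsallis_fun \<alpha> (measure P (B i)) (measure Q (B i))) \<le> partition_div \<alpha> \<A> P Q"
  unfolding partition_div_def by (rule SUP_upper2[of "(n, B)"]) (use assms in auto)

lemma partition_div_least:
  assumes "\<And>(n :: nat) B. (\<And>i. i < n \<Longrightarrow> B i \<in> \<A>) \<Longrightarrow> disjoint_family_on B {..<n} \<Longrightarrow>
     (\<Sum>i<n. tsallis_fun \<alpha> (measure P (B i)) (measure Q (B i))) \<le> C"
  shows "partition_div \<alpha> \<A> P Q \<le> C"
  unfolding partition_div_def by (rule SUP_least) (use assms in auto)

lemma partition_div_mono: "\<A> \<subseteq> \<B> \<Longrightarrow> partition_div \<alpha> \<A> P Q \<le> partition_div \<alpha> \<B> P Q"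
  by (intro partition_div_least partition_div_upper) auto

text \<open>Jensen's inequality on each piece, added up over the disjoint pieces.\<close>

lemma partition_div_le_nn_integral:
  assumes "0 < \<alpha>" and PQ: "common_densities P Q \<nu> f g"
    and \<A>: "\<And>B. B \<in> \<A> \<Longrightarrow> B \<in> sets P \<and> emeasure P B < \<infinity> \<and> emeasure Q B < \<infinity>"
  shows "partition_div \<alpha> \<A> P Q \<le> (\<integral>\<^sup>+x. tsallis_fun \<alpha> (f x) (g x) \<partial>\<nu>)"
proof (rule partition_div_least)
  fix n :: nat and B assume B: "\<And>i. i < n \<Longrightarrow> B i \<in> \<A>" "disjoint_family_on B {..<n}"
  have [measurable]: "f \<in> borel_measurable \<nu>" "g \<in> borel_measurable \<nu>" and sets: "sets P = sets \<nu>"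
    using PQ by (auto simp: common_densities_def)
  have [measurable]: "B i \<in> sets \<nu>" if "i < n" for i using \<A> B(1)[OF that] sets by auto
  have meas [measurable]: "(\<lambda>x. tsallis_fun \<alpha> (f x) (g x)) \<in> borel_measurable \<nu>"
  proof -
    have "(\<lambda>x. SUP s\<in>pos_rats. ennreal (tangent \<alpha> s (f x) (g x))) \<in> borel_measurable \<nu>"
      by (intro borel_measurable_SUP) (auto intro: countable_rat countable_subset)
    then show ?thesis
      using PQ assms(1) by (subst measurable_cong[where g="\<lambda>x. SUP s\<in>pos_rats. ennreal (tangent \<alpha> s (f x) (g x))"])
         (auto simp: common_densities_def tsallis_fun_eq_SUP)
  qed
  have "(\<Sum>i<n. tsallis_fun \<alpha> (measure P (B i)) (measure Q (B i)))
      \<le> (\<Sum>i<n. \<integral>\<^sup>+x\<in>B i. tsallis_fun \<alpha> (f x) (g x) \<partial>\<nu>)"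
    using assms(1) B(1) \<A> sets by (intro sum_mono tsallis_fun_measure_le[OF _ PQ]) auto
  also have "\<dots> = (\<integral>\<^sup>+x. (\<Sum>i<n. tsallis_fun \<alpha> (f x) (g x) * indicator (B i) x) \<partial>\<nu>)"
    by (intro nn_integral_sum[symmetric]) auto
  also have "\<dots> = (\<integral>\<^sup>+x. tsallis_fun \<alpha> (f x) (g x) * indicator (\<Union>i<n. B i) x \<partial>\<nu>)"
    using B(2) by (simp add: indicator_UN_disjoint sum_distrib_left)
  also have "\<dots> \<le> (\<integral>\<^sup>+x. tsallis_fun \<alpha> (f x) (g x) \<partial>\<nu>)"
    by (intro nn_integral_mono) (auto split: split_indicator)
  finally show "(\<Sum>i<n. tsallis_fun \<alpha> (measure P (B i)) (measure Q (B i))) \<le> \<dots>" .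
qed

section \<open>Attaining the integral by partitions from an approximating algebra\<close>

lemma SUP_ennreal_le_sum_argmax:
  fixes l :: "nat \<Rightarrow> real"
  shows "(SUP k\<in>{..<n}. ennreal (l k)) \<le>
    (\<Sum>k<n. ennreal (l k) * of_bool (0 < l k \<and> (\<forall>j<n. l j \<le> l k) \<and> (\<forall>j<k. l j < l k)))"
proof (rule SUP_least)
  fix i assume "i \<in> {..<n}"
  define m where "m = Max (l ` {..<n})"
  have m: "l j \<le> m" if "j < n" for j using that by (auto simp: m_def)
  have "m \<in> l ` {..<n}" unfolding m_def using \<open>i \<in> _\<close> by (intro Max_in) auto
  then have ex: "\<exists>k. k < n \<and> l k = m" by auto
  define k where "k = (LEAST k. k < n \<and> l k = m)"
  have k: "k < n" "l k = m" using LeastI_ex[OF ex] by (auto simp: k_def)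
  \<comment> \<open>k is the least index of a maximum. This tie-break lets at most one summand
    survive, and later makes the sets on which different planes win disjoint.\<close>
  have k': "l j < l k" if "j < k" for j
    using not_less_Least[of j "\<lambda>k. k < n \<and> l k = m"] that m[of j] k unfolding k_def[symmetric] by force
  show "ennreal (l i) \<le> (\<Sum>k<n. ennreal (l k) * of_bool (0 < l k \<and> (\<forall>j<n. l j \<le> l k) \<and> (\<forall>j<k. l j < l k)))"
  proof (cases "0 < l i")
    case True
    then have "0 < l k" "l i \<le> l k" using m[of i] k \<open>i \<in> _\<close> by auto
    then have "ennreal (l i) \<le> ennreal (l k) * of_bool (0 < l k \<and> (\<forall>j<n. l j \<le> l k) \<and> (\<forall>j<k. l j < l k))"
      using k m k' by (simp add: ennreal_leI)
    also have "\<dots> \<le> (\<Sum>k<n. ennreal (l k) * of_bool (0 < l k \<and> (\<forall>j<n. l j \<le> l k) \<and> (\<forall>j<k. l j < l k)))"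
      using k by (intro member_le_sum) auto
    finally show ?thesis .
  qed (simp add: ennreal_neg)
qed

text \<open>One set B has to serve P and Q at once, because a piece of a partition enters a sum with
  both of its measures.\<close>

definition approximable :: "'a set set \<Rightarrow> 'a measure \<Rightarrow> 'a measure \<Rightarrow> 'a set \<Rightarrow> bool" where
  "approximable \<A> P Q A \<longleftrightarrow>
    (\<forall>e>0. \<exists>B\<in>\<A>. measure P (sym_diff A B) < e \<and> measure Q (sym_diff A B) < e)"

lemma (in finite_measure) abs_measure_diff_le:
  assumes "A \<in> sets M" "B \<in> sets M"
  shows "\<bar>measure M A - measure M B\<bar> \<le> measure M (sym_diff A B)"
proof -
  have "measure M A \<le> measure M (B \<union> sym_diff A B)" "measure M B \<le> measure M (A \<union> sym_diff A B)"
    using assms by (auto intro!: finite_measure_mono)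
  moreover have "measure M (B \<union> sym_diff A B) \<le> measure M B + measure M (sym_diff A B)"
    "measure M (A \<union> sym_diff A B) \<le> measure M A + measure M (sym_diff A B)"
    using assms by (auto intro!: measure_Un_le)
  ultimately show ?thesis by linarith
qed

lemma approximable_disjointification:
  fixes n :: nat
  assumes fin: "finite_measure P" "finite_measure Q" and sets: "sets Q = sets P"
    and \<A>: "algebra (space P) \<A>" "\<A> \<subseteq> sets P"
    and A: "\<And>k. k < n \<Longrightarrow> A k \<in> sets P" "disjoint_family_on A {..<n}"
    and app: "\<And>k. k < n \<Longrightarrow> approximable \<A> P Q (A k)" and "0 < e"
  obtains B where "\<And>k. k < n \<Longrightarrow> B k \<in> \<A>" "disjoint_family_on B {..<n}"
    "\<And>k. k < n \<Longrightarrow> \<bar>measure P (A k) - measure P (B k)\<bar> \<le> e"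
    "\<And>k. k < n \<Longrightarrow> \<bar>measure Q (A k) - measure Q (B k)\<bar> \<le> e"
proof -
  interpret P: finite_measure P by fact
  interpret Q: finite_measure Q by fact
  interpret algebra "space P" \<A> by fact
  \<comment> \<open>The union of all n symmetric differences has measure at most n * d, hence at
    most e; the added 1 covers n = 0.\<close>
  define d where "d = e / (real n + 1)"
  have d: "0 < d" "real n * d \<le> e" using \<open>0 < e\<close> by (auto simp: d_def divide_simps)
  have "\<forall>k\<in>{..<n}. \<exists>C\<in>\<A>. measure P (sym_diff (A k) C) < d \<and> measure Q (sym_diff (A k) C) < d"
    using app d by (auto simp: approximable_def)
  then obtain C where C: "\<And>k. k < n \<Longrightarrow> C k \<in> \<A>"
    "\<And>k. k < n \<Longrightarrow> measure P (sym_diff (A k) (C k)) < d"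
    "\<And>k. k < n \<Longrightarrow> measure Q (sym_diff (A k) (C k)) < d"
    by (metis lessThan_iff)
  \<comment> \<open>The approximants may overlap. If an earlier \<open>C j\<close> takes away a
    point of \<open>A k\<close>, then that point is outside \<open>A j\<close> by disjointness, so
    it is already counted as an error of \<open>C j\<close>.\<close>
  define B where "B k = C k - (\<Union>j<k. C j)" for k
  have B: "B k \<in> \<A>" if "k < n" for k
    unfolding B_def using C(1) that by (intro Diff finite_UN) auto
  have CP: "C k \<in> sets P" "B k \<in> sets P" if "k < n" for k using C(1) B that \<A> by auto
  have sub: "sym_diff (A k) (B k) \<subseteq> (\<Union>j<n. sym_diff (A j) (C j))" if "k < n" for k
  proof
    fix x assume x: "x \<in> sym_diff (A k) (B k)"
    show "x \<in> (\<Union>j<n. sym_diff (A j) (C j))"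
    proof (cases "x \<in> sym_diff (A k) (C k)")
      case False
      then obtain j where "j < k" "x \<in> C j" "x \<in> A k" using x by (auto simp: B_def)
      moreover from this have "x \<notin> A j"
        using disjoint_family_onD[OF A(2), of j k] that by auto
      ultimately show ?thesis using that by (intro UN_I[of j]) simp_all
    qed (use that in auto)
  qed
  have diff: "\<bar>measure M (A k) - measure M (B k)\<bar> \<le> e"
    if k: "k < n" and M: "finite_measure M" "sets M = sets P"
      and C2: "\<And>k. k < n \<Longrightarrow> measure M (sym_diff (A k) (C k)) < d" for M k
  proof -
    interpret M: finite_measure M by fact
    have "\<bar>measure M (A k) - measure M (B k)\<bar> \<le> measure M (sym_diff (A k) (B k))"
      using k A(1) CP M by (intro M.abs_measure_diff_le) auto
    also have "\<dots> \<le> measure M (\<Union>j<n. sym_diff (A j) (C j))"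
      using sub[OF k] A(1) CP M by (intro M.finite_measure_mono) auto
    also have "\<dots> \<le> (\<Sum>j<n. measure M (sym_diff (A j) (C j)))"
      using A(1) CP M by (intro M.finite_measure_subadditive_finite) auto
    also have "\<dots> \<le> (\<Sum>j<n. d)" using C2 by (intro sum_mono) (auto intro: less_imp_le)
    also have "\<dots> \<le> e" using d by simp
    finally show ?thesis .
  qed
  show ?thesis
  proof (rule that[of B])
    show "disjoint_family_on B {..<n}"
      unfolding disjoint_family_on_def
    proof safe
      fix i j x assume "i < n" "j < n" "i \<noteq> j" "x \<in> B i" "x \<in> B j"
      then show "x \<in> {}" by (cases i j rule: linorder_cases) (auto simp: B_def)
    qed
  qed (use B diff[OF _ fin(1) refl C(2)] diff[OF _ fin(2) sets C(3)] in auto)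
qed

text \<open>Finite maxima of planes increase to the integrand. Where the k-th plane is the largest,
  the maximum integrates to that plane at the two measures of the winning set. Replacing the winning
  sets by nearby disjoint sets from \<A> moves the values only slightly, and each plane is below the
  partition term there.\<close>

lemma nn_integral_le_partition_div:
  assumes "0 < \<alpha>" and PQ: "common_densities P Q \<nu> f g"
    and fin: "finite_measure P" "finite_measure Q"
    and \<A>: "algebra (space P) \<A>" "\<A> \<subseteq> sets P"
    and app: "\<And>A. A \<in> sets P \<Longrightarrow> approximable \<A> P Q A"
  shows "(\<integral>\<^sup>+x. tsallis_fun \<alpha> (f x) (g x) \<partial>\<nu>) \<le> partition_div \<alpha> \<A> P Q"
proof -
  interpret P: finite_measure P by fact
  interpret Q: finite_measure Q by fact
  have [measurable]: "f \<in> borel_measurable \<nu>" "g \<in> borel_measurable \<nu>" and sets: "sets P = sets \<nu>" "sets Q = sets \<nu>"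
    and nn: "\<And>x. x \<in> space \<nu> \<Longrightarrow> 0 \<le> f x \<and> 0 \<le> g x"
    using PQ by (auto simp: common_densities_def)
  have ne: "pos_rats \<noteq> {}" by (auto intro!: exI[of _ 1])
  have co: "countable pos_rats" by (auto intro: countable_rat countable_subset)
  define s where "s k = from_nat_into pos_rats k" for k
  have s: "0 < s k" for k using from_nat_into[OF ne, of k] by (simp add: s_def)
  have ran: "range s = pos_rats" unfolding s_def by (rule range_from_nat_into[OF ne co])
  define l where "l k x = tangent \<alpha> (s k) (f x) (g x)" for k x
  have l [measurable]: "l k \<in> borel_measurable \<nu>" for k unfolding l_def by measurable
  have "(\<integral>\<^sup>+x. tsallis_fun \<alpha> (f x) (g x) \<partial>\<nu>) = (\<integral>\<^sup>+x. (SUP n. SUP k\<in>{..<n}. ennreal (l k x)) \<partial>\<nu>)"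
  proof (intro nn_integral_cong)
    fix x assume "x \<in> space \<nu>"
    then have "tsallis_fun \<alpha> (f x) (g x) = (SUP s\<in>range s. ennreal (tangent \<alpha> s (f x) (g x)))"
      unfolding ran using nn assms(1) by (intro tsallis_fun_eq_SUP) auto
    also have "\<dots> = (SUP k\<in>(\<Union>n. {..<n}). ennreal (l k x))"
      by (simp add: l_def image_image UN_lessThan_UNIV)
    also have "\<dots> = (SUP n. SUP k\<in>{..<n}. ennreal (l k x))"
      by (rule SUP_UNION)
    finally show "tsallis_fun \<alpha> (f x) (g x) = \<dots>" .
  qed
  also have "\<dots> = (SUP n. \<integral>\<^sup>+x. (SUP k\<in>{..<n}. ennreal (l k x)) \<partial>\<nu>)"
    by (intro nn_integral_monotone_convergence_SUP borel_measurable_SUP)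
      (auto simp: incseq_def le_fun_def intro!: SUP_subset_mono)
  also have "\<dots> \<le> partition_div \<alpha> \<A> P Q"
  proof (rule SUP_least)
    fix n
    \<comment> \<open>The set where plane k is positive and the first to be maximal. Positivity
      makes the plane a nonnegative integrand on \<open>A k\<close>, so that its two kinds of
      integral agree.\<close>
    define A where "A k = {x\<in>space \<nu>. 0 < l k x \<and> (\<forall>j<n. l j x \<le> l k x) \<and> (\<forall>j<k. l j x < l k x)}" for k
    have A [measurable]: "A k \<in> sets \<nu>" for k unfolding A_def by measurable
    have disj: "disjoint_family_on A {..<n}"
      unfolding disjoint_family_on_def
    proof safe
      fix i j x assume "i < n" "j < n" "i \<noteq> j" "x \<in> A i" "x \<in> A j"
      then have "l j x \<le> l i x" "l i x \<le> l j x" "i < j \<Longrightarrow> l i x < l j x" "j < i \<Longrightarrow> l j x < l i x"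
        by (auto simp: A_def)
      then show "x \<in> {}" using \<open>i \<noteq> j\<close> by (cases i j rule: linorder_cases) auto
    qed
    have fin': "emeasure P X < \<infinity>" "emeasure Q X < \<infinity>" for X
      by (auto simp: less_top[symmetric] P.emeasure_finite Q.emeasure_finite)
    have "(\<integral>\<^sup>+x. (SUP k\<in>{..<n}. ennreal (l k x)) \<partial>\<nu>) \<le> (\<integral>\<^sup>+x. (\<Sum>k<n. ennreal (l k x * indicator (A k) x)) \<partial>\<nu>)"
    proof (intro nn_integral_mono order.trans[OF SUP_ennreal_le_sum_argmax] sum_mono)
      fix x k assume "x \<in> space \<nu>"
      then show "ennreal (l k x) * of_bool (0 < l k x \<and> (\<forall>j<n. l j x \<le> l k x) \<and> (\<forall>j<k. l j x < l k x))
          \<le> ennreal (l k x * indicator (A k) x)"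
        by (auto simp: A_def split: split_indicator)
    qed
    also have "\<dots> = (\<Sum>k<n. \<integral>\<^sup>+x. ennreal (l k x * indicator (A k) x) \<partial>\<nu>)"
      by (intro nn_integral_sum) measurable
    also have "\<dots> = (\<Sum>k<n. ennreal (tangent \<alpha> (s k) (measure P (A k)) (measure Q (A k))))"
    proof (intro sum.cong refl)
      fix k
      have "has_bochner_integral \<nu> (\<lambda>x. l k x * indicator (A k) x)
          (tangent \<alpha> (s k) (measure P (A k)) (measure Q (A k)))"
        unfolding l_def by (rule has_bochner_integral_tangent[OF PQ A fin'])
      then show "(\<integral>\<^sup>+x. ennreal (l k x * indicator (A k) x) \<partial>\<nu>)
          = ennreal (tangent \<alpha> (s k) (measure P (A k)) (measure Q (A k)))"
        by (subst nn_integral_eq_integral) (auto simp: has_bochner_integral_iff A_def split: split_indicator)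
    qed
    also have "\<dots> \<le> partition_div \<alpha> \<A> P Q"
    proof (rule ennreal_le_epsilon)
      fix e :: real assume "0 < e"
      \<comment> \<open>Bound for the change of plane k per unit of error in both measures.\<close>
      define w where "w k = \<bar>tangent_fst \<alpha> (s k)\<bar> + \<bar>1 - s k powr \<alpha>\<bar>" for k
      have w: "0 \<le> w k" for k by (simp add: w_def)
      \<comment> \<open>With this tolerance for the measures the planes lose at most e in total; the
        added 1 avoids a division by zero.\<close>
      define d where "d = e / ((\<Sum>k<n. w k) + 1)"
      have W: "0 \<le> (\<Sum>k<n. w k)" using w by (simp add: sum_nonneg)
      have d: "0 < d" "(\<Sum>k<n. w k * d) \<le> e"
        using \<open>0 < e\<close> W by (auto simp: d_def sum_divide_distrib[symmetric] sum_distrib_right[symmetric] divide_simps)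
      obtain B where B: "\<And>k. k < n \<Longrightarrow> B k \<in> \<A>" "disjoint_family_on B {..<n}"
        "\<And>k. k < n \<Longrightarrow> \<bar>measure P (A k) - measure P (B k)\<bar> \<le> d"
        "\<And>k. k < n \<Longrightarrow> \<bar>measure Q (A k) - measure Q (B k)\<bar> \<le> d"
        using approximable_disjointification[OF fin _ \<A> _ disj _ d(1)] app sets A by metis
      have "(\<Sum>k<n. ennreal (tangent \<alpha> (s k) (measure P (A k)) (measure Q (A k))))
          \<le> (\<Sum>k<n. tsallis_fun \<alpha> (measure P (B k)) (measure Q (B k)) + ennreal (w k * d))"
      proof (rule sum_mono)
        fix k assume k: "k \<in> {..<n}"
        have "tangent_fst \<alpha> (s k) * (measure P (A k) - measure P (B k)) \<le> \<bar>tangent_fst \<alpha> (s k)\<bar> * d"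
          "(1 - s k powr \<alpha>) * (measure Q (A k) - measure Q (B k)) \<le> \<bar>1 - s k powr \<alpha>\<bar> * d"
          using B(3,4)[of k] k by (auto intro!: mult_le_abs_mult)
        then have "tangent \<alpha> (s k) (measure P (A k)) (measure Q (A k))
            \<le> tangent \<alpha> (s k) (measure P (B k)) (measure Q (B k)) + w k * d"
          by (simp add: tangent_def w_def algebra_simps)
        then have "ennreal (tangent \<alpha> (s k) (measure P (A k)) (measure Q (A k)))
            \<le> ennreal (tangent \<alpha> (s k) (measure P (B k)) (measure Q (B k)) + w k * d)"
          by (rule ennreal_leI)
        also have "\<dots> \<le> ennreal (tangent \<alpha> (s k) (measure P (B k)) (measure Q (B k))) + ennreal (w k * d)"
          using w d(1) by (intro ennreal_add_le) auto
        also have "ennreal (tangent \<alpha> (s k) (measure P (B k)) (measure Q (B k)))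
            \<le> tsallis_fun \<alpha> (measure P (B k)) (measure Q (B k))"
          using assms(1) s by (intro tangent_le_tsallis_fun) auto
        finally show "ennreal (tangent \<alpha> (s k) (measure P (A k)) (measure Q (A k)))
            \<le> tsallis_fun \<alpha> (measure P (B k)) (measure Q (B k)) + ennreal (w k * d)"
          by (simp add: add_right_mono)
      qed
      also have "\<dots> = (\<Sum>k<n. tsallis_fun \<alpha> (measure P (B k)) (measure Q (B k))) + ennreal (\<Sum>k<n. w k * d)"
        using w d(1) by (simp add: sum.distrib sum_ennreal)
      also have "\<dots> \<le> partition_div \<alpha> \<A> P Q + ennreal e"
        using B d(2) by (intro add_mono partition_div_upper ennreal_leI) auto
      finally show "(\<Sum>k<n. ennreal (tangent \<alpha> (s k) (measure P (A k)) (measure Q (A k))))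
          \<le> partition_div \<alpha> \<A> P Q + ennreal e" .
    qed
    finally show "(\<integral>\<^sup>+x. (SUP k\<in>{..<n}. ennreal (l k x)) \<partial>\<nu>) \<le> partition_div \<alpha> \<A> P Q" .
  qed
  finally show ?thesis .
qed

text \<open>The approximable sets form a sigma-algebra: complements have the same symmetric
  differences, and a countable union is first truncated to a finite one.\<close>

lemma approximable_sigma_sets:
  assumes fin: "finite_measure P" "finite_measure Q" and sets: "sets Q = sets P"
    and \<A>: "algebra (space P) \<A>" "\<A> \<subseteq> sets P"
    and G: "G \<subseteq> sets P" "\<And>A. A \<in> G \<Longrightarrow> approximable \<A> P Q A"
    and A: "A \<in> sigma_sets (space P) G"
  shows "approximable \<A> P Q A"
proof -
  interpret P: finite_measure P by fact
  interpret Q: finite_measure Q by fact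
  interpret algebra "space P" \<A> by fact
  show ?thesis using A
  proof (induction rule: sigma_sets.induct)
    case (Basic a)
    then show ?case by (rule G)
  next
    case Empty
    show ?case unfolding approximable_def by (auto intro!: bexI[of _ "{}"])
  next
    case (Compl a)
    have a: "a \<subseteq> space P" using Compl.hyps sigma_sets_into_sp[of G "space P" a] G(1) sets.space_closed[of P] by auto
    show ?case unfolding approximable_def
    proof (intro allI impI)
      fix e :: real assume "0 < e"
      then obtain B where B: "B \<in> \<A>" "measure P (sym_diff a B) < e" "measure Q (sym_diff a B) < e"
        using Compl.IH by (auto simp: approximable_def)
      have "sym_diff (space P - a) (space P - B) = sym_diff a B"
        using a B(1) \<A>(2) sets.space_closed[of P] by auto
      then show "\<exists>B\<in>\<A>. measure P (sym_diff (space P - a) B) < e \<and> measure Q (sym_diff (space P - a) B) < e"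
        using B by (intro bexI[of _ "space P - B"]) auto
    qed
  next
    case (Union a)
    have a [measurable]: "a i \<in> sets P" for i
      using Union.hyps[of i] G(1) sets.sigma_sets_subset by blast
    show ?case unfolding approximable_def
    proof (intro allI impI)
      fix e :: real assume "0 < e"
      \<comment> \<open>\<open>R N\<close> is what the first N sets miss of the union. It takes half
        of e by continuity from above; the other half is shared by the N approximations.\<close>
      define R where "R N = (\<Union>i. a i) - (\<Union>i<N. a i)" for N :: nat
      have R: "decseq R" "(\<Inter>N. R N) = {}" "range R \<subseteq> sets P"
        unfolding R_def decseq_def by (force, auto)
      have "(\<lambda>N. measure P (R N)) \<longlonglongrightarrow> 0" "(\<lambda>N. measure Q (R N)) \<longlonglongrightarrow> 0"
        using P.finite_Lim_measure_decseq[of R] Q.finite_Lim_measure_decseq[of R] R sets by auto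
      then have "\<forall>\<^sub>F N in sequentially. measure P (R N) < e / 2 \<and> measure Q (R N) < e / 2"
        using \<open>0 < e\<close> by (auto simp: eventually_conj_iff intro!: order_tendstoD)
      then obtain N where N: "measure P (R N) < e / 2" "measure Q (R N) < e / 2"
        by (auto simp: eventually_sequentially)
      define d where "d = e / (2 * (real N + 1))"
      have d: "0 < d" "real N * d \<le> e / 2" using \<open>0 < e\<close> by (auto simp: d_def divide_simps)
      have "\<forall>i\<in>UNIV. \<exists>B\<in>\<A>. measure P (sym_diff (a i) B) < d \<and> measure Q (sym_diff (a i) B) < d"
        using Union.IH d by (auto simp: approximable_def)
      then obtain B where B: "\<And>i. B i \<in> \<A>" "\<And>i. measure P (sym_diff (a i) (B i)) < d"
        "\<And>i. measure Q (sym_diff (a i) (B i)) < d"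
        by (metis UNIV_I)
      have BP [measurable]: "B i \<in> sets P" for i using B(1) \<A> by auto
      have sub: "sym_diff (\<Union>i. a i) (\<Union>i<N. B i) \<subseteq> R N \<union> (\<Union>i<N. sym_diff (a i) (B i))"
        by (auto simp: R_def)
      have est: "measure M (sym_diff (\<Union>i. a i) (\<Union>i<N. B i)) < e"
        if M: "finite_measure M" "sets M = sets P" and 1: "measure M (R N) < e / 2"
          and 2: "\<And>i. measure M (sym_diff (a i) (B i)) < d" for M
      proof -
        interpret M: finite_measure M by fact
        note M(2) [measurable_cong]
        have [measurable]: "R N \<in> sets M" using R(3) M(2) by auto
        have m2: "(\<Union>i<N. sym_diff (a i) (B i)) \<in> sets M" by measurable
        have "measure M (sym_diff (\<Union>i. a i) (\<Union>i<N. B i)) \<le> measure M (R N \<union> (\<Union>i<N. sym_diff (a i) (B i)))"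
          using m2 by (intro M.finite_measure_mono sub) auto
        also have "\<dots> \<le> measure M (R N) + measure M (\<Union>i<N. sym_diff (a i) (B i))"
          using m2 by (intro measure_Un_le) auto
        also have "measure M (\<Union>i<N. sym_diff (a i) (B i)) \<le> (\<Sum>i<N. measure M (sym_diff (a i) (B i)))"
          by (intro M.finite_measure_subadditive_finite) auto
        also have "\<dots> \<le> (\<Sum>i<N. d)" using 2 by (intro sum_mono) (auto intro: less_imp_le)
        also have "\<dots> \<le> e / 2" using d by simp
        finally show ?thesis using 1 by simp
      qed
      have "(\<Union>i<N. B i) \<in> \<A>" using B(1) by (intro finite_UN) auto
      then show "\<exists>B\<in>\<A>. measure P (sym_diff (\<Union>i. a i) B) < e \<and> measure Q (sym_diff (\<Union>i. a i) B) < e"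
        using est[OF fin(1) refl N(1) B(2)] est[OF fin(2) sets N(2) B(3)] by blast
    qed
  qed
qed

section \<open>Common densities and sigma-finite measures\<close>

definition countable_sum :: "'a measure \<Rightarrow> (nat \<Rightarrow> 'a measure) \<Rightarrow> 'a measure" where
  "countable_sum M \<xi> = measure_of (space M) (sets M) (\<lambda>B. \<Sum>i. emeasure (\<xi> i) B)"

lemma space_countable_sum [simp]: "space (countable_sum M \<xi>) = space M"
  unfolding countable_sum_def by (rule space_measure_of) (rule sets.space_closed)

lemma sets_countable_sum [simp, measurable_cong]: "sets (countable_sum M \<xi>) = sets M"
  unfolding countable_sum_def by (rule sets.sets_measure_of_eq)

lemma emeasure_countable_sum:
  assumes "\<And>i. sets (\<xi> i) = sets M" "B \<in> sets M"
  shows "emeasure (countable_sum M \<xi>) B = (\<Sum>i. emeasure (\<xi> i) B)"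
proof (rule emeasure_measure_of[OF countable_sum_def])
  show "countably_additive (sets (countable_sum M \<xi>)) (\<lambda>B. \<Sum>i. emeasure (\<xi> i) B)"
  proof (rule countably_additiveI)
    fix B :: "nat \<Rightarrow> 'a set"
    assume B: "range B \<subseteq> sets (countable_sum M \<xi>)" "disjoint_family B"
    have "(\<Sum>j. \<Sum>i. emeasure (\<xi> i) (B j)) = (\<Sum>i. \<Sum>j. emeasure (\<xi> i) (B j))"
    proof -
      have "(\<Sum>j. \<Sum>i. emeasure (\<xi> i) (B j)) = (\<integral>\<^sup>+j. (\<Sum>i. emeasure (\<xi> i) (B j)) \<partial>count_space UNIV)"
        by (simp add: nn_integral_count_space_nat)
      also have "\<dots> = (\<Sum>i. \<integral>\<^sup>+j. emeasure (\<xi> i) (B j) \<partial>count_space UNIV)"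
        by (intro nn_integral_suminf) auto
      finally show ?thesis by (simp add: nn_integral_count_space_nat)
    qed
    also have "\<dots> = (\<Sum>i. emeasure (\<xi> i) (\<Union>j. B j))"
      using B assms(1) by (intro suminf_cong suminf_emeasure) auto
    finally show "(\<Sum>j. \<Sum>i. emeasure (\<xi> i) (B j)) = (\<Sum>i. emeasure (\<xi> i) (\<Union> (range B)))" .
  qed
qed (use assms sets.space_closed[of M] in \<open>auto simp: positive_def\<close>)

text \<open>One exhausting sequence for both measures: it makes their sum sigma-finite, and monotone
  convergence along it reduces the sigma-finite case to the finite one.\<close>

definition cofinite_cover :: "'a measure \<Rightarrow> 'a measure \<Rightarrow> (nat \<Rightarrow> 'a set) \<Rightarrow> bool" where
  "cofinite_cover P Q S \<longleftrightarrow> range S \<subseteq> sets P \<and> incseq S \<and> (\<Union>k. S k) = space P \<and>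
     (\<forall>k. emeasure P (S k) < \<infinity> \<and> emeasure Q (S k) < \<infinity>)"

text \<open>Radon-Nikodym derivatives with respect to P + Q.\<close>

lemma common_densities_exist:
  assumes S: "cofinite_cover P Q S" and sets: "sets Q = sets P"
  obtains \<nu> f g where "common_densities P Q \<nu> f g"
proof -
  define \<nu> where "\<nu> = countable_sum P (\<lambda>i. if i = 0 then P else if i = Suc 0 then Q else null_measure P)"
  have \<nu>_sets [measurable_cong]: "sets \<nu> = sets P" by (simp add: \<nu>_def)
  have em: "emeasure \<nu> B = emeasure P B + emeasure Q B" if "B \<in> sets P" for B
  proof -
    have "emeasure \<nu> B = (\<Sum>i. emeasure (if i = 0 then P else if i = Suc 0 then Q else null_measure P) B)"
      unfolding \<nu>_def by (rule emeasure_countable_sum) (use sets that in auto)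
    also have "\<dots> = (\<Sum>i\<in>{0, Suc 0}. emeasure (if i = 0 then P else if i = Suc 0 then Q else null_measure P) B)"
      by (rule suminf_finite) auto
    finally show ?thesis by simp
  qed
  have sp: "space \<nu> = space P" by (simp add: \<nu>_def)
  have sf: "sigma_finite_measure M" if "sets M = sets P" "\<And>k. emeasure M (S k) < \<infinity>" for M
  proof
    show "\<exists>A. countable A \<and> A \<subseteq> sets M \<and> \<Union> A = space M \<and> (\<forall>a\<in>A. emeasure M a \<noteq> \<infinity>)"
      using S that sets_eq_imp_space_eq[OF that(1)] 
      by (intro exI[of _ "range S"]) (auto simp: cofinite_cover_def less_top)
  qed
  have Sk: "S k \<in> sets P" "emeasure P (S k) < \<infinity>" "emeasure Q (S k) < \<infinity>" for k
    using S by (auto simp: cofinite_cover_def)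
  interpret \<nu>: sigma_finite_measure \<nu>
    using Sk by (intro sf) (auto simp: \<nu>_sets em)
  have ex: "\<exists>f. f \<in> borel_measurable \<nu> \<and> (\<forall>x. 0 \<le> f x) \<and> density \<nu> (\<lambda>x. ennreal (f x)) = M"
    if M: "sets M = sets P" "\<And>B. B \<in> sets P \<Longrightarrow> emeasure M B \<le> emeasure \<nu> B" 
      "\<And>k. emeasure M (S k) < \<infinity>" for M
  proof -
    have ac: "absolutely_continuous \<nu> M"
      unfolding absolutely_continuous_def using M(1,2) \<nu>_sets
      by (auto simp: null_sets_def) (metis le_zero_eq)
    have sM: "sets M = sets \<nu>" using M \<nu>_sets by simp
    have AE: "AE x in \<nu>. RN_deriv \<nu> M x \<noteq> \<infinity>"
      by (rule \<nu>.RN_deriv_finite[OF sf ac sM]) (use M in auto)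
    \<comment> \<open>Densities have to be real-valued. The derivative is finite almost everywhere
      because M is sigma-finite, so the conversion changes it on a null set only.\<close>
    have "density \<nu> (\<lambda>x. ennreal (enn2real (RN_deriv \<nu> M x))) = density \<nu> (RN_deriv \<nu> M)"
      by (rule density_cong) (use AE in \<open>auto simp: less_top\<close>)
    also have "\<dots> = M"
      by (rule \<nu>.density_RN_deriv[OF ac sM])
    finally show ?thesis
      by (intro exI[of _ "\<lambda>x. enn2real (RN_deriv \<nu> M x)"]) auto
  qed
  obtain f where "f \<in> borel_measurable \<nu>" "\<forall>x. 0 \<le> f x" "density \<nu> (\<lambda>x. ennreal (f x)) = P"
    using ex[of P] Sk by (auto simp: em)
  moreover obtain g where "g \<in> borel_measurable \<nu>" "\<forall>x. 0 \<le> g x" "density \<nu> (\<lambda>x. ennreal (g x)) = Q"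
    using ex[of Q] Sk sets by (auto simp: em)
  ultimately have "common_densities P Q \<nu> f g"
    using \<nu>.sigma_finite_measure_axioms by (auto simp: common_densities_def)
  then show ?thesis by (rule that)
qed

lemma cofinite_cover_finite_measure:
  "finite_measure P \<Longrightarrow> finite_measure Q \<Longrightarrow> cofinite_cover P Q (\<lambda>_. space P)"
  by (auto simp: cofinite_cover_def incseq_def finite_measure.emeasure_finite less_top[symmetric])

lemma sigma_algebra_approximable:
  "A \<in> \<A> \<Longrightarrow> approximable \<A> P Q A"
  unfolding approximable_def by (auto intro!: bexI[of _ A])

lemma partition_div_finite:
  assumes "0 < \<alpha>" and PQ: "common_densities P Q \<nu> f g" and fin: "finite_measure P" "finite_measure Q"
    and \<A>: "algebra (space P) \<A>" "\<A> \<subseteq> sets P"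
    and app: "\<And>A. A \<in> sets P \<Longrightarrow> approximable \<A> P Q A"
  shows "partition_div \<alpha> \<A> P Q = (\<integral>\<^sup>+x. tsallis_fun \<alpha> (f x) (g x) \<partial>\<nu>)"
  using \<A>(2) fin
  by (intro antisym nn_integral_le_partition_div[OF assms] partition_div_le_nn_integral[OF assms(1) PQ])
    (auto simp: finite_measure.emeasure_finite less_top[symmetric])

text \<open>Both sides equal the same integral along common densities, which then drop out of the
  statement.\<close>

lemma partition_div_algebra:
  assumes "0 < \<alpha>" and fin: "finite_measure P" "finite_measure Q" and sets: "sets Q = sets P"
    and \<A>: "algebra (space P) \<A>" "\<A> \<subseteq> sets P"
    and app: "\<And>A. A \<in> sets P \<Longrightarrow> approximable \<A> P Q A"
  shows "partition_div \<alpha> \<A> P Q = partition_div \<alpha> (sets P) P Q"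
proof -
  obtain \<nu> f g where cd: "common_densities P Q \<nu> f g"
    using common_densities_exist[OF cofinite_cover_finite_measure[OF fin] sets] .
  have "partition_div \<alpha> (sets P) P Q = (\<integral>\<^sup>+x. tsallis_fun \<alpha> (f x) (g x) \<partial>\<nu>)"
    using sets.sigma_algebra_axioms[of P]
    by (intro partition_div_finite[OF assms(1) cd fin] sigma_algebra_approximable)
      (auto simp: sigma_algebra_def)
  then show ?thesis
    using partition_div_finite[OF assms(1) cd fin \<A> app] by simp
qed

text \<open>The plane with s = 1 is identically zero.\<close>

lemma tsallis_integrand_nonneg:
  "0 < \<alpha> \<Longrightarrow> 0 \<le> x \<Longrightarrow> 0 \<le> y \<Longrightarrow> 0 \<le> tsallis_integrand \<alpha> x y"
  using tangent_le[of \<alpha> 1 x y] by (cases "\<alpha> = 1") (simp_all add: tangent_def tangent_fst_def zero_ereal_def)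

lemma tsallis_fun_0_0: "0 < \<alpha> \<Longrightarrow> tsallis_fun \<alpha> 0 0 = 0"
  by (simp add: tsallis_fun_def tsallis_integrand_0_left zero_ereal_def[symmetric])

lemma measurable_tsallis_fun:
  assumes "0 < \<alpha>" "f \<in> borel_measurable M" "g \<in> borel_measurable M"
    "\<And>x. x \<in> space M \<Longrightarrow> 0 \<le> f x" "\<And>x. x \<in> space M \<Longrightarrow> 0 \<le> g x"
  shows "(\<lambda>x. tsallis_fun \<alpha> (f x) (g x)) \<in> borel_measurable M"
proof -
  have "(\<lambda>x. SUP s\<in>pos_rats. ennreal (tangent \<alpha> s (f x) (g x))) \<in> borel_measurable M"
    using assms by (intro borel_measurable_SUP measurable_compose[OF _ measurable_ennreal] measurable_tangent)
      (auto intro: countable_rat countable_subset)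
  then show ?thesis
    using assms by (subst measurable_cong[where g="\<lambda>x. SUP s\<in>pos_rats. ennreal (tangent \<alpha> s (f x) (g x))"])
         (auto simp: tsallis_fun_eq_SUP)
qed

text \<open>Densities cut off outside \<open>S k\<close> belong to finite measures, for which the
  partition formula is known; monotone convergence removes the cut-off.\<close>

lemma partition_div_sigma_finite:
  assumes "0 < \<alpha>" and PQ: "common_densities P Q \<nu> f g" and S: "cofinite_cover P Q S"
  shows "partition_div \<alpha> {B\<in>sets P. emeasure P B < \<infinity> \<and> emeasure Q B < \<infinity>} P Q
    = (\<integral>\<^sup>+x. tsallis_fun \<alpha> (f x) (g x) \<partial>\<nu>)" (is "partition_div \<alpha> ?R P Q = _")
proof (rule antisym)
  show "partition_div \<alpha> ?R P Q \<le> (\<integral>\<^sup>+x. tsallis_fun \<alpha> (f x) (g x) \<partial>\<nu>)"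
    by (rule partition_div_le_nn_integral[OF assms(1,2)]) auto
  have [measurable]: "f \<in> borel_measurable \<nu>" "g \<in> borel_measurable \<nu>" 
    and P: "P = density \<nu> f" and Q: "Q = density \<nu> g" and sf: "sigma_finite_measure \<nu>"
    and nn: "\<And>x. x \<in> space \<nu> \<Longrightarrow> 0 \<le> f x" "\<And>x. x \<in> space \<nu> \<Longrightarrow> 0 \<le> g x"
    using PQ by (auto simp: common_densities_def)
  have sets: "sets P = sets \<nu>" "sets Q = sets \<nu>" "space P = space \<nu>" by (simp_all add: P Q)
  have S' [measurable]: "S k \<in> sets \<nu>" and S'': "emeasure P (S k) < \<infinity>" "emeasure Q (S k) < \<infinity>" for k
    using S sets by (auto simp: cofinite_cover_def)
  have [measurable]: "(\<lambda>x. tsallis_fun \<alpha> (f x) (g x)) \<in> borel_measurable \<nu>"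
    using nn assms(1) by (intro measurable_tsallis_fun) auto
  have "(\<integral>\<^sup>+x. tsallis_fun \<alpha> (f x) (g x) \<partial>\<nu>) = (\<integral>\<^sup>+x. (SUP k. tsallis_fun \<alpha> (f x) (g x) * indicator (S k) x) \<partial>\<nu>)"
  proof (intro nn_integral_cong antisym SUP_least)
    fix x assume "x \<in> space \<nu>"
    then have "x \<in> (\<Union>k. S k)" using S sets by (simp add: cofinite_cover_def)
    then obtain k where "x \<in> S k" by blast
    then show "tsallis_fun \<alpha> (f x) (g x) \<le> (SUP k. tsallis_fun \<alpha> (f x) (g x) * indicator (S k) x)"
      by (intro SUP_upper2[of k]) auto
  qed (auto split: split_indicator)
  also have "\<dots> = (SUP k. \<integral>\<^sup>+x. tsallis_fun \<alpha> (f x) (g x) * indicator (S k) x \<partial>\<nu>)"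
    using S by (intro nn_integral_monotone_convergence_SUP)
      (auto simp: cofinite_cover_def incseq_def le_fun_def split: split_indicator)
  also have "\<dots> \<le> partition_div \<alpha> ?R P Q"
  proof (rule SUP_least)
    fix k
    \<comment> \<open>The integrand vanishes at (0, 0), so cutting off both densities has the same
      effect as restricting the integral to \<open>S k\<close>.\<close>
    define fk where "fk x = f x * indicator (S k) x" for x
    define gk where "gk x = g x * indicator (S k) x" for x
    have [measurable]: "fk \<in> borel_measurable \<nu>" "gk \<in> borel_measurable \<nu>"
      unfolding fk_def gk_def by measurable
    have cd: "common_densities (density \<nu> fk) (density \<nu> gk) \<nu> fk gk"
      using sf nn by (auto simp: common_densities_def fk_def gk_def)
    have em: "emeasure (density \<nu> fk) B = emeasure P (B \<inter> S k)" "emeasure (density \<nu> gk) B = emeasure Q (B \<inter> S k)"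
      if [measurable]: "B \<in> sets \<nu>" for B
      unfolding P Q fk_def gk_def
      by (auto simp: emeasure_density intro!: nn_integral_cong split: split_indicator)
    have le: "emeasure P (B \<inter> S k) < \<infinity>" "emeasure Q (B \<inter> S k) < \<infinity>" if "B \<in> sets \<nu>" for B
      using emeasure_mono[of "B \<inter> S k" "S k" P] emeasure_mono[of "B \<inter> S k" "S k" Q] S' S''[of k] sets 
      by (auto simp: le_less_trans)
    have fin: "finite_measure (density \<nu> fk)" "finite_measure (density \<nu> gk)"
      using em[of "space \<nu>"] le[of "space \<nu>"] by (auto intro!: finite_measureI)
    have "(\<integral>\<^sup>+x. tsallis_fun \<alpha> (f x) (g x) * indicator (S k) x \<partial>\<nu>) = (\<integral>\<^sup>+x. tsallis_fun \<alpha> (fk x) (gk x) \<partial>\<nu>)"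
      using assms(1) by (intro nn_integral_cong) (auto simp: fk_def gk_def tsallis_fun_0_0 split: split_indicator)
    also have "\<dots> = partition_div \<alpha> (sets \<nu>) (density \<nu> fk) (density \<nu> gk)"
      using sets.sigma_algebra_axioms[of \<nu>]
      by (intro partition_div_finite[OF assms(1) cd fin, symmetric] sigma_algebra_approximable)
        (auto simp: sigma_algebra_def)
    also have "\<dots> \<le> partition_div \<alpha> ?R P Q"
    proof (rule partition_div_least)
      fix n :: nat and B assume B: "\<And>i. i < n \<Longrightarrow> B i \<in> sets \<nu>" "disjoint_family_on B {..<n}"
      have "(\<Sum>i<n. tsallis_fun \<alpha> (measure (density \<nu> fk) (B i)) (measure (density \<nu> gk) (B i)))
          = (\<Sum>i<n. tsallis_fun \<alpha> (measure P (B i \<inter> S k)) (measure Q (B i \<inter> S k)))"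
        using B by (intro sum.cong refl) (simp add: measure_def em)
      also have "\<dots> \<le> partition_div \<alpha> ?R P Q"
        using B le sets by (intro partition_div_upper) (auto simp: disjoint_family_on_def)
      finally show "(\<Sum>i<n. tsallis_fun \<alpha> (measure (density \<nu> fk) (B i)) (measure (density \<nu> gk) (B i)))
        \<le> partition_div \<alpha> ?R P Q" .
    qed
    finally show "(\<integral>\<^sup>+x. tsallis_fun \<alpha> (f x) (g x) * indicator (S k) x \<partial>\<nu>) \<le> partition_div \<alpha> ?R P Q" .
  qed
  finally show "(\<integral>\<^sup>+x. tsallis_fun \<alpha> (f x) (g x) \<partial>\<nu>) \<le> partition_div \<alpha> ?R P Q" .
qed

section \<open>Partition formulas for the two divergences\<close>

lemma ext_integral_nonneg:
  assumes "\<And>x. x \<in> space M \<Longrightarrow> 0 \<le> h x"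
  shows "ext_integral M h = enn2ereal (\<integral>\<^sup>+x. e2ennreal (h x) \<partial>M)"
proof -
  have "(\<integral>\<^sup>+x. e2ennreal (- h x) \<partial>M) = (\<integral>\<^sup>+x. 0 \<partial>M)"
    using assms by (intro nn_integral_cong) (simp add: e2ennreal_neg)
  then show ?thesis by (simp add: ext_integral_def zero_ennreal.rep_eq)
qed

text \<open>The right-hand side mentions no densities, so every choice of them gives this value and
  the definite description denotes it.\<close>

lemma tsallis_div_eq_partition_div:
  assumes "0 < \<alpha>" and S: "cofinite_cover P Q S" and sets: "sets Q = sets P"
  shows "tsallis_div \<alpha> P Q
    = enn2ereal (partition_div \<alpha> {B\<in>sets P. emeasure P B < \<infinity> \<and> emeasure Q B < \<infinity>} P Q)" (is "_ = ?r")
proof -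
  have val: "ext_integral \<nu> (\<lambda>x. tsallis_integrand \<alpha> (f x) (g x)) = ?r"
    if cd: "common_densities P Q \<nu> f g" for \<nu> f g
    unfolding partition_div_sigma_finite[OF assms(1) cd S] tsallis_fun_def
    using cd assms(1) by (intro ext_integral_nonneg tsallis_integrand_nonneg) (auto simp: common_densities_def)
  obtain \<nu> f g where cd: "common_densities P Q \<nu> f g"
    using common_densities_exist[OF S sets] .
  show ?thesis
    unfolding tsallis_div_def
  proof (rule the_equality)
    show "\<exists>\<nu> f g. common_densities P Q \<nu> f g \<and> ?r = ext_integral \<nu> (\<lambda>x. tsallis_integrand \<alpha> (f x) (g x))"
      using cd val[OF cd] by metis
  qed (use val in auto)
qed

text \<open>
  For probability measures the Renyi divergence is an increasing function of the Tsallis divergence;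
  this is the inverse of that function.
\<close>

definition tsallis_of_renyi :: "real \<Rightarrow> ennreal \<Rightarrow> ennreal" where
  "tsallis_of_renyi \<alpha> x =
    (if \<alpha> = 1 then x
     else if x = \<top> then (if \<alpha> < 1 then ennreal (1 / (1 - \<alpha>)) else \<top>)
     else ennreal ((exp ((\<alpha> - 1) * enn2real x) - 1) / (\<alpha> - 1)))"

lemma tsallis_of_renyi_ennreal:
  "\<alpha> \<noteq> 1 \<Longrightarrow> 0 \<le> x \<Longrightarrow> tsallis_of_renyi \<alpha> (ennreal x) = ennreal ((exp ((\<alpha> - 1) * x) - 1) / (\<alpha> - 1))"
  by (simp add: tsallis_of_renyi_def)

lemma tsallis_of_renyi_strict_mono:
  assumes "x < y"
  shows "tsallis_of_renyi \<alpha> x < tsallis_of_renyi \<alpha> y"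
proof (cases "\<alpha> = 1")
  case False
  obtain r where x: "x = ennreal r" "0 \<le> r" using assms by (cases x) auto
  have *: "0 \<le> (exp ((\<alpha> - 1) * r) - 1) / (\<alpha> - 1)"
    using False x(2) by (cases "\<alpha> < 1") (auto intro!: divide_nonneg_pos divide_nonpos_neg simp: mult_nonpos_nonneg)
  show ?thesis
  proof (cases y)
    case (real s)
    then have rs: "r < s" using assms x by (simp add: ennreal_less_iff)
    have "(exp ((\<alpha> - 1) * r) - 1) / (\<alpha> - 1) < (exp ((\<alpha> - 1) * s) - 1) / (\<alpha> - 1)"
      using False rs by (cases "\<alpha> < 1") (auto simp: divide_strict_right_mono divide_strict_right_mono_neg)
    then show ?thesis using False x real * by (simp add: tsallis_of_renyi_ennreal ennreal_less_iff)
  next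
    case top
    have "(exp ((\<alpha> - 1) * r) - 1) / (\<alpha> - 1) < 1 / (1 - \<alpha>)" if "\<alpha> < 1"
      using that by (simp add: field_simps)
    then show ?thesis using False x top * by (simp add: tsallis_of_renyi_ennreal) (simp add: tsallis_of_renyi_def ennreal_less_iff less_top)
  qed
qed (simp add: tsallis_of_renyi_def assms)

lemma tsallis_of_renyi_mono: "x \<le> y \<Longrightarrow> tsallis_of_renyi \<alpha> x \<le> tsallis_of_renyi \<alpha> y"
  using tsallis_of_renyi_strict_mono[of x y \<alpha>] by (cases "x = y") (auto simp: less_imp_le)

lemma tsallis_of_renyi_onto:
  assumes "c < tsallis_of_renyi \<alpha> \<top>"
  obtains x where "c = tsallis_of_renyi \<alpha> x"
proof (cases "\<alpha> = 1")
  case False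
  obtain r where c: "c = ennreal r" "0 \<le> r" using assms by (cases c) auto
  \<comment> \<open>For probability measures with Tsallis divergence r the Hellinger integral is 1 +
    (\<alpha> - 1) r; its logarithm divided by \<alpha> - 1 is the Renyi divergence.\<close>
  define x where "x = ln (1 + (\<alpha> - 1) * r) / (\<alpha> - 1)"
  have "r * (1 - \<alpha>) < 1" if "\<alpha> < 1"
    using assms that c by (simp add: tsallis_of_renyi_def ennreal_less_iff field_simps)
  then have pos: "0 < 1 + (\<alpha> - 1) * r"
    using c mult_right_mono[of 1 \<alpha> r] by (cases "\<alpha> < 1") (auto simp: algebra_simps)
  have "0 \<le> x"
  proof (cases "\<alpha> < 1")
    case True
    then have "ln (1 + (\<alpha> - 1) * r) \<le> 0" using pos c by (simp add: mult_nonpos_nonneg)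
    then show ?thesis using True by (simp add: x_def divide_nonpos_neg)
  next
    case F: False
    then show ?thesis using c False by (simp add: x_def)
  qed
  then have "c = tsallis_of_renyi \<alpha> (ennreal x)"
    using False pos by (simp add: tsallis_of_renyi_ennreal c x_def)
  then show ?thesis by (rule that)
qed (use that[of c] in \<open>simp add: tsallis_of_renyi_def\<close>)

text \<open>A strictly increasing function onto an initial segment is compatible with suprema. This
  moves \<open>tsallis_of_renyi\<close> through the supremum over partitions of the state
  space.\<close>

lemma tsallis_of_renyi_SUP_le:
  assumes "\<And>i. i \<in> I \<Longrightarrow> tsallis_of_renyi \<alpha> (F i) \<le> c"
  shows "tsallis_of_renyi \<alpha> (SUP i\<in>I. F i) \<le> c"
proof (cases "c < tsallis_of_renyi \<alpha> \<top>")
  case True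
  then obtain x where x: "c = tsallis_of_renyi \<alpha> x" by (rule tsallis_of_renyi_onto)
  have "F i \<le> x" if "i \<in> I" for i
    using assms[OF that] tsallis_of_renyi_strict_mono[of x "F i" \<alpha>] x by (auto simp: not_less[symmetric])
  then show ?thesis unfolding x by (intro tsallis_of_renyi_mono SUP_least)
next
  case False
  then show ?thesis
    using tsallis_of_renyi_mono[OF top_greatest, of \<alpha> "SUP i\<in>I. F i"] by simp
qed

lemma ennreal_mult_add_eq_1D:
  assumes "0 \<le> a" "0 \<le> b" "0 \<le> c" "ennreal a * ennreal b + ennreal c = 1"
  shows "a * b + c = 1"
proof -
  have "ennreal (a * b + c) = ennreal 1"
    using assms by (simp add: ennreal_mult)
  then show ?thesis
    using assms by (intro iffD1[OF ennreal_inj]) auto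
qed

text \<open>The linear terms of the integrand integrate to 1 each, which leaves the Hellinger
  integral or, at \<alpha> = 1, the Kullback-Leibler integral. Writing the Tsallis divergence as an
  image under \<open>tsallis_of_renyi\<close> lets x be read off, infinite values included.\<close>

lemma renyi_div_eq_partition_div:
  assumes "0 < \<alpha>" and P: "prob_space P" and Q: "prob_space Q" and sets: "sets Q = sets P"
    and T: "partition_div \<alpha> (sets P) P Q = tsallis_of_renyi \<alpha> x"
  shows "renyi_div \<alpha> P Q = enn2ereal x"
proof -
  have fin: "finite_measure P" "finite_measure Q" using P Q by (auto simp: prob_space_def)
  have val: "(if \<alpha> = 1 then ext_integral m (\<lambda>x. xlog_ratio (p x) (q x))
      else ereal (1 / (\<alpha> - 1)) * ext_log (ext_integral m (\<lambda>x. power_prod \<alpha> (p x) (q x)))) = enn2ereal x"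
    if cd: "common_densities P Q m p q" for m p q
  proof -
    have [measurable]: "p \<in> borel_measurable m" "q \<in> borel_measurable m" 
      and P': "P = density m p" and Q': "Q = density m q" 
      and nn: "\<And>x. x \<in> space m \<Longrightarrow> 0 \<le> p x" "\<And>x. x \<in> space m \<Longrightarrow> 0 \<le> q x"
      using cd by (auto simp: common_densities_def)
    have p1: "(\<integral>\<^sup>+x. ennreal (p x) \<partial>m) = 1" and q1: "(\<integral>\<^sup>+x. ennreal (q x) \<partial>m) = 1"
      using prob_space.emeasure_space_1[OF P] prob_space.emeasure_space_1[OF Q]
      by (auto simp: P' Q' emeasure_density cong: nn_integral_cong)
    have tf [measurable]: "(\<lambda>x. tsallis_fun \<alpha> (p x) (q x)) \<in> borel_measurable m"
      using nn assms(1) by (intro measurable_tsallis_fun) auto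
    have I: "(\<integral>\<^sup>+x. tsallis_fun \<alpha> (p x) (q x) \<partial>m) = tsallis_of_renyi \<alpha> x"
      unfolding T[symmetric] using sets.sigma_algebra_axioms[of P]
      by (intro partition_div_finite[OF assms(1) cd fin, symmetric] sigma_algebra_approximable)
        (auto simp: sigma_algebra_def)
    show ?thesis
    proof (cases "\<alpha> = 1")
      case True
      let ?u = "\<lambda>x. e2ennreal (xlog_ratio (p x) (q x))" and ?v = "\<lambda>x. e2ennreal (- xlog_ratio (p x) (q x))"
      have [measurable]: "(\<lambda>x. xlog_ratio (p x) (q x)) \<in> borel_measurable m"
        unfolding xlog_ratio_def by measurable
      \<comment> \<open>The formula for the integrand with every subtracted term moved across, so
        that it can be integrated in \<open>ennreal\<close>. The bound by q expresses nonnegativity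
        of the integrand and keeps the integral of the negative part finite.\<close>
      have pw: "tsallis_fun 1 (p x) (q x) + ?v x + p x = ?u x + q x" "?v x \<le> q x" if "x \<in> space m" for x
      proof -
        obtain r where "xlog_ratio (p x) (q x) = \<infinity> \<or> xlog_ratio (p x) (q x) = ereal r"
          by (cases "xlog_ratio (p x) (q x)") (auto simp: xlog_ratio_def split: if_splits)
        moreover have "0 \<le> tsallis_integrand 1 (p x) (q x)" using tsallis_integrand_nonneg nn that by auto
        ultimately show "tsallis_fun 1 (p x) (q x) + ?v x + p x = ?u x + q x" "?v x \<le> q x"
          using nn[OF that]
          by (auto simp: tsallis_fun_def tsallis_integrand_def e2ennreal_ereal zero_ereal_def 
              ennreal_plus[symmetric] e2ennreal_neg simp del: ennreal_plus intro!: ennreal_leI)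
             (cases "0 \<le> r"; auto simp: ennreal_neg ennreal_plus[symmetric] simp del: ennreal_plus)
      qed
      have "(\<integral>\<^sup>+x. tsallis_fun 1 (p x) (q x) \<partial>m) + (\<integral>\<^sup>+x. ?v x \<partial>m) + 1 = (\<integral>\<^sup>+x. tsallis_fun 1 (p x) (q x) + ?v x + p x \<partial>m)"
        using tf by (simp add: nn_integral_add p1 True)
      also have "\<dots> = (\<integral>\<^sup>+x. ?u x + q x \<partial>m)" using pw by (intro nn_integral_cong) auto
      also have "\<dots> = (\<integral>\<^sup>+x. ?u x \<partial>m) + 1" by (simp add: nn_integral_add q1)
      finally have eq: "(\<integral>\<^sup>+x. ?u x \<partial>m) = x + (\<integral>\<^sup>+x. ?v x \<partial>m)"
        using I True by (simp add: ennreal_add_left_cancel add.commute[of _ 1] tsallis_of_renyi_def)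
      have "(\<integral>\<^sup>+x. ?v x \<partial>m) \<le> 1"
        unfolding q1[symmetric] by (intro nn_integral_mono pw)
      then obtain v where v: "(\<integral>\<^sup>+x. ?v x \<partial>m) = ennreal v" "0 \<le> v"
        by (cases "\<integral>\<^sup>+x. ?v x \<partial>m") (auto simp: top_unique)
      have "ext_integral m (\<lambda>x. xlog_ratio (p x) (q x)) = enn2ereal x"
        unfolding ext_integral_def eq unfolding v using v(2)
        by (cases x) (auto simp: plus_ennreal.rep_eq enn2ereal_ennreal)
      then show ?thesis using True by simp
    next
      case False
      let ?W = "\<lambda>x. e2ennreal (power_prod \<alpha> (p x) (q x))"
      have pp: "0 \<le> power_prod \<alpha> a b" for a b
        unfolding power_prod_def by (cases "b powr (\<alpha> - 1) = 0") (auto simp: divide_ereal_def)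
      have H: "ext_integral m (\<lambda>x. power_prod \<alpha> (p x) (q x)) = enn2ereal (\<integral>\<^sup>+x. ?W x \<partial>m)"
        by (rule ext_integral_nonneg) (rule pp)
      have [measurable]: "(\<lambda>x. power_prod \<alpha> (p x) (q x)) \<in> borel_measurable m"
        unfolding power_prod_def by measurable
      show ?thesis
      proof (cases "\<alpha> < 1")
        case True
        \<comment> \<open>Again only sums occur, so the integrals can be separated before any of
          them is known to be finite.\<close>
        have pw: "ennreal (1 - \<alpha>) * tsallis_fun \<alpha> (p x) (q x) + ?W x = ennreal \<alpha> * p x + ennreal (1 - \<alpha>) * q x" if "x \<in> space m" for x
        proof -
          have 0: "0 \<le> tsallis_integrand \<alpha> (p x) (q x)" using tsallis_integrand_nonneg nn that assms(1) by auto
          then have "0 \<le> \<alpha> * p x + (1 - \<alpha>) * q x - p x powr \<alpha> * q x powr (1 - \<alpha>)"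
            using True by (simp add: tsallis_integrand_def power_prod_def zero_ereal_def zero_le_divide_iff)
          then show ?thesis using nn[OF that] True assms(1)
            by (simp add: tsallis_fun_def tsallis_integrand_def power_prod_def e2ennreal_ereal zero_ereal_def
               ennreal_plus[symmetric] ennreal_mult'[symmetric] ennreal_mult''[symmetric] del: ennreal_plus)
        qed
        have "ennreal (1 - \<alpha>) * tsallis_of_renyi \<alpha> x + (\<integral>\<^sup>+x. ?W x \<partial>m) = (\<integral>\<^sup>+x. ennreal (1 - \<alpha>) * tsallis_fun \<alpha> (p x) (q x) + ?W x \<partial>m)"
          by (simp add: nn_integral_add nn_integral_cmult I)
        also have "\<dots> = (\<integral>\<^sup>+x. ennreal \<alpha> * p x + ennreal (1 - \<alpha>) * q x \<partial>m)"
          using pw by (intro nn_integral_cong) auto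
        also have "\<dots> = ennreal \<alpha> + ennreal (1 - \<alpha>)"
          by (simp add: nn_integral_add nn_integral_cmult p1 q1)
        also have "\<dots> = 1" using True assms(1) by (simp add: ennreal_plus[symmetric] del: ennreal_plus)
        finally have eq: "ennreal (1 - \<alpha>) * tsallis_of_renyi \<alpha> x + (\<integral>\<^sup>+x. ?W x \<partial>m) = 1" .
        then obtain w where w: "(\<integral>\<^sup>+x. ?W x \<partial>m) = ennreal w" "0 \<le> w"
          by (cases "\<integral>\<^sup>+x. ?W x \<partial>m") auto
        show ?thesis
        proof (cases x)
          case (real r)
          have *: "0 \<le> (exp ((\<alpha> - 1) * r) - 1) / (\<alpha> - 1)"
            using True real by (auto intro!: divide_nonpos_neg simp: mult_nonpos_nonneg)
          have "(1 - \<alpha>) * ((exp ((\<alpha> - 1) * r) - 1) / (\<alpha> - 1)) + w = 1"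
            using eq * True w(2) unfolding w real(2) tsallis_of_renyi_ennreal[OF False real(1)]
            by (intro ennreal_mult_add_eq_1D) auto
          moreover have "(1 - \<alpha>) * ((exp ((\<alpha> - 1) * r) - 1) / (\<alpha> - 1)) = - (exp ((\<alpha> - 1) * r) - 1)"
            using False by (simp add: divide_simps) (simp add: algebra_simps)
          ultimately have "w = exp ((\<alpha> - 1) * r)" by simp
          then show ?thesis using False real unfolding H w by (simp add: ext_log_def enn2ereal_ennreal)
        next
          case top
          \<comment> \<open>An infinite divergence of order below 1 means that the Hellinger
            integral is 0: the logarithm is -\<infinity> and its factor 1 / (\<alpha> - 1) is
            negative.\<close>
          have "(1 - \<alpha>) * (1 / (1 - \<alpha>)) + w = 1"
            using eq True w(2) False unfolding w top tsallis_of_renyi_def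
            by (intro ennreal_mult_add_eq_1D) auto
          then have "w = 0" using True by simp
          then show ?thesis using False True top unfolding H w
            by (simp add: ext_log_def zero_ennreal.rep_eq)
        qed
      next
        case F: False
        have pw: "?W x + ennreal (\<alpha> - 1) * q x = ennreal (\<alpha> - 1) * tsallis_fun \<alpha> (p x) (q x) + ennreal \<alpha> * p x" if "x \<in> space m" for x
        proof (cases "power_prod \<alpha> (p x) (q x)")
          case (real r)
          have 0: "0 \<le> tsallis_integrand \<alpha> (p x) (q x)" using tsallis_integrand_nonneg nn that assms(1) by auto
          define t where "t = (\<alpha> * p x + (1 - \<alpha>) * q x - r) / (1 - \<alpha>)"
          have "r + (\<alpha> - 1) * q x = (\<alpha> - 1) * t + \<alpha> * p x"
            using F False by (simp add: t_def field_simps)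
          moreover have t: "tsallis_integrand \<alpha> (p x) (q x) = ereal t"
            using False real by (simp add: tsallis_integrand_def t_def)
          moreover have "0 \<le> t" using 0 by (simp add: t zero_ereal_def)
          ultimately show ?thesis using nn[OF that] F assms(1) real pp[of "p x" "q x"]
            by (simp add: tsallis_fun_def e2ennreal_ereal zero_ereal_def
               ennreal_plus[symmetric] ennreal_mult'[symmetric] ennreal_mult''[symmetric] del: ennreal_plus)
        next
          case PInf
          then show ?thesis using False F
            by (simp add: tsallis_fun_def tsallis_integrand_def divide_ereal_def ennreal_mult_top)
        qed (use pp[of "p x" "q x"] in auto)
        have "(\<integral>\<^sup>+x. ?W x \<partial>m) + ennreal (\<alpha> - 1) = (\<integral>\<^sup>+x. ?W x + ennreal (\<alpha> - 1) * q x \<partial>m)"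
          by (simp add: nn_integral_add nn_integral_cmult q1)
        also have "\<dots> = (\<integral>\<^sup>+x. ennreal (\<alpha> - 1) * tsallis_fun \<alpha> (p x) (q x) + ennreal \<alpha> * p x \<partial>m)"
          using pw by (intro nn_integral_cong) auto
        also have "\<dots> = ennreal (\<alpha> - 1) * tsallis_of_renyi \<alpha> x + ennreal \<alpha>"
          by (simp add: nn_integral_add nn_integral_cmult p1 I)
        finally have eq: "(\<integral>\<^sup>+x. ?W x \<partial>m) + ennreal (\<alpha> - 1) = ennreal (\<alpha> - 1) * tsallis_of_renyi \<alpha> x + ennreal \<alpha>" .
        show ?thesis
        proof (cases x)
          case (real r)
          have *: "0 \<le> (exp ((\<alpha> - 1) * r) - 1) / (\<alpha> - 1)"
            using F real False by auto
          have eq': "(\<integral>\<^sup>+x. ?W x \<partial>m) + ennreal (\<alpha> - 1) = ennreal ((\<alpha> - 1) * ((exp ((\<alpha> - 1) * r) - 1) / (\<alpha> - 1)) + \<alpha>)"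
            using eq * F False real(1) unfolding real(2) tsallis_of_renyi_ennreal[OF False real(1)]
            by (simp add: ennreal_mult[symmetric] ennreal_plus[symmetric] del: ennreal_plus)
          then obtain w where w: "(\<integral>\<^sup>+x. ?W x \<partial>m) = ennreal w" "0 \<le> w"
            by (cases "\<integral>\<^sup>+x. ?W x \<partial>m") auto
          have "w + (\<alpha> - 1) = (\<alpha> - 1) * ((exp ((\<alpha> - 1) * r) - 1) / (\<alpha> - 1)) + \<alpha>"
            using eq' w F False real(1) unfolding w by (simp add: ennreal_plus[symmetric] del: ennreal_plus)
          then have "w = exp ((\<alpha> - 1) * r)" using F False by simp
          then show ?thesis using False real unfolding H w by (simp add: ext_log_def enn2ereal_ennreal)
        next
          case top
          then have "(\<integral>\<^sup>+x. ?W x \<partial>m) = \<top>"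
            using eq F False by (simp add: tsallis_of_renyi_def ennreal_mult_top)
          then show ?thesis using F False top unfolding H by (simp add: ext_log_def)
        qed
      qed
    qed
  qed
  obtain m p q where cd: "common_densities P Q m p q"
    using common_densities_exist[OF cofinite_cover_finite_measure[OF fin] sets] .
  show ?thesis
    unfolding renyi_div_def
  proof (rule the_equality)
    show "\<exists>m p q. common_densities P Q m p q \<and> enn2ereal x =
       (if \<alpha> = 1 then ext_integral m (\<lambda>x. xlog_ratio (p x) (q x))
        else ereal (1 / (\<alpha> - 1)) * ext_log (ext_integral m (\<lambda>x. power_prod \<alpha> (p x) (q x))))"
      using cd val[OF cd] by metis
  qed (use val in auto)
qed

section \<open>Vectors of independent Poisson variables\<close>

text \<open>Counts are values of measures and hence of type \<open>ennreal\<close>. The value at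
  infinity is 0; for Poisson laws of finite mean infinite counts form a null event.\<close>

definition nat_of_ennreal :: "ennreal \<Rightarrow> nat" where
  "nat_of_ennreal x = nat \<lfloor>enn2real x\<rfloor>"

lemma nat_of_ennreal_of_nat [simp]: "nat_of_ennreal (of_nat k) = k"
  by (simp add: nat_of_ennreal_def ennreal_of_nat_eq_real_of_nat)

lemma measurable_nat_of_ennreal [measurable]: "nat_of_ennreal \<in> measurable borel (count_space UNIV)"
  unfolding nat_of_ennreal_def by measurable

lemma poisson_distr_finite:
  "0 < r \<Longrightarrow> poisson_distr (ennreal r) = distr (measure_pmf (poisson_pmf r)) borel of_nat"
  by (simp add: poisson_distr_def)

lemma sets_poisson_distr [simp, measurable_cong]: "sets (poisson_distr r) = sets borel"
  by (simp add: poisson_distr_def)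

lemma space_poisson_distr [simp]: "space (poisson_distr r) = UNIV"
  by (simp add: poisson_distr_def)

lemma prob_space_poisson_distr: "prob_space (poisson_distr r)"
  by (auto simp: poisson_distr_def intro!: prob_space_return measure_pmf.prob_space_distr)

lemma poisson_sums_1: "(\<lambda>k. r ^ k / fact k * exp (- r)) sums (1 :: real)"
  using sums_mult2[OF exp_converges[of r], of "exp (- r)"]
  by (simp add: exp_minus_inverse divide_inverse mult.commute)

lemma emeasure_poisson_distr_nat:
  assumes "0 \<le> r"
  shows "emeasure (poisson_distr (ennreal r)) {of_nat k} = ennreal (r ^ k / fact k * exp (- r))"
proof (cases "r = 0")
  case True
  then show ?thesis
    by (cases "k = 0") (auto simp: poisson_distr_def)
next
  case False
  have "emeasure (poisson_distr (ennreal r)) {of_nat k} = emeasure (measure_pmf (poisson_pmf r)) (of_nat -` {of_nat k :: ennreal})"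
    using False assms by (simp add: poisson_distr_finite emeasure_distr)
  also have "of_nat -` {of_nat k :: ennreal} = {k}"
    by auto
  also have "emeasure (measure_pmf (poisson_pmf r)) {k} = ennreal (r ^ k / fact k * exp (- r))"
    using False assms by (simp add: emeasure_pmf_single)
  finally show ?thesis .
qed

lemma AE_poisson_distr_nat:
  assumes "r \<noteq> \<infinity>"
  shows "AE x in poisson_distr r. x = of_nat (nat_of_ennreal x)"
proof -
  have [measurable]: "Measurable.pred borel (\<lambda>x :: ennreal. x = of_nat (nat_of_ennreal x))"
    by measurable
  have "nat_of_ennreal 0 = 0" using nat_of_ennreal_of_nat[of 0] by simp
  show ?thesis
  proof (cases "r = 0")
    case True
    have "AE x in return borel (0 :: ennreal). x = of_nat (nat_of_ennreal x)"
      using \<open>nat_of_ennreal 0 = 0\<close> by (subst AE_return) auto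
    moreover have "poisson_distr r = return borel 0" using True by (simp add: poisson_distr_def)
    ultimately show ?thesis by (simp only:)
  next
    case False
    have "AE x in distr (measure_pmf (poisson_pmf (enn2real r))) borel (of_nat :: nat \<Rightarrow> ennreal). x = of_nat (nat_of_ennreal x)"
      by (subst AE_distr_iff) auto
    moreover have "poisson_distr r = distr (measure_pmf (poisson_pmf (enn2real r))) borel of_nat"
      using False assms by (simp add: poisson_distr_def)
    ultimately show ?thesis by (simp only:)
  qed
qed

lemma nn_integral_poisson_distr:
  assumes "0 \<le> r" "f \<in> borel_measurable borel"
  shows "(\<integral>\<^sup>+x. f x \<partial>poisson_distr (ennreal r)) = (\<Sum>k. ennreal (r ^ k / fact k * exp (- r)) * f (of_nat k))"
proof (cases "r = 0")
  case True
  have "(\<Sum>k. ennreal (r ^ k / fact k * exp (- r)) * f (of_nat k)) = (\<Sum>k\<in>{0}. ennreal (r ^ k / fact k * exp (- r)) * f (of_nat k))"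
    by (rule suminf_finite) (use True in auto)
  then show ?thesis using True assms
    by (simp add: poisson_distr_def nn_integral_return)
next
  case False
  have "(\<integral>\<^sup>+x. f x \<partial>poisson_distr (ennreal r)) = (\<integral>\<^sup>+k. f (of_nat k) \<partial>measure_pmf (poisson_pmf r))"
    using False assms by (simp add: poisson_distr_finite nn_integral_distr)
  also have "\<dots> = (\<integral>\<^sup>+k. ennreal (pmf (poisson_pmf r) k) * f (of_nat k) \<partial>count_space UNIV)"
    by (simp add: nn_integral_measure_pmf)
  finally show ?thesis using False assms by (simp add: nn_integral_count_space_nat)
qed

text \<open>The density of the Poisson law of mean a with respect to that of mean 1, which charges
  every natural number and therefore dominates all finite means. For a = 0 the convention
  \<open>0 ^ 0 = 1\<close> yields the point mass at 0.\<close>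

definition poisson_weight :: "real \<Rightarrow> ennreal \<Rightarrow> real" where
  "poisson_weight a x = exp (1 - a) * a ^ nat_of_ennreal x"

lemma poisson_weight_nonneg: "0 \<le> a \<Longrightarrow> 0 \<le> poisson_weight a x"
  by (simp add: poisson_weight_def)

lemma measurable_poisson_weight [measurable]: "poisson_weight a \<in> borel_measurable borel"
  unfolding poisson_weight_def by measurable

lemma poisson_distr_eq_density:
  assumes "0 \<le> a"
  shows "poisson_distr (ennreal a) = density (poisson_distr 1) (poisson_weight a)"
proof (rule measure_eqI)
  fix A assume "A \<in> sets (poisson_distr (ennreal a))"
  then have [measurable]: "A \<in> sets borel" by simp
  have "emeasure (poisson_distr (ennreal a)) A = (\<integral>\<^sup>+x. indicator A x \<partial>poisson_distr (ennreal a))"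
    by simp
  also have "\<dots> = (\<integral>\<^sup>+x. ennreal (poisson_weight a x) * indicator A x \<partial>poisson_distr (ennreal 1))"
  proof -
    have *: "a ^ k / fact k * exp (- a) = 1 ^ k / fact k * exp (- 1) * poisson_weight a (of_nat k)" for k
      by (simp add: poisson_weight_def exp_diff exp_minus field_simps)
    then have "ennreal (a ^ k / fact k * exp (- a)) * u
        = ennreal (1 ^ k / fact k * exp (- 1)) * (ennreal (poisson_weight a (of_nat k)) * u)" for k u
      using assms by (subst *, subst ennreal_mult) (auto simp: poisson_weight_nonneg mult.assoc)
    then show ?thesis using assms by (simp only: nn_integral_poisson_distr zero_le_one borel_measurable_indicator
       borel_measurable_times_ennreal measurable_compose[OF measurable_poisson_weight measurable_ennreal] \<open>A \<in> sets borel\<close>)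
  qed
  also have "\<dots> = emeasure (density (poisson_distr 1) (poisson_weight a)) A"
    by (simp add: emeasure_density)
  finally show "emeasure (poisson_distr (ennreal a)) A = emeasure (density (poisson_distr 1) (poisson_weight a)) A" .
qed simp

text \<open>The Poisson mean, used at \<alpha> = 1, where the log-likelihood ratio is affine in the
  counts.\<close>

lemma nn_integral_nat_of_poisson_distr:
  assumes "0 \<le> r"
  shows "(\<integral>\<^sup>+x. ennreal (real (nat_of_ennreal x)) \<partial>poisson_distr (ennreal r)) = ennreal r"
proof -
  have "(\<lambda>k. r * (r ^ k / fact k * exp (- r))) sums (r * 1)"
    by (rule sums_mult[OF poisson_sums_1])
  moreover have "r * (r ^ k / fact k * exp (- r)) = r ^ Suc k / fact (Suc k) * exp (- r) * real (Suc k)" for k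
    by (simp add: field_simps del: of_nat_Suc)
  ultimately have "(\<lambda>k. r ^ Suc k / fact (Suc k) * exp (- r) * real (Suc k)) sums r"
    by (simp only: mult_1_right)
  then have "(\<lambda>k. r ^ k / fact k * exp (- r) * real k) sums r"
    by (subst (asm) sums_Suc_iff) simp
  then have "(\<Sum>k. ennreal (r ^ k / fact k * exp (- r) * real k)) = ennreal r"
    using assms by (intro suminf_ennreal_eq) auto
  moreover have "ennreal (r ^ k / fact k * exp (- r) * real k) = ennreal (r ^ k / fact k * exp (- r)) * ennreal (real k)" for k
    using assms by (intro ennreal_mult) auto
  ultimately show ?thesis using assms by (simp only: nn_integral_poisson_distr) (simp add: nn_integral_poisson_distr)
qed

section \<open>Product laws and their densities\<close>

locale poisson_vector =
  fixes I :: "'i set" and a :: "'i \<Rightarrow> real"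
  assumes finite_I [simp, intro]: "finite I" and a_nonneg: "\<And>i. i \<in> I \<Longrightarrow> 0 \<le> a i"
begin

definition law :: "('i \<Rightarrow> ennreal) measure" where
  "law = PiM I (\<lambda>i. poisson_distr (ennreal (a i)))"

definition dens :: "('i \<Rightarrow> ennreal) \<Rightarrow> real" where
  "dens x = (\<Prod>i\<in>I. poisson_weight (a i) (x i))"

lemma sets_law [measurable_cong]: "sets law = sets (PiM I (\<lambda>_. borel))"
  unfolding law_def by (intro sets_PiM_cong) auto

sublocale law: prob_space law
  unfolding law_def by (intro prob_space_PiM prob_space_poisson_distr)

lemma dens_nonneg: "0 \<le> dens x"
  unfolding dens_def by (intro prod_nonneg poisson_weight_nonneg a_nonneg)

lemma measurable_dens [measurable]: "dens \<in> borel_measurable (PiM I (\<lambda>_. poisson_distr 1))"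
  unfolding dens_def by measurable

lemma law_eq_density: "law = density (PiM I (\<lambda>_. poisson_distr 1)) dens"
proof -
  interpret one: product_prob_space "\<lambda>_. poisson_distr 1" I
    by (intro product_prob_spaceI prob_space_poisson_distr)
  interpret as: product_prob_space "\<lambda>i. poisson_distr (ennreal (a i))" I
    by (intro product_prob_spaceI prob_space_poisson_distr)
  have "density (PiM I (\<lambda>_. poisson_distr 1)) dens = PiM I (\<lambda>i. poisson_distr (ennreal (a i)))"
  proof (rule as.PiM_eqI)
    show "sets (density (PiM I (\<lambda>_. poisson_distr 1)) dens) = sets (PiM I (\<lambda>i. poisson_distr (ennreal (a i))))"
      by (auto intro!: sets_PiM_cong)
  next
    fix A assume "\<And>i. i \<in> I \<Longrightarrow> A i \<in> sets (poisson_distr (ennreal (a i)))"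
    then have A [measurable]: "\<And>i. i \<in> I \<Longrightarrow> A i \<in> sets borel" by simp
    have [measurable]: "Pi\<^sub>E I A \<in> sets (PiM I (\<lambda>_. poisson_distr 1))"
      using A by (intro sets_PiM_I_finite) auto
    have "emeasure (density (PiM I (\<lambda>_. poisson_distr 1)) dens) (Pi\<^sub>E I A)
        = (\<integral>\<^sup>+x. ennreal (dens x) * indicator (Pi\<^sub>E I A) x \<partial>PiM I (\<lambda>_. poisson_distr 1))"
      by (simp add: emeasure_density)
    also have "\<dots> = (\<integral>\<^sup>+x. (\<Prod>i\<in>I. ennreal (poisson_weight (a i) (x i)) * indicator (A i) (x i)) \<partial>PiM I (\<lambda>_. poisson_distr 1))"
    proof (intro nn_integral_cong)
      fix x assume "x \<in> space (PiM I (\<lambda>_. poisson_distr 1))"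
      then have "indicator (Pi\<^sub>E I A) x = (\<Prod>i\<in>I. indicator (A i) (x i) :: ennreal)"
        by (auto simp: space_PiM PiE_def indicator_def prod_zero_iff Pi_def)
      then show "ennreal (dens x) * indicator (Pi\<^sub>E I A) x = (\<Prod>i\<in>I. ennreal (poisson_weight (a i) (x i)) * indicator (A i) (x i))"
        by (simp add: dens_def prod.distrib prod_ennreal[symmetric] poisson_weight_nonneg a_nonneg)
    qed
    also have "\<dots> = (\<Prod>i\<in>I. \<integral>\<^sup>+x. ennreal (poisson_weight (a i) x) * indicator (A i) x \<partial>poisson_distr 1)"
      by (intro one.product_nn_integral_prod) auto
    also have "\<dots> = (\<Prod>i\<in>I. emeasure (poisson_distr (ennreal (a i))) (A i))"
      by (intro prod.cong refl) (simp add: poisson_distr_eq_density a_nonneg emeasure_density)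
    finally show "emeasure (density (PiM I (\<lambda>_. poisson_distr 1)) dens) (Pi\<^sub>E I A)
      = (\<Prod>i\<in>I. emeasure (poisson_distr (ennreal (a i))) (A i))" .
  qed simp
  then show ?thesis by (simp add: law_def)
qed

lemma distr_component:
  assumes "i \<in> I"
  shows "distr law (poisson_distr (ennreal (a i))) (\<lambda>x. x i) = poisson_distr (ennreal (a i))"
proof -
  interpret product_prob_space "\<lambda>i. poisson_distr (ennreal (a i))" I
    by (intro product_prob_spaceI prob_space_poisson_distr)
  show ?thesis unfolding law_def by (rule PiM_component[OF assms])
qed

lemma has_bochner_integral_dens: "has_bochner_integral (PiM I (\<lambda>_. poisson_distr 1)) dens 1"
proof (rule has_bochner_integral_nn_integral)
  have "(\<integral>\<^sup>+x. ennreal (dens x) \<partial>PiM I (\<lambda>_. poisson_distr 1)) = emeasure law (space law)"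
    unfolding law_eq_density by (simp add: emeasure_density cong: nn_integral_cong)
  then show "(\<integral>\<^sup>+x. ennreal (dens x) \<partial>PiM I (\<lambda>_. poisson_distr 1)) = ennreal 1"
    by (simp add: law.emeasure_space_1)
qed (auto simp: dens_nonneg)

lemma has_bochner_integral_dens_count:
  assumes "i \<in> I"
  shows "has_bochner_integral (PiM I (\<lambda>_. poisson_distr 1)) (\<lambda>x. dens x * real (nat_of_ennreal (x i))) (a i)"
proof (rule has_bochner_integral_nn_integral)
  have [measurable]: "(\<lambda>x. x i) \<in> measurable (PiM I (\<lambda>_. poisson_distr 1)) borel"
    using measurable_component_singleton[OF assms, of "\<lambda>_. poisson_distr 1"] by (simp cong: measurable_cong_sets)
  show "(\<lambda>x. dens x * real (nat_of_ennreal (x i))) \<in> borel_measurable (PiM I (\<lambda>_. poisson_distr 1))"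
    by measurable
  have [measurable]: "(\<lambda>x. x i) \<in> measurable law borel"
    using assms by (auto simp: measurable_cong_sets[OF sets_law refl])
  have "(\<integral>\<^sup>+x. ennreal (dens x * real (nat_of_ennreal (x i))) \<partial>PiM I (\<lambda>_. poisson_distr 1))
      = (\<integral>\<^sup>+x. ennreal (real (nat_of_ennreal (x i))) \<partial>law)"
    unfolding law_eq_density by (simp add: nn_integral_density ennreal_mult dens_nonneg)
  also have "\<dots> = (\<integral>\<^sup>+x. ennreal (real (nat_of_ennreal x)) \<partial>distr law (poisson_distr (ennreal (a i))) (\<lambda>x. x i))"
    by (subst nn_integral_distr) (auto simp: measurable_cong_sets[OF refl sets_poisson_distr]
        measurable_cong_sets[OF sets_poisson_distr refl])
  also have "\<dots> = ennreal (a i)"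
    using assms by (simp add: distr_component nn_integral_nat_of_poisson_distr a_nonneg)
  finally show "(\<integral>\<^sup>+x. ennreal (dens x * real (nat_of_ennreal (x i))) \<partial>PiM I (\<lambda>_. poisson_distr 1)) = ennreal (a i)" .
qed (use assms in \<open>auto simp: dens_nonneg a_nonneg\<close>)

end

section \<open>Divergence of two Poisson vectors\<close>

lemma power_powr_commute: "0 \<le> (x :: real) \<Longrightarrow> (x ^ n) powr b = (x powr b) ^ n"
  by (induction n) (auto simp: powr_mult)

text \<open>The geometric mixture of two Poisson weights is a multiple of the Poisson weight of mean
  \<open>a powr \<alpha> * b powr (1 - \<alpha>)\<close>. As that weight integrates to 1, the
  exponential factor is the Hellinger integral of the two laws.\<close>

lemma poisson_weight_powr:
  assumes "0 \<le> a" "0 \<le> b"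
  shows "poisson_weight a x powr \<alpha> * poisson_weight b x powr (1 - \<alpha>)
    = exp (a powr \<alpha> * b powr (1 - \<alpha>) - \<alpha> * a - (1 - \<alpha>) * b) * poisson_weight (a powr \<alpha> * b powr (1 - \<alpha>)) x"
proof -
  have "poisson_weight a x powr \<alpha> * poisson_weight b x powr (1 - \<alpha>)
    = exp (\<alpha> * (1 - a)) * exp ((1 - \<alpha>) * (1 - b)) * (a powr \<alpha> * b powr (1 - \<alpha>)) ^ nat_of_ennreal x"
    using assms by (simp add: poisson_weight_def powr_mult power_powr_commute power_mult_distrib exp_powr_real mult.commute)
  also have "exp (\<alpha> * (1 - a)) * exp ((1 - \<alpha>) * (1 - b))
     = exp (a powr \<alpha> * b powr (1 - \<alpha>) - \<alpha> * a - (1 - \<alpha>) * b) * exp (1 - a powr \<alpha> * b powr (1 - \<alpha>))"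
    by (simp add: exp_add[symmetric] algebra_simps)
  finally show ?thesis by (simp add: poisson_weight_def)
qed

text \<open>Because \<open>0 powr r\<close> is 0, the interior formula persists on the axes, except
  where the value is infinite: \<alpha> > 1 and y = 0 < x.\<close>

lemma tsallis_integrand_real:
  assumes "\<alpha> \<noteq> 1" "0 < \<alpha>" "0 \<le> x" "0 \<le> y" "\<alpha> < 1 \<or> y \<noteq> 0 \<or> x = 0"
  shows "tsallis_integrand \<alpha> x y = ereal ((\<alpha> * x + (1 - \<alpha>) * y - x powr \<alpha> * y powr (1 - \<alpha>)) / (1 - \<alpha>))"
  using assms tsallis_integrand_pos[of x y \<alpha>] tsallis_integrand_0_left[of \<alpha> y] tsallis_integrand_0_right[of \<alpha> x]
  by (cases "x = 0"; cases "y = 0") auto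

lemma tsallis_integrand_1_real:
  assumes "0 \<le> x" "0 \<le> y" "y \<noteq> 0 \<or> x = 0"
  shows "tsallis_integrand 1 x y = ereal (x * ln (x / y) + y - x)"
  using assms tsallis_integrand_pos[of x y 1] tsallis_integrand_0_left[of 1 y] 
  by (cases "x = 0"; cases "y = 0") auto

lemma poisson_weight_0_iff: "0 \<le> a \<Longrightarrow> poisson_weight a x = 0 \<longleftrightarrow> a = 0 \<and> nat_of_ennreal x \<noteq> 0"
  by (simp add: poisson_weight_def)

text \<open>If a = 0, a nonzero weight forces the count 0, and the term with
  \<open>ln (a / b)\<close> vanishes.\<close>

lemma poisson_weight_ln_ratio:
  assumes "0 \<le> a" "0 \<le> b" "b = 0 \<longrightarrow> a = 0" "poisson_weight a x \<noteq> 0"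
  shows "ln (poisson_weight a x / poisson_weight b x) = b - a + real (nat_of_ennreal x) * ln (a / b)"
proof (cases "a = 0")
  case True
  then show ?thesis using assms by (simp add: poisson_weight_def exp_diff[symmetric] del: exp_diff) 
next
  case False
  then have "0 < a" "0 < b" using assms by auto
  then show ?thesis by (simp add: poisson_weight_def ln_mult ln_div ln_realpow algebra_simps)
qed

locale poisson_vector_pair = A: poisson_vector I a + B: poisson_vector I b
  for I :: "'i set" and a b
begin

abbreviation base :: "('i \<Rightarrow> ennreal) measure" where "base \<equiv> PiM I (\<lambda>_. poisson_distr 1)"

lemma common_densities: "common_densities A.law B.law base A.dens B.dens"
proof -
  interpret one: prob_space base
    by (intro prob_space_PiM prob_space_poisson_distr)
  have "sigma_finite_measure base" by unfold_locales
  then show ?thesis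
    by (auto simp: common_densities_def A.law_eq_density B.law_eq_density A.dens_nonneg B.dens_nonneg)
qed

lemma partition_div_eq_nn_integral:
  assumes "0 < \<alpha>"
  shows "partition_div \<alpha> (sets A.law) A.law B.law = (\<integral>\<^sup>+x. tsallis_fun \<alpha> (A.dens x) (B.dens x) \<partial>base)"
  using sets.sigma_algebra_axioms[of A.law] A.law.finite_measure_axioms B.law.finite_measure_axioms
  by (intro partition_div_finite[OF assms common_densities] sigma_algebra_approximable)
    (auto simp: sigma_algebra_def)

text \<open>The event that the i-th count is nonzero has positive mass under the first law and none
  under the second; Jensen's inequality on this single event already gives infinity.\<close>

lemma nn_integral_singular:
  assumes "1 \<le> \<alpha>" and i: "i \<in> I" "a i \<noteq> 0" "b i = 0"
  shows "(\<integral>\<^sup>+x. tsallis_fun \<alpha> (A.dens x) (B.dens x) \<partial>base) = \<top>"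
proof -
  have [measurable]: "(\<lambda>x. x i) \<in> measurable base borel"
    using measurable_component_singleton[OF i(1), of "\<lambda>_. poisson_distr 1"] by (simp cong: measurable_cong_sets)
  define E where "E = {x\<in>space base. nat_of_ennreal (x i) \<noteq> 0}"
  have E [measurable]: "E \<in> sets base" unfolding E_def by measurable
  have "measure B.law E = 0"
  proof -
    have "emeasure B.law E = (\<integral>\<^sup>+x. ennreal (B.dens x) * indicator E x \<partial>base)"
      unfolding B.law_eq_density by (simp add: emeasure_density)
    also have "\<dots> = (\<integral>\<^sup>+x. 0 \<partial>base)"
      using i by (intro nn_integral_cong)
        (auto simp: E_def B.dens_def poisson_weight_0_iff split: split_indicator intro!: prod_zero bexI[of _ i]
          arg_cong[where f = ennreal and y = 0, simplified])
    finally show ?thesis by (simp add: measure_def)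
  qed
  moreover have "measure A.law E > 0"
  proof -
    have "ennreal (a i ^ 1 / fact 1 * exp (- a i)) = emeasure (poisson_distr (ennreal (a i))) {of_nat 1}"
      using i A.a_nonneg by (simp only: emeasure_poisson_distr_nat)
    also have "\<dots> \<le> emeasure (poisson_distr (ennreal (a i))) {x. nat_of_ennreal x \<noteq> 0}"
      using nat_of_ennreal_of_nat[of 1] by (intro emeasure_mono) auto
    also have "\<dots> = emeasure (distr A.law (poisson_distr (ennreal (a i))) (\<lambda>x. x i)) {x. nat_of_ennreal x \<noteq> 0}"
      using i by (simp add: A.distr_component)
    also have "\<dots> = emeasure A.law E"
    proof (subst emeasure_distr)
      show "(\<lambda>x. x i) \<in> measurable A.law (poisson_distr (ennreal (a i)))"
        using i by (simp add: measurable_cong_sets[OF A.sets_law sets_poisson_distr])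
      show "{x. nat_of_ennreal x \<noteq> 0} \<in> sets (poisson_distr (ennreal (a i)))" by simp
      have "space A.law = space base" 
        using sets_eq_imp_space_eq[OF A.sets_law] by (simp add: space_PiM)
      then show "emeasure A.law ((\<lambda>x. x i) -` {x. nat_of_ennreal x \<noteq> 0} \<inter> space A.law) = emeasure A.law E"
        by (auto simp: E_def intro!: arg_cong[where f="emeasure A.law"])
    qed
    finally have "ennreal (a i * exp (- a i)) \<le> emeasure A.law E" by simp
    moreover have "0 < a i * exp (- a i)" using i A.a_nonneg[of i] by simp
    ultimately have "0 < emeasure A.law E" by (meson ennreal_less_zero_iff order.strict_trans2)
    then show ?thesis by (simp add: A.law.emeasure_eq_measure)
  qed
  ultimately have "\<top> = tsallis_fun \<alpha> (measure A.law E) (measure B.law E)"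
    using assms(1) by (simp add: tsallis_fun_def tsallis_integrand_0_right)
  also have "\<dots> \<le> (\<integral>\<^sup>+x\<in>E. tsallis_fun \<alpha> (A.dens x) (B.dens x) \<partial>base)"
    using assms(1) by (intro tsallis_fun_measure_le[OF _ common_densities E])
      (auto simp: A.law.emeasure_eq_measure B.law.emeasure_eq_measure)
  also have "\<dots> \<le> (\<integral>\<^sup>+x. tsallis_fun \<alpha> (A.dens x) (B.dens x) \<partial>base)"
    by (intro nn_integral_mono) (auto split: split_indicator)
  finally show ?thesis by (simp add: top_unique)
qed

lemma dens_0_imp:
  assumes "\<And>i. i \<in> I \<Longrightarrow> b i = 0 \<Longrightarrow> a i = 0" "B.dens x = 0"
  shows "A.dens x = 0"
proof -
  obtain i where "i \<in> I" "poisson_weight (b i) (x i) = 0"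
    using assms(2) by (auto simp: B.dens_def)
  then show ?thesis using assms(1)[of i] A.a_nonneg[of i] B.a_nonneg[of i]
    by (auto simp: A.dens_def poisson_weight_0_iff intro!: prod_zero bexI[of _ i])
qed

text \<open>Mixtures multiply over the components, so the Hellinger integral is \<open>exp D\<close>
  with D a sum over components. Hence the Renyi divergence is D / (\<alpha> - 1), and each summand
  of this is the Tsallis integrand at the two means.\<close>

lemma nn_integral_regular:
  assumes \<alpha>: "0 < \<alpha>" "\<alpha> \<noteq> 1" and ab: "\<alpha> < 1 \<or> (\<forall>i\<in>I. b i = 0 \<longrightarrow> a i = 0)"
  shows "(\<integral>\<^sup>+x. tsallis_fun \<alpha> (A.dens x) (B.dens x) \<partial>base)
    = tsallis_of_renyi \<alpha> (\<Sum>i\<in>I. tsallis_fun \<alpha> (a i) (b i))"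
proof -
  define c where "c i = a i powr \<alpha> * b i powr (1 - \<alpha>)" for i
  interpret C: poisson_vector I c
    by standard (auto simp: c_def)
  define D where "D = (\<Sum>i\<in>I. c i - \<alpha> * a i - (1 - \<alpha>) * b i)"
  have pw: "A.dens x powr \<alpha> * B.dens x powr (1 - \<alpha>) = exp D * C.dens x" for x
  proof -
    have "A.dens x powr \<alpha> * B.dens x powr (1 - \<alpha>) =
        (\<Prod>i\<in>I. poisson_weight (a i) (x i) powr \<alpha> * poisson_weight (b i) (x i) powr (1 - \<alpha>))"
      by (simp add: A.dens_def B.dens_def prod_powr_distrib poisson_weight_nonneg A.a_nonneg B.a_nonneg prod.distrib)
    also have "\<dots> = (\<Prod>i\<in>I. exp (c i - \<alpha> * a i - (1 - \<alpha>) * b i) * poisson_weight (c i) (x i))"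
      by (intro prod.cong refl) (simp add: poisson_weight_powr A.a_nonneg B.a_nonneg c_def)
    finally show ?thesis by (simp add: D_def C.dens_def prod.distrib exp_sum)
  qed
  define u where "u x = (\<alpha> * A.dens x + (1 - \<alpha>) * B.dens x - exp D * C.dens x) / (1 - \<alpha>)" for x
  have u: "tsallis_integrand \<alpha> (A.dens x) (B.dens x) = ereal (u x)" for x
    using \<alpha> ab dens_0_imp[of x] A.dens_nonneg[of x] B.dens_nonneg[of x]
    by (subst tsallis_integrand_real) (auto simp: u_def pw)
  have u0: "0 \<le> u x" for x
    using tsallis_integrand_nonneg[OF \<alpha>(1) A.dens_nonneg B.dens_nonneg, of x x] by (simp add: u zero_ereal_def)
  have "has_bochner_integral base u ((\<alpha> * 1 + (1 - \<alpha>) * 1 - exp D * 1) / (1 - \<alpha>))"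
    unfolding u_def
    by (intro has_bochner_integral_divide_zero has_bochner_integral_diff has_bochner_integral_add
        has_bochner_integral_mult_right A.has_bochner_integral_dens B.has_bochner_integral_dens C.has_bochner_integral_dens)
  then have "(\<integral>\<^sup>+x. ennreal (u x) \<partial>base) = ennreal ((1 - exp D) / (1 - \<alpha>))"
    by (subst nn_integral_eq_integral) (auto simp: has_bochner_integral_iff u0)
  moreover have "(\<Sum>i\<in>I. tsallis_fun \<alpha> (a i) (b i)) = ennreal (D / (\<alpha> - 1))" "0 \<le> D / (\<alpha> - 1)"
  proof -
    have t: "tsallis_integrand \<alpha> (a i) (b i) = ereal ((c i - \<alpha> * a i - (1 - \<alpha>) * b i) / (\<alpha> - 1))" if "i \<in> I" for i
      using \<alpha> ab that A.a_nonneg[of i] B.a_nonneg[of i]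
      by (subst tsallis_integrand_real) (auto simp: c_def divide_simps algebra_simps)
    have t0: "0 \<le> (c i - \<alpha> * a i - (1 - \<alpha>) * b i) / (\<alpha> - 1)" if "i \<in> I" for i
      using tsallis_integrand_nonneg[OF \<alpha>(1) A.a_nonneg[OF that] B.a_nonneg[OF that]] by (simp add: t that zero_ereal_def)
    show "(\<Sum>i\<in>I. tsallis_fun \<alpha> (a i) (b i)) = ennreal (D / (\<alpha> - 1))" "0 \<le> D / (\<alpha> - 1)"
      unfolding D_def sum_divide_distrib using t t0
      by (auto simp: tsallis_fun_def e2ennreal_ereal sum_ennreal intro!: sum_nonneg)
  qed
  moreover have "(1 - exp D) / (1 - \<alpha>) = (exp D - 1) / (\<alpha> - 1)"
    using minus_divide_divide[of "exp D - 1" "\<alpha> - 1"] by simp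
  ultimately show ?thesis
    using \<alpha>(2) tsallis_of_renyi_ennreal[OF \<alpha>(2), of "D / (\<alpha> - 1)"]
    by (simp add: tsallis_fun_def u e2ennreal_ereal)
qed

text \<open>The log-likelihood ratio is affine in the counts, so its expectation under the first law
  needs only the means \<open>a i\<close>.\<close>

lemma nn_integral_regular_1:
  assumes ab: "\<And>i. i \<in> I \<Longrightarrow> b i = 0 \<Longrightarrow> a i = 0"
  shows "(\<integral>\<^sup>+x. tsallis_fun 1 (A.dens x) (B.dens x) \<partial>base) = (\<Sum>i\<in>I. tsallis_fun 1 (a i) (b i))"
proof -
  let ?N = "\<lambda>x i. real (nat_of_ennreal (x i))"
  define l where "l i = ln (a i / b i)" for i
  have pw: "A.dens x * ln (A.dens x / B.dens x) = (\<Sum>i\<in>I. (b i - a i) * A.dens x + l i * (A.dens x * ?N x i))" for x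
  proof (cases "A.dens x = 0")
    case False
    have nz: "poisson_weight (a i) (x i) \<noteq> 0" "poisson_weight (b i) (x i) \<noteq> 0" if "i \<in> I" for i
    proof -
      show "poisson_weight (a i) (x i) \<noteq> 0" using False that by (auto simp: A.dens_def)
      then show "poisson_weight (b i) (x i) \<noteq> 0" using ab[OF that] A.a_nonneg[OF that] B.a_nonneg[OF that] 
        by (auto simp: poisson_weight_0_iff)
    qed
    have "ln (A.dens x / B.dens x) = ln (\<Prod>i\<in>I. poisson_weight (a i) (x i) / poisson_weight (b i) (x i))"
      by (simp add: A.dens_def B.dens_def prod_dividef)
    also have "\<dots> = (\<Sum>i\<in>I. ln (poisson_weight (a i) (x i) / poisson_weight (b i) (x i)))"
      using nz by (intro ln_prod) (auto intro!: divide_pos_pos simp: less_le poisson_weight_nonneg A.a_nonneg B.a_nonneg)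
    also have "\<dots> = (\<Sum>i\<in>I. b i - a i + ?N x i * l i)"
      using nz ab by (intro sum.cong refl) (auto simp: l_def poisson_weight_ln_ratio A.a_nonneg B.a_nonneg)
    finally show ?thesis by (simp add: sum_distrib_left algebra_simps)
  qed simp
  define u where "u x = (\<Sum>i\<in>I. (b i - a i) * A.dens x + l i * (A.dens x * ?N x i)) + B.dens x - A.dens x" for x
  have u: "tsallis_integrand 1 (A.dens x) (B.dens x) = ereal (u x)" for x
    using ab dens_0_imp[of x] A.dens_nonneg[of x] B.dens_nonneg[of x]
    by (subst tsallis_integrand_1_real) (auto simp: u_def pw)
  have u0: "0 \<le> u x" for x
    using tsallis_integrand_nonneg[OF zero_less_one A.dens_nonneg B.dens_nonneg, of x x] by (simp add: u zero_ereal_def)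
  have "has_bochner_integral base u ((\<Sum>i\<in>I. (b i - a i) * 1 + l i * a i) + 1 - 1)"
    unfolding u_def
    by (intro has_bochner_integral_diff has_bochner_integral_add has_bochner_integral_sum
        has_bochner_integral_mult_right A.has_bochner_integral_dens B.has_bochner_integral_dens A.has_bochner_integral_dens_count)
  then have "(\<integral>\<^sup>+x. ennreal (u x) \<partial>base) = ennreal (\<Sum>i\<in>I. (b i - a i) + l i * a i)"
    by (subst nn_integral_eq_integral) (auto simp: has_bochner_integral_iff u0)
  also have "\<dots> = (\<Sum>i\<in>I. tsallis_fun 1 (a i) (b i))"
  proof -
    have t: "tsallis_integrand 1 (a i) (b i) = ereal ((b i - a i) + l i * a i)" if "i \<in> I" for i
      using ab that A.a_nonneg[of i] B.a_nonneg[of i]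
      by (subst tsallis_integrand_1_real) (auto simp: l_def)
    have t0: "0 \<le> (b i - a i) + l i * a i" if "i \<in> I" for i
      using tsallis_integrand_nonneg[OF zero_less_one A.a_nonneg[OF that] B.a_nonneg[OF that]] by (simp add: t that zero_ereal_def)
    show ?thesis using t t0 by (simp add: tsallis_fun_def e2ennreal_ereal sum_ennreal)
  qed
  finally show ?thesis by (simp add: tsallis_fun_def u e2ennreal_ereal)
qed

text \<open>Outside the regular cases \<alpha> \<ge> 1 and some component has b i = 0 < a i, which
  makes both sides infinite.\<close>

theorem partition_div_law:
  assumes "0 < \<alpha>"
  shows "partition_div \<alpha> (sets A.law) A.law B.law = tsallis_of_renyi \<alpha> (\<Sum>i\<in>I. tsallis_fun \<alpha> (a i) (b i))"
proof (cases "\<alpha> < 1 \<or> (\<forall>i\<in>I. b i = 0 \<longrightarrow> a i = 0)")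
  case True
  then show ?thesis
    using nn_integral_regular[OF assms] nn_integral_regular_1 assms
    by (cases "\<alpha> = 1") (auto simp: partition_div_eq_nn_integral tsallis_of_renyi_def)
next
  case False
  then obtain i where i: "i \<in> I" "a i \<noteq> 0" "b i = 0" "1 \<le> \<alpha>" by auto
  then have "tsallis_fun \<alpha> (a i) (b i) = \<top>"
    using A.a_nonneg[of i] by (simp add: tsallis_fun_def tsallis_integrand_0_right)
  then have top: "(\<Sum>i\<in>I. tsallis_fun \<alpha> (a i) (b i)) = \<top>"
    using i member_le_sum[of i I "\<lambda>i. tsallis_fun \<alpha> (a i) (b i)"] A.finite_I by (auto simp: top_unique)
  show ?thesis
    using i(4) unfolding partition_div_eq_nn_integral[OF assms] nn_integral_singular[OF i(4,1-3)] top
    by (simp add: tsallis_of_renyi_def)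
qed

end

section \<open>Existence of Poisson point processes\<close>

text \<open>A finite supremum of naturals is a maximum. This keeps countable sums of integer-valued
  measures integer-valued wherever they are finite.\<close>

lemma SUP_of_nat_ennreal:
  "(SUP n. of_nat (f n) :: ennreal) = \<top> \<or> (\<exists>k :: nat. (SUP n. of_nat (f n) :: ennreal) = of_nat k)"
proof (cases "(SUP n. of_nat (f n) :: ennreal) = \<top>")
  case False
  then have "(SUP n. of_nat (f n) :: ennreal) < \<top>" by (simp only: less_top)
  from ennreal_Ex_less_of_nat[OF this] obtain N where N: "(SUP n. of_nat (f n) :: ennreal) < of_nat N" ..
  have "f n < N" for n
    using le_less_trans[OF SUP_upper[of n UNIV "\<lambda>n. of_nat (f n) :: ennreal"] N] by simp
  then have fin: "finite (range f)" by (auto intro: finite_subset[of _ "{..<N}"])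
  have "(SUP n. of_nat (f n) :: ennreal) = of_nat (Max (range f))"
  proof (rule antisym)
    show "(SUP n. of_nat (f n) :: ennreal) \<le> of_nat (Max (range f))"
      using fin by (intro SUP_least) (auto intro: Max_ge)
    have "Max (range f) \<in> range f" using fin by (intro Max_in) auto
    then obtain m where "Max (range f) = f m" by auto
    then show "of_nat (Max (range f)) \<le> (SUP n. of_nat (f n) :: ennreal)"
      by (auto intro: SUP_upper)
  qed
  then show ?thesis by blast
qed simp

lemma point_patterns_cong: "sets M = sets N \<Longrightarrow> point_patterns M = point_patterns N"
  by (simp add: point_patterns_def)

lemma point_pattern_space_cong: "sets M = sets N \<Longrightarrow> point_pattern_space M = point_pattern_space N"
  by (simp add: point_pattern_space_def point_patterns_cong[of M N])

lemma sets_point_pattern: "\<eta> \<in> point_patterns S \<Longrightarrow> sets \<eta> = sets S"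
  by (simp add: point_patterns_def)

lemma space_point_pattern: "\<eta> \<in> point_patterns S \<Longrightarrow> space \<eta> = space S"
  by (intro sets_eq_imp_space_eq sets_point_pattern)

lemma point_pattern_nat_valued:
  assumes "\<eta> \<in> point_patterns S" "B \<in> sets S"
  shows "emeasure \<eta> B = \<top> \<or> (\<exists>k :: nat. emeasure \<eta> B = of_nat k)"
proof -
  from assms obtain \<xi> where \<xi>: "\<And>i. \<exists>k :: nat. emeasure (\<xi> i) B = of_nat k" 
    "emeasure \<eta> B = (\<Sum>i :: nat. emeasure (\<xi> i) B)"
    unfolding point_patterns_def by blast
  then obtain k :: "nat \<Rightarrow> nat" where k: "\<And>i. emeasure (\<xi> i) B = of_nat (k i)" by metis
  have "emeasure \<eta> B = (SUP n. of_nat (\<Sum>i<n. k i))"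
    by (simp add: \<xi>(2) suminf_eq_SUP k)
  then show ?thesis using SUP_of_nat_ennreal[of "\<lambda>n. \<Sum>i<n. k i"] by simp
qed

lemma point_pattern_nat:
  "\<eta> \<in> point_patterns S \<Longrightarrow> B \<in> sets S \<Longrightarrow> emeasure \<eta> B < \<infinity> \<Longrightarrow>
    emeasure \<eta> B = of_nat (nat_of_ennreal (emeasure \<eta> B))"
  using point_pattern_nat_valued[of \<eta> S B] by auto

lemma nat_valued_point_pattern:
  assumes "sets \<xi> = sets S" "finite_measure \<xi>" "\<And>B. B \<in> sets S \<Longrightarrow> \<exists>k :: nat. emeasure \<xi> B = of_nat k"
  shows "\<xi> \<in> point_patterns S"
proof -
  define \<zeta> where "\<zeta> i = (if i = (0 :: nat) then \<xi> else null_measure S)" for i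
  have "emeasure \<xi> B = (\<Sum>i. emeasure (\<zeta> i) B)" for B
  proof -
    have "(\<Sum>i. emeasure (\<zeta> i) B) = (\<Sum>i\<in>{0}. emeasure (\<zeta> i) B)"
      by (rule suminf_finite) (auto simp: \<zeta>_def)
    then show ?thesis by (simp add: \<zeta>_def)
  qed
  moreover have "finite_measure (null_measure S)" by (rule finite_measureI) simp
  moreover have "\<exists>k :: nat. emeasure (\<zeta> i) B = of_nat k" if "B \<in> sets S" for i B
    using assms(3)[OF that] by (auto simp: \<zeta>_def intro: exI[of _ "0 :: nat"])
  moreover have "sets (\<zeta> i) = sets S \<and> finite_measure (\<zeta> i)" for i
    using assms \<open>finite_measure (null_measure S)\<close> by (simp add: \<zeta>_def)
  ultimately show ?thesis
    using assms(1) unfolding point_patterns_def by blast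
qed

lemma null_measure_point_pattern: "sets S' = sets S \<Longrightarrow> null_measure S' \<in> point_patterns S"
  by (rule nat_valued_point_pattern) (auto intro!: finite_measureI exI[of _ "0 :: nat"])

lemma return_point_pattern: "x \<in> space S \<Longrightarrow> return S x \<in> point_patterns S"
  by (rule nat_valued_point_pattern)
    (auto intro!: prob_space.finite_measure prob_space_return split: split_indicator
      intro: exI[of _ "0 :: nat"] exI[of _ "1 :: nat"])

text \<open>The double sequence of finite summands is enumerated by
  \<open>prod_decode\<close>.\<close>

lemma countable_sum_point_pattern:
  assumes \<eta>: "\<And>i. \<eta> i \<in> point_patterns S"
  shows "countable_sum S \<eta> \<in> point_patterns S"
proof -
  have "\<forall>i. \<exists>\<xi>. (\<forall>j. sets (\<xi> j) = sets S \<and> finite_measure (\<xi> j) \<and>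
             (\<forall>B\<in>sets S. \<exists>k :: nat. emeasure (\<xi> j) B = of_nat k)) \<and>
        (\<forall>B\<in>sets S. emeasure (\<eta> i) B = (\<Sum>j :: nat. emeasure (\<xi> j) B))"
    using \<eta> by (auto simp: point_patterns_def)
  then obtain \<xi> where \<xi>: "\<And>i j :: nat. sets (\<xi> i j) = sets S \<and> finite_measure (\<xi> i j) \<and>
             (\<forall>B\<in>sets S. \<exists>k :: nat. emeasure (\<xi> i j) B = of_nat k)"
    "\<And>i B. B \<in> sets S \<Longrightarrow> emeasure (\<eta> i) B = (\<Sum>j. emeasure (\<xi> i j) B)"
    by metis
  define \<zeta> where "\<zeta> k = case_prod \<xi> (prod_decode k)" for k
  have "emeasure (countable_sum S \<eta>) B = (\<Sum>k. emeasure (\<zeta> k) B)" if B: "B \<in> sets S" for B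
  proof -
    have "(\<Sum>k. emeasure (\<zeta> k) B) = (\<Sum>i. emeasure (\<eta> i) B)"
      unfolding \<zeta>_def
      using suminf_ennreal_2dimen[of "\<lambda>i. emeasure (\<eta> i) B" "\<lambda>p. emeasure (case_prod \<xi> p) B"] \<xi>(2)[OF B] by simp
    then show ?thesis
      using \<eta> B by (subst emeasure_countable_sum) (auto simp: sets_point_pattern)
  qed
  moreover have "sets (\<zeta> k) = sets S \<and> finite_measure (\<zeta> k) \<and>
      (\<forall>B\<in>sets S. \<exists>j :: nat. emeasure (\<zeta> k) B = of_nat j)" for k
    using \<xi>(1) by (simp add: \<zeta>_def split: prod.split)
  ultimately show ?thesis
    unfolding point_patterns_def by (auto simp del: emeasure_countable_sum)
qed

lemma space_point_pattern_space [simp]: "space (point_pattern_space S) = point_patterns S"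
  unfolding point_pattern_space_def by (subst space_Sup_eq_UN) auto

lemma measurable_emeasure_point_pattern [measurable (raw)]:
  assumes "f \<in> measurable M (point_pattern_space S)" "B \<in> sets S"
  shows "(\<lambda>x. emeasure (f x) B) \<in> borel_measurable M"
proof (rule measurable_compose[OF assms(1)])
  show "(\<lambda>\<eta>. emeasure \<eta> B) \<in> borel_measurable (point_pattern_space S)"
    unfolding point_pattern_space_def
    by (rule measurable_Sup1[OF imageI[OF assms(2)]]) (auto intro!: measurable_vimage_algebra1)
qed

lemma measurable_sets_Collect_emeasure:
  assumes "B \<in> sets S" "E \<in> sets borel"
  shows "{\<eta>\<in>point_patterns S. emeasure \<eta> B \<in> E} \<in> sets (point_pattern_space S)"
proof -
  have "{\<eta>\<in>space (point_pattern_space S). emeasure \<eta> B \<in> E} \<in> sets (point_pattern_space S)"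
    using assms by measurable
  then show ?thesis by simp
qed

lemma measurable_point_pattern_spaceI:
  assumes "\<And>x. x \<in> space M \<Longrightarrow> f x \<in> point_patterns S"
    and "\<And>B. B \<in> sets S \<Longrightarrow> (\<lambda>x. emeasure (f x) B) \<in> borel_measurable M"
  shows "f \<in> measurable M (point_pattern_space S)"
  unfolding point_pattern_space_def
  using assms by (intro measurable_Sup2) (auto intro!: measurable_vimage_algebra2)

lemma sets_point_pattern_space:
  "sets (point_pattern_space S) = sigma_sets (point_patterns S)
    {{\<eta>\<in>point_patterns S. emeasure \<eta> B \<in> E} | B E. B \<in> sets S \<and> E \<in> sets borel}" (is "_ = sigma_sets _ ?G")
proof (rule antisym)
  let ?v = "\<lambda>B. vimage_algebra (point_patterns S) (\<lambda>\<eta>. emeasure \<eta> B) (borel :: ennreal measure)"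
  have "sets (point_pattern_space S) = sigma_sets (point_patterns S) (\<Union>B\<in>sets S. sets (?v B))"
    unfolding point_pattern_space_def by (subst sets_Sup_eq[where X = "point_patterns S"]) auto
  also have "\<dots> \<subseteq> sigma_sets (point_patterns S) ?G"
  proof (rule sigma_sets_mono, safe)
    fix A B assume "B \<in> sets S" "A \<in> sets (?v B)"
    then obtain E where "E \<in> sets borel" "A = (\<lambda>\<eta>. emeasure \<eta> B) -` E \<inter> point_patterns S"
      by (auto simp: sets_vimage_algebra2)
    then show "A \<in> sigma_sets (point_patterns S) ?G"
      using \<open>B \<in> sets S\<close> by (intro sigma_sets.Basic) auto
  qed
  finally show "sets (point_pattern_space S) \<subseteq> sigma_sets (point_patterns S) ?G" .
  show "sigma_sets (point_patterns S) ?G \<subseteq> sets (point_pattern_space S)"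
  proof (rule sets.sigma_sets_subset[where M = "point_pattern_space S", simplified], safe)
    fix B E assume [measurable]: "B \<in> sets S" "E \<in> sets (borel :: ennreal measure)"
    have "{\<eta> \<in> space (point_pattern_space S). emeasure \<eta> B \<in> E} \<in> sets (point_pattern_space S)"
      by measurable
    then show "{\<eta> \<in> point_patterns S. emeasure \<eta> B \<in> E} \<in> sets (point_pattern_space S)" by simp
  qed
qed

section \<open>Poisson processes of finite intensity\<close>

definition add_point :: "'a measure \<Rightarrow> 'a measure \<Rightarrow> 'a \<Rightarrow> 'a measure" where
  "add_point S \<eta> x = countable_sum S (\<lambda>i. if i = 0 then \<eta> else if i = 1 then return S x else null_measure S)"

lemma add_point_point_pattern:
  "\<eta> \<in> point_patterns S \<Longrightarrow> x \<in> space S \<Longrightarrow> add_point S \<eta> x \<in> point_patterns S"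
  unfolding add_point_def
  by (intro countable_sum_point_pattern) (auto simp: return_point_pattern null_measure_point_pattern)

lemma emeasure_add_point:
  assumes "\<eta> \<in> point_patterns S" "B \<in> sets S"
  shows "emeasure (add_point S \<eta> x) B = emeasure \<eta> B + indicator B x"
proof -
  let ?\<xi> = "\<lambda>i :: nat. if i = 0 then \<eta> else if i = 1 then return S x else null_measure S"
  have "emeasure (add_point S \<eta> x) B = (\<Sum>i. emeasure (?\<xi> i) B)"
    using assms unfolding add_point_def by (intro emeasure_countable_sum) (auto simp: sets_point_pattern)
  also have "\<dots> = (\<Sum>i\<in>{0, 1}. emeasure (?\<xi> i) B)"
    by (rule suminf_finite) auto
  finally show ?thesis using assms by simp
qed

lemma measurable_add_point:
  "case_prod (add_point S) \<in> measurable (point_pattern_space S \<Otimes>\<^sub>M S) (point_pattern_space S)"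
proof (rule measurable_point_pattern_spaceI)
  fix B assume [measurable]: "B \<in> sets S"
  have "(\<lambda>p. emeasure (fst p) B + indicator B (snd p)) \<in> borel_measurable (point_pattern_space S \<Otimes>\<^sub>M S)"
    by measurable
  then show "(\<lambda>x. emeasure (case x of (\<eta>, x) \<Rightarrow> add_point S \<eta> x) B) \<in> borel_measurable (point_pattern_space S \<Otimes>\<^sub>M S)"
    by (rule measurable_cong[THEN iffD1, rotated]) (auto simp: space_pair_measure emeasure_add_point)
qed (auto simp: space_pair_measure add_point_point_pattern)

text \<open>The unnormalised law of the pattern of n independent points. For finite \<Lambda> its
  mass is the n-th power of the mass of \<Lambda>, and nothing is divided by a mass that might be
  zero.\<close>

primrec points_measure :: "'a measure \<Rightarrow> nat \<Rightarrow> 'a measure measure" where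
  "points_measure \<Lambda> 0 = return (point_pattern_space \<Lambda>) (null_measure \<Lambda>)"
| "points_measure \<Lambda> (Suc n) =
    distr (points_measure \<Lambda> n \<Otimes>\<^sub>M \<Lambda>) (point_pattern_space \<Lambda>) (case_prod (add_point \<Lambda>))"

lemma sets_points_measure [simp, measurable_cong]: "sets (points_measure \<Lambda> n) = sets (point_pattern_space \<Lambda>)"
  by (cases n) auto

lemma space_points_measure [simp]: "space (points_measure \<Lambda> n) = point_patterns \<Lambda>"
  using sets_eq_imp_space_eq[OF sets_points_measure] by simp

text \<open>Times \<open>fact n\<close>, with n the sum of the counts, this is the multinomial
  probability without normalisation of M.\<close>

definition multinomial_weight :: "'a measure \<Rightarrow> 'i set \<Rightarrow> ('i \<Rightarrow> 'a set) \<Rightarrow> ('i \<Rightarrow> nat) \<Rightarrow> real" where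
  "multinomial_weight M I B k = (\<Prod>i\<in>I. measure M (B i) ^ k i / fact (k i))"

text \<open>A Poisson number of independent points: with c the mass of M, the factor
  \<open>exp (- c) / fact n\<close> turns the mass \<open>c ^ n\<close> of
  \<open>points_measure M n\<close> into the Poisson probability of n.\<close>

definition finite_poisson :: "'a measure \<Rightarrow> 'a measure measure" where
  "finite_poisson M = countable_sum (point_pattern_space M)
     (\<lambda>n. scale_measure (ennreal (exp (- measure M (space M)) / fact n)) (points_measure M n))"

context finite_measure
begin

lemma nn_integral_points_measure_Suc:
  assumes f [measurable]: "f \<in> borel_measurable (point_pattern_space M)" 
  shows "(\<integral>\<^sup>+\<eta>. f \<eta> \<partial>points_measure M (Suc n)) = (\<integral>\<^sup>+\<eta>. \<integral>\<^sup>+x. f (add_point M \<eta> x) \<partial>M \<partial>points_measure M n)"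
proof -
  have [measurable]: "case_prod (add_point M) \<in> measurable (points_measure M n \<Otimes>\<^sub>M M) (point_pattern_space M)"
    using measurable_add_point[of M] by (simp cong: measurable_cong_sets)
  show ?thesis
    by (simp add: nn_integral_distr nn_integral_fst[symmetric] split_beta')
qed

lemma finite_points_measure: "emeasure (points_measure M n) (point_patterns M) = emeasure M (space M) ^ n"
proof (induction n)
  case 0
  show ?case 
    using null_measure_point_pattern[OF refl, of M] sets.top[of "point_pattern_space M"] by simp
next
  case (Suc n)
  have "emeasure (points_measure M (Suc n)) (point_patterns M) = (\<integral>\<^sup>+\<eta>. 1 \<partial>points_measure M (Suc n))"
    by simp
  also have "\<dots> = (\<integral>\<^sup>+\<eta>. \<integral>\<^sup>+x. 1 \<partial>M \<partial>points_measure M n)"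
    by (subst nn_integral_points_measure_Suc) auto
  finally show ?case using Suc by (simp add: mult.commute)
qed

text \<open>The effect of deleting one point from cell j; it drives the induction on the number of
  points.\<close>

lemma multinomial_weight_remove:
  assumes "finite I" "j \<in> I" "0 < k j"
  shows "measure M (B j) * multinomial_weight M I B (k(j := k j - 1)) = real (k j) * multinomial_weight M I B k"
proof -
  obtain m where m: "k j = Suc m" using assms by (cases "k j") auto
  have "(\<Prod>i\<in>I - {j}. measure M (B i) ^ (k(j := m)) i / fact ((k(j := m)) i)) = (\<Prod>i\<in>I - {j}. measure M (B i) ^ k i / fact (k i))"
    by (intro prod.cong) auto
  moreover have "x * (x ^ m / fact m * R) = real (Suc m) * (x ^ Suc m / fact (Suc m) * R)" for x R :: real
    by (simp add: divide_simps del: of_nat_Suc)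
  ultimately show ?thesis
    using assms unfolding multinomial_weight_def by (simp only: prod.remove[of I j] m fun_upd_same diff_Suc_1)
qed

text \<open>Induction on the number of points: the last point lies in exactly one cell j, and the
  others must realise the counts with \<open>k j\<close> lowered by one.\<close>

lemma emeasure_points_measure:
  assumes I: "finite I" and B: "\<And>i. i \<in> I \<Longrightarrow> B i \<in> sets M" "disjoint_family_on B I" "(\<Union>i\<in>I. B i) = space M"
  shows "emeasure (points_measure M n) {\<eta>\<in>point_patterns M. \<forall>i\<in>I. emeasure \<eta> (B i) = of_nat (k i)}
    = (if sum k I = n then ennreal (fact n * multinomial_weight M I B k) else 0)"
proof (induction n arbitrary: k)
  case 0
  have "{\<eta>\<in>space (point_pattern_space M). \<forall>i\<in>I. emeasure \<eta> (B i) = of_nat (k i)} \<in> sets (point_pattern_space M)"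
    using I B(1) by measurable
  then have "emeasure (points_measure M 0) {\<eta>\<in>point_patterns M. \<forall>i\<in>I. emeasure \<eta> (B i) = of_nat (k i)} =
      indicator {\<eta>\<in>point_patterns M. \<forall>i\<in>I. emeasure \<eta> (B i) = of_nat (k i)} (null_measure M)"
    by simp
  also have "\<dots> = (if \<forall>i\<in>I. k i = 0 then 1 else 0)"
    using null_measure_point_pattern[OF refl, of M] by (auto simp: indicator_def)
  finally show ?case using I by (auto simp: multinomial_weight_def)
next
  case (Suc n)
  define E where "E k = {\<eta>\<in>point_patterns M. \<forall>i\<in>I. emeasure \<eta> (B i) = of_nat (k i)}" for k :: "_ \<Rightarrow> nat"
  have E [measurable]: "E k \<in> sets (point_pattern_space M)" for k
  proof -
    have "{\<eta>\<in>space (point_pattern_space M). \<forall>i\<in>I. emeasure \<eta> (B i) = of_nat (k i)} \<in> sets (point_pattern_space M)"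
      using I B(1) by measurable
    then show ?thesis by (simp add: E_def)
  qed
  have pt: "indicator (E k) (add_point M \<eta> x) =
      (\<Sum>j\<in>I. (if 0 < k j then indicator (E (k(j := k j - 1))) \<eta> * indicator (B j) x else 0) :: ennreal)"
    if \<eta>: "\<eta> \<in> point_patterns M" and x: "x \<in> space M" for \<eta> x
  proof -
    obtain j where j: "j \<in> I" "x \<in> B j" using x B(3) by auto
    have nj: "x \<notin> B i" if "i \<in> I" "i \<noteq> j" for i
      using B(2) j that by (auto simp: disjoint_family_on_def)
    have "(\<Sum>j\<in>I. (if 0 < k j then indicator (E (k(j := k j - 1))) \<eta> * indicator (B j) x else 0) :: ennreal)
        = (if 0 < k j then indicator (E (k(j := k j - 1))) \<eta> else 0)"
      using I j nj by (subst sum.remove[of I j]) (auto intro!: sum.neutral)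
    moreover have "add_point M \<eta> x \<in> E k \<longleftrightarrow> 0 < k j \<and> \<eta> \<in> E (k(j := k j - 1))"
    proof -
      have em: "emeasure (add_point M \<eta> x) (B i) = emeasure \<eta> (B i) + (if i = j then 1 else 0)" if "i \<in> I" for i
        using that j nj B(1) \<eta> by (auto simp: emeasure_add_point)
      have *: "emeasure \<eta> (B j) + 1 = of_nat (k j) \<longleftrightarrow> 0 < k j \<and> emeasure \<eta> (B j) = of_nat (k j - 1)"
      proof (cases "k j")
        case (Suc m)
        then show ?thesis using ennreal_add_left_cancel[of 1 "emeasure \<eta> (B j)" "of_nat m"] by (auto simp: add.commute)
      qed simp
      have "(\<forall>i\<in>I. emeasure (add_point M \<eta> x) (B i) = of_nat (k i)) \<longleftrightarrow>
        (0 < k j \<and> (\<forall>i\<in>I. emeasure \<eta> (B i) = of_nat ((k(j := k j - 1)) i)))"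
        using j(1) em * by fastforce
      then show ?thesis using \<eta> x by (auto simp: E_def add_point_point_pattern)
    qed
    ultimately show ?thesis by (auto simp: indicator_def)
  qed
  have "emeasure (points_measure M (Suc n)) (E k) = (\<integral>\<^sup>+\<eta>. \<integral>\<^sup>+x. indicator (E k) (add_point M \<eta> x) \<partial>M \<partial>points_measure M n)"
    by (subst nn_integral_points_measure_Suc[symmetric]) (auto simp: nn_integral_indicator simp del: points_measure.simps)
  also have "\<dots> = (\<integral>\<^sup>+\<eta>. \<integral>\<^sup>+x. (\<Sum>j\<in>I. (if 0 < k j then indicator (E (k(j := k j - 1))) \<eta> * indicator (B j) x else 0)) \<partial>M \<partial>points_measure M n)"
    using pt by (intro nn_integral_cong) auto
  also have "\<dots> = (\<integral>\<^sup>+\<eta>. (\<Sum>j\<in>I. (if 0 < k j then indicator (E (k(j := k j - 1))) \<eta> * emeasure M (B j) else 0)) \<partial>points_measure M n)"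
    using B(1) by (intro nn_integral_cong) (auto simp: nn_integral_sum nn_integral_cmult intro!: sum.cong)
  also have "\<dots> = (\<Sum>j\<in>I. (if 0 < k j then emeasure (points_measure M n) (E (k(j := k j - 1))) * emeasure M (B j) else 0))"
    by (subst nn_integral_sum) (auto simp: nn_integral_multc intro!: sum.cong)
  also have "\<dots> = (\<Sum>j\<in>I. if sum k I = Suc n then ennreal (fact n * (real (k j) * multinomial_weight M I B k)) else 0)"
  proof (intro sum.cong refl)
    fix j assume j: "j \<in> I"
    show "(if 0 < k j then emeasure (points_measure M n) (E (k(j := k j - 1))) * emeasure M (B j) else 0)
      = (if sum k I = Suc n then ennreal (fact n * (real (k j) * multinomial_weight M I B k)) else 0)"
    proof (cases "0 < k j")
      case True
      have "sum (k(j := k j - 1)) I = (k j - 1) + sum k (I - {j})"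
        using I j by (subst sum.remove[of I j]) (auto intro!: sum.cong)
      moreover have "sum k I = k j + sum k (I - {j})" using I j by (simp add: sum.remove)
      ultimately have eq: "sum (k(j := k j - 1)) I = n \<longleftrightarrow> sum k I = Suc n" using True by auto
      have "ennreal (fact n * multinomial_weight M I B (k(j := k j - 1))) * emeasure M (B j)
          = ennreal (fact n * (measure M (B j) * multinomial_weight M I B (k(j := k j - 1))))"
        by (simp add: emeasure_eq_measure ennreal_mult[symmetric] multinomial_weight_def prod_nonneg mult_ac)
      then show ?thesis
        using True Suc.IH[of "k(j := k j - 1)"] eq multinomial_weight_remove[of I j k B, OF I j True]
        by (simp add: E_def)
    qed simp
  qed
  \<comment> \<open>The factors \<open>k j\<close> add up to \<open>Suc n\<close>, which raises
    \<open>fact n\<close> to \<open>fact (Suc n)\<close>.\<close>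
  also have "\<dots> = (if sum k I = Suc n then ennreal (fact (Suc n) * multinomial_weight M I B k) else 0)"
  proof -
    have "(\<Sum>j\<in>I. fact n * (real (k j) * multinomial_weight M I B k)) = fact n * real (sum k I) * multinomial_weight M I B k"
      by (simp add: sum_distrib_left sum_distrib_right mult_ac)
    moreover have "0 \<le> multinomial_weight M I B k"
      by (simp add: multinomial_weight_def prod_nonneg)
    ultimately show ?thesis
      by (auto simp: sum_ennreal mult_ac of_nat_sum[symmetric] simp del: of_nat_Suc of_nat_sum)
  qed
  finally show ?case by (simp only: E_def)
qed

lemma sets_finite_poisson [simp, measurable_cong]: "sets (finite_poisson M) = sets (point_pattern_space M)"
  by (simp add: finite_poisson_def)

lemma space_finite_poisson [simp]: "space (finite_poisson M) = point_patterns M"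
  by (simp add: finite_poisson_def)

lemma emeasure_finite_poisson:
  "A \<in> sets (point_pattern_space M) \<Longrightarrow> emeasure (finite_poisson M) A =
    (\<Sum>n. ennreal (exp (- measure M (space M)) / fact n) * emeasure (points_measure M n) A)"
  unfolding finite_poisson_def by (subst emeasure_countable_sum) auto

lemma prob_space_finite_poisson: "prob_space (finite_poisson M)"
proof
  let ?c = "measure M (space M)"
  have "emeasure (finite_poisson M) (point_patterns M) = (\<Sum>n. ennreal (exp (- ?c) / fact n) * emeasure M (space M) ^ n)"
    using sets.top[of "point_pattern_space M"] by (subst emeasure_finite_poisson) (auto simp: finite_points_measure)
  also have "\<dots> = (\<Sum>n. ennreal (?c ^ n / fact n * exp (- ?c)))"
    by (simp add: emeasure_eq_measure ennreal_power ennreal_mult[symmetric] mult.commute)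
  also have "\<dots> = 1"
    using poisson_sums_1[of ?c] by (subst suminf_ennreal_eq) auto
  finally show "emeasure (finite_poisson M) (space (finite_poisson M)) = 1" by simp
qed

text \<open>Only n = \<open>sum k I\<close> contributes. Since the cells partition the space, the
  exponential of the total mass factors over them, and this is what makes the counts
  independent.\<close>

lemma emeasure_finite_poisson_nat:
  assumes I: "finite I" and B: "\<And>i. i \<in> I \<Longrightarrow> B i \<in> sets M" "disjoint_family_on B I" "(\<Union>i\<in>I. B i) = space M"
  shows "emeasure (finite_poisson M) {\<eta>\<in>point_patterns M. \<forall>i\<in>I. emeasure \<eta> (B i) = of_nat (k i)}
    = (\<Prod>i\<in>I. emeasure (poisson_distr (emeasure M (B i))) {of_nat (k i)})" (is "emeasure _ ?A = _")
proof -
  let ?c = "measure M (space M)"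
  have c: "?c = (\<Sum>i\<in>I. measure M (B i))"
    using finite_measure_finite_Union[OF I _ B(2)] B(1,3) by auto
  have "{\<eta>\<in>space (point_pattern_space M). \<forall>i\<in>I. emeasure \<eta> (B i) = of_nat (k i)} \<in> sets (point_pattern_space M)"
    using I B(1) by measurable
  then have "emeasure (finite_poisson M) ?A = (\<Sum>n. ennreal (exp (- ?c) / fact n) * emeasure (points_measure M n) ?A)"
    by (simp add: emeasure_finite_poisson)
  also have "\<dots> = (\<Sum>n\<in>{sum k I}. ennreal (exp (- ?c) / fact n) * emeasure (points_measure M n) ?A)"
    by (rule suminf_finite) (auto simp: emeasure_points_measure[OF I B])
  also have "\<dots> = ennreal (exp (- ?c) * multinomial_weight M I B k)"
    by (simp add: emeasure_points_measure[OF I B] ennreal_mult''[symmetric] multinomial_weight_def prod_nonneg)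
  also have "exp (- ?c) * multinomial_weight M I B k = (\<Prod>i\<in>I. measure M (B i) ^ k i / fact (k i) * exp (- measure M (B i)))"
    by (simp add: c multinomial_weight_def prod.distrib exp_sum[OF I, symmetric] sum_negf prod_dividef)
  also have "ennreal \<dots> = (\<Prod>i\<in>I. emeasure (poisson_distr (emeasure M (B i))) {of_nat (k i)})"
    by (subst prod_ennreal[symmetric]) (auto simp: emeasure_eq_measure emeasure_poisson_distr_nat)
  finally show ?thesis .
qed

end

text \<open>The prescribed point masses add up to 1, so the law is carried by the naturals and
  determined there.\<close>

lemma poisson_distr_eqI:
  assumes \<mu>: "prob_space \<mu>" "sets \<mu> = sets borel" and "0 \<le> r"
    and pt: "\<And>k. emeasure \<mu> {of_nat k} = ennreal (r ^ k / fact k * exp (- r))"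
  shows "\<mu> = poisson_distr (ennreal r)"
proof -
  interpret prob_space \<mu> by fact
  have [measurable]: "{of_nat k} \<in> sets \<mu>" for k by (simp add: \<mu>)
  have em: "emeasure \<mu> A = (\<Sum>k. ennreal (r ^ k / fact k * exp (- r)) * indicator A (of_nat k))"
    if A: "A \<subseteq> range of_nat" for A
  proof -
    have "A = (\<Union>k\<in>{k. of_nat k \<in> A}. {of_nat k})" using A by auto
    then have "emeasure \<mu> A = emeasure \<mu> (\<Union>k\<in>{k. of_nat k \<in> A}. {of_nat k})" by simp
    also have "\<dots> = (\<integral>\<^sup>+k. emeasure \<mu> {of_nat k} \<partial>count_space {k. of_nat k \<in> A})"
      by (intro emeasure_UN_countable) (auto simp: disjoint_family_on_def \<mu>)
    also have "\<dots> = (\<integral>\<^sup>+k. emeasure \<mu> {of_nat k} * indicator {k. of_nat k \<in> A} k \<partial>count_space UNIV)"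
      by (simp add: nn_integral_count_space_indicator)
    also have "\<dots> = (\<Sum>k. emeasure \<mu> {of_nat k} * indicator A (of_nat k))"
      by (subst nn_integral_count_space_nat) (auto intro!: suminf_cong split: split_indicator)
    finally show ?thesis by (simp add: pt)
  qed
  have "emeasure \<mu> (range of_nat) = (\<Sum>k. ennreal (r ^ k / fact k * exp (- r)))"
    by (subst em) auto
  also have "\<dots> = 1"
    using poisson_sums_1[of r] \<open>0 \<le> r\<close> by (subst suminf_ennreal_eq) auto
  finally have "AE x in \<mu>. x \<in> range (of_nat :: nat \<Rightarrow> ennreal)"
    by (intro AE_prob_1) (simp add: emeasure_eq_measure)
  then have AE: "AE x in \<mu>. x \<in> range (of_nat :: nat \<Rightarrow> ennreal)" .
  have range: "range (of_nat :: nat \<Rightarrow> ennreal) \<in> sets borel"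
    by (rule sets.countable) auto
  show ?thesis
  proof (rule measure_eqI)
    fix A assume "A \<in> sets \<mu>"
    then have A [measurable]: "A \<in> sets borel" by (simp add: \<mu>)
    have "emeasure \<mu> A = emeasure \<mu> (A \<inter> range of_nat)"
      using AE range A by (intro emeasure_eq_AE) (auto simp: \<mu>)
    also have "\<dots> = (\<Sum>k. ennreal (r ^ k / fact k * exp (- r)) * indicator A (of_nat k))"
      by (subst em) (auto intro!: suminf_cong split: split_indicator)
    also have "\<dots> = emeasure (poisson_distr (ennreal r)) A"
      using nn_integral_poisson_distr[OF \<open>0 \<le> r\<close>, of "indicator A"] by simp
    finally show "emeasure \<mu> A = emeasure (poisson_distr (ennreal r)) A" .
  qed (simp add: \<mu>)
qed

text \<open>Independence and marginal laws in a single product formula, in which a set with the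
  event \<open>UNIV\<close> can be added or dropped freely.\<close>

definition poisson_joint :: "'a measure \<Rightarrow> 'a measure measure \<Rightarrow> bool" where
  "poisson_joint \<Lambda> P \<longleftrightarrow> (\<forall>(n :: nat) B E. (\<forall>i<n. B i \<in> sets \<Lambda>) \<longrightarrow> disjoint_family_on B {..<n} \<longrightarrow>
     (\<forall>i<n. E i \<in> sets borel) \<longrightarrow>
     emeasure P {\<eta>\<in>point_patterns \<Lambda>. \<forall>i<n. emeasure \<eta> (B i) \<in> E i}
       = (\<Prod>i<n. emeasure (poisson_distr (emeasure \<Lambda> (B i))) (E i)))"

lemma poisson_jointD:
  fixes n :: nat
  assumes "poisson_joint \<Lambda> P" "\<And>i. i < n \<Longrightarrow> B i \<in> sets \<Lambda>" "disjoint_family_on B {..<n}"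
    "\<And>i. i < n \<Longrightarrow> E i \<in> sets borel"
  shows "emeasure P {\<eta>\<in>point_patterns \<Lambda>. \<forall>i<n. emeasure \<eta> (B i) \<in> E i}
       = (\<Prod>i<n. emeasure (poisson_distr (emeasure \<Lambda> (B i))) (E i))"
  using assms unfolding poisson_joint_def by blast

lemma poisson_joint_single:
  assumes "poisson_joint \<Lambda> P" "B \<in> sets \<Lambda>" "E \<in> sets borel"
  shows "emeasure P {\<eta>\<in>point_patterns \<Lambda>. emeasure \<eta> B \<in> E} = emeasure (poisson_distr (emeasure \<Lambda> B)) E"
  using poisson_jointD[OF assms(1), of 1 "\<lambda>_. B" "\<lambda>_. E"] assms(2,3)
  by (simp add: disjoint_family_on_def)

lemma is_poisson_pp_distrI:
  assumes P: "prob_space P" "sets P = sets (point_pattern_space \<Lambda>)" and joint: "poisson_joint \<Lambda> P"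
  shows "is_poisson_pp_distr \<Lambda> P"
proof -
  interpret prob_space P by fact
  note P(2) [measurable_cong]
  have sp: "space P = point_patterns \<Lambda>" using sets_eq_imp_space_eq[OF P(2)] by simp
  have rv [measurable]: "(\<lambda>\<eta>. emeasure \<eta> B) \<in> borel_measurable P" if "B \<in> sets \<Lambda>" for B
    using that by measurable
  have marg: "distr P borel (\<lambda>\<eta>. emeasure \<eta> B) = poisson_distr (emeasure \<Lambda> B)" if B [measurable]: "B \<in> sets \<Lambda>" for B
  proof (rule measure_eqI)
    fix E assume "E \<in> sets (distr P borel (\<lambda>\<eta>. emeasure \<eta> B))"
    then have E: "E \<in> sets borel" by simp
    then have "emeasure (distr P borel (\<lambda>\<eta>. emeasure \<eta> B)) E = emeasure P {\<eta>\<in>point_patterns \<Lambda>. emeasure \<eta> B \<in> E}"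
      by (subst emeasure_distr) (auto simp: sp intro!: arg_cong[where f="emeasure P"])
    then show "emeasure (distr P borel (\<lambda>\<eta>. emeasure \<eta> B)) E = emeasure (poisson_distr (emeasure \<Lambda> B)) E"
      using poisson_joint_single[OF joint B E] by simp
  qed simp
  have "indep_vars (\<lambda>_. borel) (\<lambda>i \<eta>. emeasure \<eta> (B i)) {..<n}"
    if B: "\<forall>i<n. B i \<in> sets \<Lambda>" "disjoint_family_on B {..<n}" for n :: nat and B
  proof (cases "n = 0")
    case True
    then show ?thesis by (simp add: indep_vars_def2 indep_sets_def)
  next
    case False
    show ?thesis
    proof (subst indep_vars_finite[where E = "\<lambda>_. sets borel"])
      show "\<forall>A\<in>{..<n} \<rightarrow> sets borel. prob (\<Inter>j\<in>{..<n}. (\<lambda>\<eta>. emeasure \<eta> (B j)) -` A j \<inter> space P)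
          = (\<Prod>j<n. prob ((\<lambda>\<eta>. emeasure \<eta> (B j)) -` A j \<inter> space P))"
      proof
        fix A assume "A \<in> {..<n} \<rightarrow> sets (borel :: ennreal measure)"
        then have A: "A i \<in> sets borel" if "i < n" for i using that by auto
        have "(\<Inter>j\<in>{..<n}. (\<lambda>\<eta>. emeasure \<eta> (B j)) -` A j \<inter> space P) = {\<eta>\<in>point_patterns \<Lambda>. \<forall>i<n. emeasure \<eta> (B i) \<in> A i}"
          using False by (auto simp: sp)
        then have "emeasure P (\<Inter>j\<in>{..<n}. (\<lambda>\<eta>. emeasure \<eta> (B j)) -` A j \<inter> space P)
            = (\<Prod>i<n. emeasure (poisson_distr (emeasure \<Lambda> (B i))) (A i))"
          using poisson_jointD[OF joint, of n B A] B A by simp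
        also have "\<dots> = (\<Prod>j<n. emeasure P ((\<lambda>\<eta>. emeasure \<eta> (B j)) -` A j \<inter> space P))"
        proof (intro prod.cong refl)
          fix j assume "j \<in> {..<n}"
          then show "emeasure (poisson_distr (emeasure \<Lambda> (B j))) (A j) = emeasure P ((\<lambda>\<eta>. emeasure \<eta> (B j)) -` A j \<inter> space P)"
            using B(1) A by (subst marg[symmetric]) (auto intro!: emeasure_distr)
        qed
        finally show "prob (\<Inter>j\<in>{..<n}. (\<lambda>\<eta>. emeasure \<eta> (B j)) -` A j \<inter> space P)
          = (\<Prod>j<n. prob ((\<lambda>\<eta>. emeasure \<eta> (B j)) -` A j \<inter> space P))"
          by (simp add: emeasure_eq_measure prod_ennreal prod_nonneg)
      qed
    qed (use False B rv in \<open>auto simp: sets.sigma_sets_eq[of borel, simplified] intro!: sets.Int_stable\<close>)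
  qed
  then show ?thesis using assms marg unfolding is_poisson_pp_distr_def by auto
qed

lemma (in finite_measure) AE_finite_poisson: "AE \<eta> in (finite_poisson M). emeasure \<eta> (space M) < \<infinity>"
proof -
  interpret FP: prob_space "finite_poisson M" by (rule prob_space_finite_poisson)
  have rv [measurable]: "(\<lambda>\<eta>. emeasure \<eta> (space M)) \<in> borel_measurable (finite_poisson M)" by measurable
  have "distr (finite_poisson M) borel (\<lambda>\<eta>. emeasure \<eta> (space M)) = poisson_distr (ennreal (measure M (space M)))"
  proof (rule poisson_distr_eqI)
    show "prob_space (distr (finite_poisson M) borel (\<lambda>\<eta>. emeasure \<eta> (space M)))"
      by (rule FP.prob_space_distr[OF rv])
    show "emeasure (distr (finite_poisson M) borel (\<lambda>\<eta>. emeasure \<eta> (space M))) {of_nat k}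
        = ennreal (measure M (space M) ^ k / fact k * exp (- measure M (space M)))" for k
    proof -
      have "emeasure (distr (finite_poisson M) borel (\<lambda>\<eta>. emeasure \<eta> (space M))) {of_nat k}
          = emeasure (finite_poisson M) {\<eta>\<in>point_patterns M. \<forall>i\<in>{()}. emeasure \<eta> (space M) = of_nat k}"
        by (subst emeasure_distr) (auto intro!: arg_cong[where f="emeasure (finite_poisson M)"])
      also have "\<dots> = (\<Prod>i\<in>{()}. emeasure (poisson_distr (emeasure M (space M))) {of_nat k})"
        by (rule emeasure_finite_poisson_nat) (auto simp: disjoint_family_on_def)
      finally show ?thesis by (simp add: emeasure_eq_measure emeasure_poisson_distr_nat)
    qed
  qed auto
  note eq = this
  have "AE x in poisson_distr (ennreal (measure M (space M))). x < \<infinity>"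
    using AE_poisson_distr_nat[of "ennreal (measure M (space M))"]
    by (auto elim!: eventually_mono) (metis of_nat_less_top)
  then have "AE x in distr (finite_poisson M) borel (\<lambda>\<eta>. emeasure \<eta> (space M)). x < \<infinity>"
    by (simp only: eq)
  from AE_distrD[OF rv this] show ?thesis .
qed

text \<open>The counts are almost surely natural numbers, so their joint law is that of the rounded
  counts. These live on a countable space, where the formula for singletons decides.\<close>

lemma (in finite_measure) poisson_joint_finite_poisson_cover:
  assumes I: "finite I" and B: "\<And>i. i \<in> I \<Longrightarrow> B i \<in> sets M" "disjoint_family_on B I" "(\<Union>i\<in>I. B i) = space M"
    and E: "\<And>i. i \<in> I \<Longrightarrow> E i \<in> sets borel"
  shows "emeasure (finite_poisson M) {\<eta>\<in>point_patterns M. \<forall>i\<in>I. emeasure \<eta> (B i) \<in> E i}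
    = (\<Prod>i\<in>I. emeasure (poisson_distr (emeasure M (B i))) (E i))"
proof -
  interpret FP: prob_space "finite_poisson M" by (rule prob_space_finite_poisson)
  note [measurable] = B(1) E
  let ?c = "count_space (UNIV :: nat set)"
  \<comment> \<open>The product of the laws of rounded Poisson variables; the law of the rounded
    counts N is compared with it at every single vector.\<close>
  define U where "U = PiM I (\<lambda>i. distr (poisson_distr (emeasure M (B i))) ?c nat_of_ennreal)"
  define N where "N \<eta> = (\<lambda>i\<in>I. nat_of_ennreal (emeasure \<eta> (B i)))" for \<eta> :: "'a measure"
  have [measurable]: "N \<in> measurable (finite_poisson M) (PiM I (\<lambda>_. ?c))"
    unfolding N_def by measurable
  interpret pp: product_prob_space "\<lambda>i. distr (poisson_distr (emeasure M (B i))) ?c nat_of_ennreal" I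
    by (intro product_prob_spaceI prob_space.prob_space_distr prob_space_poisson_distr) 
      (simp add: measurable_cong_sets[OF sets_poisson_distr refl])
  have nat: "AE x in poisson_distr (emeasure M (B i)). x = of_nat (nat_of_ennreal x)" for i
    by (rule AE_poisson_distr_nat) simp
  have AE: "AE \<eta> in (finite_poisson M). \<forall>i\<in>I. emeasure \<eta> (B i) = of_nat (nat_of_ennreal (emeasure \<eta> (B i)))"
    using AE_finite_poisson AE_space
  proof eventually_elim
    case (elim \<eta>)
    show ?case
    proof
      fix i assume i: "i \<in> I"
      have "emeasure \<eta> (B i) \<le> emeasure \<eta> (space M)"
        using elim i B(1)[OF i] sets.sets_into_space[of "B i" M] by (intro emeasure_mono) (auto simp: sets_point_pattern)
      then show "emeasure \<eta> (B i) = of_nat (nat_of_ennreal (emeasure \<eta> (B i)))"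
        using elim i B(1) by (intro point_pattern_nat) auto
    qed
  qed
  have VU: "distr (finite_poisson M) (PiM I (\<lambda>_. ?c)) N = U"
  proof (rule measure_eqI_countable'[where A = "PiE I (\<lambda>_. UNIV)"])
    show "space (distr (finite_poisson M) (PiM I (\<lambda>_. ?c)) N) = PiE I (\<lambda>_. UNIV)" "space U = PiE I (\<lambda>_. UNIV)"
      by (auto simp: U_def space_PiM)
    show "countable (PiE I (\<lambda>_. UNIV :: nat set))" using I by (intro countable_PiE) auto
    fix k assume k: "k \<in> PiE I (\<lambda>_. UNIV :: nat set)"
    have sing: "{k} = PiE I (\<lambda>i. {k i})" using k by (intro PiE_singleton[symmetric]) (auto simp: PiE_def)
    show "{k} \<in> sets (distr (finite_poisson M) (PiM I (\<lambda>_. ?c)) N)" "{k} \<in> sets U"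
      unfolding U_def sets_distr sing using I by (intro sets_PiM_I_finite; simp)+
    have [measurable]: "{k} \<in> sets (PiM I (\<lambda>_. ?c))"
      unfolding sing using I by (intro sets_PiM_I_finite) auto
    have "emeasure (distr (finite_poisson M) (PiM I (\<lambda>_. ?c)) N) {k} = emeasure (finite_poisson M) (N -` {k} \<inter> space (finite_poisson M))"
      by (subst emeasure_distr) auto
    also have "\<dots> = emeasure (finite_poisson M) {\<eta>\<in>point_patterns M. \<forall>i\<in>I. emeasure \<eta> (B i) = of_nat (k i)}"
    proof (rule emeasure_eq_AE)
      show "AE \<eta> in (finite_poisson M). (\<eta> \<in> N -` {k} \<inter> space (finite_poisson M)) = (\<eta> \<in> {\<eta>\<in>point_patterns M. \<forall>i\<in>I. emeasure \<eta> (B i) = of_nat (k i)})"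
        using AE AE_space
      proof eventually_elim
        case (elim \<eta>)
        have "N \<eta> = k \<longleftrightarrow> (\<forall>i\<in>I. nat_of_ennreal (emeasure \<eta> (B i)) = k i)"
          using k by (auto simp: N_def PiE_def extensional_def fun_eq_iff)
        also have "\<dots> \<longleftrightarrow> (\<forall>i\<in>I. emeasure \<eta> (B i) = of_nat (k i))"
          using elim by (metis nat_of_ennreal_of_nat)
        finally show ?case using elim by simp
      qed
      have "{\<eta>\<in>space (finite_poisson M). \<forall>i\<in>I. emeasure \<eta> (B i) = of_nat (k i)} \<in> sets (finite_poisson M)"
        using I by measurable
      then show "{\<eta>\<in>point_patterns M. \<forall>i\<in>I. emeasure \<eta> (B i) = of_nat (k i)} \<in> sets (finite_poisson M)" by simp
    qed measurable
    also have "\<dots> = (\<Prod>i\<in>I. emeasure (poisson_distr (emeasure M (B i))) {of_nat (k i)})"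
      by (rule emeasure_finite_poisson_nat[OF I B])
    also have "\<dots> = (\<Prod>i\<in>I. emeasure (distr (poisson_distr (emeasure M (B i))) ?c nat_of_ennreal) {k i})"
    proof (intro prod.cong refl)
      fix i assume "i \<in> I"
      have "emeasure (poisson_distr (emeasure M (B i))) {of_nat (k i)} = emeasure (poisson_distr (emeasure M (B i))) (nat_of_ennreal -` {k i})"
      proof (rule emeasure_eq_AE)
        show "AE x in poisson_distr (emeasure M (B i)). (x \<in> {of_nat (k i)}) = (x \<in> nat_of_ennreal -` {k i})"
          using nat[of i] by eventually_elim (metis nat_of_ennreal_of_nat singleton_iff vimage_singleton_eq)
        show "nat_of_ennreal -` {k i} \<in> sets (poisson_distr (emeasure M (B i)))"
          using measurable_sets[OF measurable_nat_of_ennreal, of "{k i}"] by simp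
      qed simp
      also have "\<dots> = emeasure (distr (poisson_distr (emeasure M (B i))) ?c nat_of_ennreal) {k i}"
        by (subst emeasure_distr) (auto simp: measurable_cong_sets[OF sets_poisson_distr refl])
      finally show "emeasure (poisson_distr (emeasure M (B i))) {of_nat (k i)} = \<dots>" .
    qed
    also have "\<dots> = emeasure U {k}"
      unfolding U_def sing using I by (subst pp.emeasure_PiM) auto
    finally show "emeasure (distr (finite_poisson M) (PiM I (\<lambda>_. ?c)) N) {k} = emeasure U {k}" .
  qed
  let ?F = "\<lambda>i. {k. of_nat k \<in> E i}"
  have "{\<eta>\<in>space (finite_poisson M). \<forall>i\<in>I. emeasure \<eta> (B i) \<in> E i} \<in> sets (finite_poisson M)"
    using I by measurable
  then have "emeasure (finite_poisson M) {\<eta>\<in>point_patterns M. \<forall>i\<in>I. emeasure \<eta> (B i) \<in> E i}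
      = emeasure (finite_poisson M) (N -` (PiE I ?F) \<inter> space (finite_poisson M))"
  proof (intro emeasure_eq_AE)
    show "AE \<eta> in (finite_poisson M). (\<eta> \<in> {\<eta>\<in>point_patterns M. \<forall>i\<in>I. emeasure \<eta> (B i) \<in> E i}) = (\<eta> \<in> N -` (PiE I ?F) \<inter> space (finite_poisson M))"
      using AE AE_space by eventually_elim (auto simp: N_def PiE_iff)
    show "N -` (PiE I ?F) \<inter> space (finite_poisson M) \<in> sets (finite_poisson M)"
      using I by (intro measurable_sets[where A = "PiM I (\<lambda>_. ?c)"] sets_PiM_I_finite) measurable
  qed simp
  also have "\<dots> = emeasure U (PiE I ?F)"
    unfolding VU[symmetric] using I by (intro emeasure_distr[symmetric] sets_PiM_I_finite) measurable
  also have "\<dots> = (\<Prod>i\<in>I. emeasure (distr (poisson_distr (emeasure M (B i))) ?c nat_of_ennreal) (?F i))"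
    unfolding U_def using I by (subst pp.emeasure_PiM) auto
  also have "\<dots> = (\<Prod>i\<in>I. emeasure (poisson_distr (emeasure M (B i))) (E i))"
  proof (intro prod.cong refl)
    fix i assume i: "i \<in> I"
    have "emeasure (distr (poisson_distr (emeasure M (B i))) ?c nat_of_ennreal) (?F i) = emeasure (poisson_distr (emeasure M (B i))) (nat_of_ennreal -` ?F i)"
      by (subst emeasure_distr) (auto simp: measurable_cong_sets[OF sets_poisson_distr refl])
    also have "\<dots> = emeasure (poisson_distr (emeasure M (B i))) (E i)"
    proof (rule emeasure_eq_AE)
      show "AE x in poisson_distr (emeasure M (B i)). (x \<in> nat_of_ennreal -` ?F i) = (x \<in> E i)"
        using nat[of i] by eventually_elim simp
      show "nat_of_ennreal -` ?F i \<in> sets (poisson_distr (emeasure M (B i)))"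
        using measurable_sets[OF measurable_nat_of_ennreal, of "?F i"] by simp
    qed (use E[OF i] in simp)
    finally show "emeasure (distr (poisson_distr (emeasure M (B i))) ?c nat_of_ennreal) (?F i) = \<dots>" .
  qed
  finally show ?thesis .
qed

text \<open>A family that does not cover the space is completed by the remaining set, at index n,
  with the event \<open>UNIV\<close>.\<close>

lemma (in finite_measure) poisson_joint_finite_poisson: "poisson_joint M (finite_poisson M)"
  unfolding poisson_joint_def
proof (intro allI impI)
  fix n :: nat and B E
  assume B: "\<forall>i<n. B i \<in> sets M" "disjoint_family_on B {..<n}" and E: "\<forall>i<n. E i \<in> sets (borel :: ennreal measure)"
  define B' where "B' i = (if i < n then B i else space M - (\<Union>i<n. B i))" for i
  define E' where "E' i = (if i < n then E i else UNIV)" for i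
  have B'_sets: "B' i \<in> sets M" for i using B(1) by (auto simp: B'_def)
  have disj: "disjoint_family_on B' {..n}"
    using B(2) by (auto simp: disjoint_family_on_def B'_def)
  have "(\<Union>i\<in>{..n}. B' i) = space M"
    using B(1) sets.sets_into_space by (fastforce simp: B'_def split: if_splits)
  then have "emeasure (finite_poisson M) {\<eta>\<in>point_patterns M. \<forall>i\<in>{..n}. emeasure \<eta> (B' i) \<in> E' i}
      = (\<Prod>i\<in>{..n}. emeasure (poisson_distr (emeasure M (B' i))) (E' i))"
    using B'_sets disj E by (intro poisson_joint_finite_poisson_cover) (auto simp: E'_def)
  also have "{\<eta>\<in>point_patterns M. \<forall>i\<in>{..n}. emeasure \<eta> (B' i) \<in> E' i} = {\<eta>\<in>point_patterns M. \<forall>i<n. emeasure \<eta> (B i) \<in> E i}"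
    by (auto simp: B'_def E'_def)
  also have "(\<Prod>i\<in>{..n}. emeasure (poisson_distr (emeasure M (B' i))) (E' i)) = (\<Prod>i<n. emeasure (poisson_distr (emeasure M (B i))) (E i))"
    using prob_space.emeasure_space_1[OF prob_space_poisson_distr]
    by (simp add: lessThan_Suc_atMost[symmetric] B'_def E'_def)
  finally show "emeasure (finite_poisson M) {\<eta>\<in>point_patterns M. \<forall>i<n. emeasure \<eta> (B i) \<in> E i}
    = (\<Prod>i<n. emeasure (poisson_distr (emeasure M (B i))) (E i))" .
qed

section \<open>Sums of independent Poisson variables\<close>

lemma poisson_distr_add:
  fixes X Y :: "'b \<Rightarrow> ennreal"
  assumes "prob_space M" and ind: "prob_space.indep_var M borel X borel Y"
    and X: "distr M borel X = poisson_distr (ennreal a)" and Y: "distr M borel Y = poisson_distr (ennreal b)"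
    and ab: "0 \<le> a" "0 \<le> b"
  shows "distr M borel (\<lambda>\<omega>. X \<omega> + Y \<omega>) = poisson_distr (ennreal (a + b))"
proof (rule poisson_distr_eqI)
  interpret prob_space M by fact
  have [measurable]: "X \<in> borel_measurable M" "Y \<in> borel_measurable M"
    using ind by (auto dest: indep_var_rv1 indep_var_rv2)
  interpret PY: prob_space "poisson_distr (ennreal b)" by (rule prob_space_poisson_distr)
  interpret PX: prob_space "poisson_distr (ennreal a)" by (rule prob_space_poisson_distr)
  show "prob_space (distr M borel (\<lambda>\<omega>. X \<omega> + Y \<omega>))" by (rule prob_space_distr) measurable
  fix k
  have joint: "distr M (borel \<Otimes>\<^sub>M borel) (\<lambda>\<omega>. (X \<omega>, Y \<omega>)) = poisson_distr (ennreal a) \<Otimes>\<^sub>M poisson_distr (ennreal b)"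
    using ind by (simp add: indep_var_distribution_eq X Y)
  let ?S = "{p. fst p + snd p = of_nat k} :: (ennreal \<times> ennreal) set"
  have S [measurable]: "?S \<in> sets (borel \<Otimes>\<^sub>M borel)"
  proof -
    have "{p\<in>space (borel \<Otimes>\<^sub>M borel :: (ennreal \<times> ennreal) measure). fst p + snd p = of_nat k} \<in> sets (borel \<Otimes>\<^sub>M borel)"
      by measurable
    then show ?thesis by (simp add: space_pair_measure)
  qed
  have S': "?S \<in> sets (poisson_distr (ennreal a) \<Otimes>\<^sub>M poisson_distr (ennreal b))"
    using S sets_pair_measure_cong[OF sets_poisson_distr sets_poisson_distr] by blast
  have "emeasure (distr M borel (\<lambda>\<omega>. X \<omega> + Y \<omega>)) {of_nat k} = emeasure (distr M (borel \<Otimes>\<^sub>M borel) (\<lambda>\<omega>. (X \<omega>, Y \<omega>))) ?S"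
    by (simp add: emeasure_distr S) (auto intro!: arg_cong[where f="emeasure M"])
  also have "\<dots> = (\<integral>\<^sup>+x. emeasure (poisson_distr (ennreal b)) (Pair x -` ?S) \<partial>poisson_distr (ennreal a))"
    unfolding joint by (rule PY.emeasure_pair_measure_alt[OF S'])
  also have "\<dots> = (\<Sum>j. ennreal (a ^ j / fact j * exp (- a)) * emeasure (poisson_distr (ennreal b)) (Pair (of_nat j) -` ?S))"
  proof (rule nn_integral_poisson_distr[OF ab(1)])
    show "(\<lambda>x. emeasure (poisson_distr (ennreal b)) (Pair x -` ?S)) \<in> borel_measurable borel"
      using PY.measurable_emeasure_Pair[OF S'] by (simp add: measurable_cong_sets[OF sets_poisson_distr refl])
  qed
  also have "\<dots> = (\<Sum>j\<le>k. ennreal (a ^ j / fact j * exp (- a)) * emeasure (poisson_distr (ennreal b)) (Pair (of_nat j) -` ?S))"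
  proof (rule suminf_finite)
    fix j assume "j \<notin> {..k}"
    then have "Pair (of_nat j) -` ?S = {}"
      by (auto simp: not_le) (metis le_iff_add of_nat_le_iff not_less)
    then show "ennreal (a ^ j / fact j * exp (- a)) * emeasure (poisson_distr (ennreal b)) (Pair (of_nat j) -` ?S) = 0"
      by simp
  qed simp
  also have "\<dots> = (\<Sum>j\<le>k. ennreal (a ^ j / fact j * exp (- a)) * ennreal (b ^ (k - j) / fact (k - j) * exp (- b)))"
  proof (intro sum.cong refl)
    fix j assume j: "j \<in> {..k}"
    then have "(of_nat k :: ennreal) = of_nat j + of_nat (k - j)" by (simp flip: of_nat_add)
    then have "Pair (of_nat j) -` ?S = {of_nat (k - j) :: ennreal}"
      by (auto simp: ennreal_add_left_cancel)
    then show "ennreal (a ^ j / fact j * exp (- a)) * emeasure (poisson_distr (ennreal b)) (Pair (of_nat j) -` ?S)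
      = ennreal (a ^ j / fact j * exp (- a)) * ennreal (b ^ (k - j) / fact (k - j) * exp (- b))"
      using ab by (simp only: emeasure_poisson_distr_nat)
  qed
  also have "\<dots> = ennreal (\<Sum>j\<le>k. (a ^ j / fact j * exp (- a)) * (b ^ (k - j) / fact (k - j) * exp (- b)))"
    using ab by (subst sum_ennreal[symmetric], simp, intro sum.cong refl ennreal_mult[symmetric]) auto
  also have "(\<Sum>j\<le>k. (a ^ j / fact j * exp (- a)) * (b ^ (k - j) / fact (k - j) * exp (- b)))
      = (\<Sum>j\<le>k. of_nat (k choose j) * a ^ j * b ^ (k - j)) / fact k * exp (- (a + b))"
  proof -
    have "exp (- (a + b)) = exp (- a) * exp (- b)" by (simp add: exp_add[symmetric])
    then show ?thesis
      unfolding sum_divide_distrib sum_distrib_right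
      by (intro sum.cong refl) (simp add: binomial_fact field_simps)
  qed
  also have "\<dots> = (a + b) ^ k / fact k * exp (- (a + b))"
    by (simp add: binomial_ring)
  finally show "emeasure (distr M borel (\<lambda>\<omega>. X \<omega> + Y \<omega>)) {of_nat k} = ennreal ((a + b) ^ k / fact k * exp (- (a + b)))" .
qed (use ab in auto)

lemma poisson_distr_sum:
  fixes X :: "nat \<Rightarrow> 'b \<Rightarrow> ennreal"
  assumes "prob_space M" and ind: "prob_space.indep_vars M (\<lambda>_. borel) X UNIV"
    and X: "\<And>n. distr M borel (X n) = poisson_distr (ennreal (r n))" and r: "\<And>n. 0 \<le> r n"
  shows "distr M borel (\<lambda>\<omega>. \<Sum>n<N. X n \<omega>) = poisson_distr (ennreal (\<Sum>n<N. r n))"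
proof (induction N)
  interpret prob_space M by fact
  case 0
  have "distr M borel (\<lambda>_. 0 :: ennreal) = return borel 0"
    by (rule distr_const) auto
  then show ?case by (simp add: poisson_distr_def)
next
  interpret prob_space M by fact
  case (Suc N)
  have rv: "X n \<in> borel_measurable M" for n
    using ind by (auto simp: indep_vars_def2)
  have "indep_var borel ((\<lambda>f. \<Sum>n<N. f n) \<circ> (\<lambda>\<omega>. restrict (\<lambda>n. X n \<omega>) {..<N}))
      borel ((\<lambda>f. f N) \<circ> (\<lambda>\<omega>. restrict (\<lambda>n. X n \<omega>) {N}))"
    by (intro indep_var_compose[OF indep_var_restrict[OF ind]]) auto
  also have "((\<lambda>f. \<Sum>n<N. f n) \<circ> (\<lambda>\<omega>. restrict (\<lambda>n. X n \<omega>) {..<N})) = (\<lambda>\<omega>. \<Sum>n<N. X n \<omega>)"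
    by auto
  also have "((\<lambda>f. f N) \<circ> (\<lambda>\<omega>. restrict (\<lambda>n. X n \<omega>) {N})) = X N"
    by auto
  finally have "indep_var borel (\<lambda>\<omega>. \<Sum>n<N. X n \<omega>) borel (X N)" .
  then show ?case
    using poisson_distr_add[OF prob_space_axioms _ Suc X] r by (simp add: sum_nonneg)
qed

lemma emeasure_poisson_distr_atMost:
  assumes "0 \<le> r"
  shows "emeasure (poisson_distr (ennreal r)) {..of_nat k} = ennreal (\<Sum>j\<le>k. r ^ j / fact j * exp (- r))"
proof -
  have "emeasure (poisson_distr (ennreal r)) {..of_nat k} = (\<Sum>j. ennreal (r ^ j / fact j * exp (- r)) * indicator {..of_nat k} (of_nat j :: ennreal))"
    using nn_integral_poisson_distr[OF assms, of "indicator {..of_nat k}"] by simp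
  also have "\<dots> = (\<Sum>j\<le>k. ennreal (r ^ j / fact j * exp (- r)) * indicator {..of_nat k} (of_nat j :: ennreal))"
    by (rule suminf_finite) auto
  also have "\<dots> = (\<Sum>j\<le>k. ennreal (r ^ j / fact j * exp (- r)))"
    by (intro sum.cong) auto
  finally show ?thesis using assms by (simp add: sum_ennreal)
qed

lemma tendsto_poisson_distr_atMost_at_top:
  "((\<lambda>r. \<Sum>j\<le>k. r ^ j / fact j * exp (- r)) \<longlongrightarrow> (0 :: real)) at_top"
proof (rule tendsto_null_sum)
  fix j
  have "((\<lambda>r::real. r ^ j / exp r * (1 / fact j)) \<longlongrightarrow> 0 * (1 / fact j)) at_top"
    by (intro tendsto_mult tendsto_power_div_exp_0 tendsto_const)
  then show "((\<lambda>r::real. r ^ j / fact j * exp (- r)) \<longlongrightarrow> 0) at_top"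
    by (simp add: exp_minus field_simps)
qed

text \<open>The events that a partial sum is at most k decrease to the same event for the full sum,
  so the distribution functions converge. For summable means the Poisson distribution function is
  continuous in the mean; otherwise it tends to 0, and the sum is infinite almost surely.\<close>

lemma poisson_distr_suminf:
  fixes X :: "nat \<Rightarrow> 'b \<Rightarrow> ennreal"
  assumes "prob_space M" and ind: "prob_space.indep_vars M (\<lambda>_. borel) X UNIV"
    and X: "\<And>n. distr M borel (X n) = poisson_distr (ennreal (r n))" and r: "\<And>n. 0 \<le> r n"
  shows "distr M borel (\<lambda>\<omega>. \<Sum>n. X n \<omega>) = poisson_distr (\<Sum>n. ennreal (r n))"
proof -
  interpret prob_space M by fact
  have rv [measurable]: "X n \<in> borel_measurable M" for n
    using ind by (auto simp: indep_vars_def2)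
  define Z where "Z \<omega> = (\<Sum>n. X n \<omega>)" for \<omega>
  have [measurable]: "Z \<in> borel_measurable M" unfolding Z_def by measurable
  define s where "s N = (\<Sum>n<N. r n)" for N
  define F where "F k x = (\<Sum>j\<le>k. x ^ j / fact j * exp (- x))" for k and x :: real
  have s0: "0 \<le> s N" for N using r by (simp add: s_def sum_nonneg)
  have part: "emeasure M {\<omega>\<in>space M. (\<Sum>n<N. X n \<omega>) \<le> of_nat k} = ennreal (F k (s N))" for N k
  proof -
    have "emeasure M {\<omega>\<in>space M. (\<Sum>n<N. X n \<omega>) \<le> of_nat k} = emeasure (distr M borel (\<lambda>\<omega>. \<Sum>n<N. X n \<omega>)) {..of_nat k}"
      by (subst emeasure_distr) (auto intro!: arg_cong[where f="emeasure M"])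
    then show ?thesis
      using poisson_distr_sum[OF assms, of N] emeasure_poisson_distr_atMost[OF s0[of N], of k] by (simp add: s_def F_def)
  qed
  have lim: "(\<lambda>N. ennreal (F k (s N))) \<longlonglongrightarrow> emeasure M {\<omega>\<in>space M. Z \<omega> \<le> of_nat k}" for k
  proof -
    have "{\<omega>\<in>space M. Z \<omega> \<le> of_nat k} = (\<Inter>N. {\<omega>\<in>space M. (\<Sum>n<N. X n \<omega>) \<le> of_nat k})"
      by (auto simp: Z_def suminf_eq_SUP SUP_le_iff)
    moreover have "(\<lambda>N. emeasure M {\<omega>\<in>space M. (\<Sum>n<N. X n \<omega>) \<le> of_nat k}) \<longlonglongrightarrow> emeasure M (\<Inter>N. {\<omega>\<in>space M. (\<Sum>n<N. X n \<omega>) \<le> of_nat k})"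
    proof (rule Lim_emeasure_decseq)
      show "decseq (\<lambda>N. {\<omega>\<in>space M. (\<Sum>n<N. X n \<omega>) \<le> of_nat k})"
        unfolding decseq_Suc_iff by (auto intro: order.trans[rotated])
    qed auto
    ultimately show ?thesis by (simp add: part)
  qed
  have sums: "(\<Sum>n. ennreal (r n)) = (SUP N. ennreal (s N))"
    using r by (simp add: suminf_eq_SUP s_def sum_ennreal)
  have mono_s: "mono s" unfolding s_def mono_iff_le_Suc using r by simp
  show ?thesis
  proof (cases "\<Sum>n. ennreal (r n)")
    case (real t)
    then have summ: "summable r" using r by (intro summable_suminf_not_top) auto
    have st: "s \<longlonglongrightarrow> t"
    proof -
      have "ennreal (suminf r) = ennreal t" using suminf_ennreal2[OF r summ] real by simp
      then have "suminf r = t" using real(1) suminf_nonneg[OF summ r] by simp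
      then show ?thesis using summable_LIMSEQ[OF summ] by (simp add: s_def[abs_def])
    qed
    have le: "emeasure M {\<omega>\<in>space M. Z \<omega> \<le> of_nat k} = ennreal (F k t)" for k
    proof (rule LIMSEQ_unique[OF lim])
      show "(\<lambda>N. ennreal (F k (s N))) \<longlonglongrightarrow> ennreal (F k t)"
        unfolding F_def by (intro tendsto_ennrealI tendsto_intros st) auto
    qed
    have "distr M borel Z = poisson_distr (ennreal t)"
    proof (rule poisson_distr_eqI)
      show "prob_space (distr M borel Z)" by (rule prob_space_distr) measurable
      have nat_part: "\<exists>j. (\<Sum>n<N. X n \<omega>) = of_nat j" if "\<forall>n. X n \<omega> = of_nat (nat_of_ennreal (X n \<omega>))" for N \<omega>
      proof (induction N)
        case (Suc N)
        then show ?case using that by (metis of_nat_add sum.lessThan_Suc)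
      qed (auto intro: exI[of _ "0 :: nat"])
      have AE: "AE \<omega> in M. \<forall>n. X n \<omega> = of_nat (nat_of_ennreal (X n \<omega>))"
      proof (intro AE_all_countable[THEN iffD2] allI)
        fix n
        have "AE x in distr M borel (X n). x = of_nat (nat_of_ennreal x)"
          unfolding X by (rule AE_poisson_distr_nat) simp
        then show "AE \<omega> in M. X n \<omega> = of_nat (nat_of_ennreal (X n \<omega>))"
          by (rule AE_distrD[OF rv])
      qed
      have Znat: "AE \<omega> in M. Z \<omega> = \<top> \<or> (\<exists>j. Z \<omega> = of_nat j)"
        using AE
      proof eventually_elim
        case (elim \<omega>)
        obtain f where "\<And>N. (\<Sum>n<N. X n \<omega>) = of_nat (f N :: nat)" using nat_part[OF elim] by metis
        then have "Z \<omega> = (SUP N. of_nat (f N))" by (simp add: Z_def suminf_eq_SUP)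
        then show ?case using SUP_of_nat_ennreal[of f] by auto
      qed
      fix k
      show "emeasure (distr M borel Z) {of_nat k} = ennreal (t ^ k / fact k * exp (- t))"
      proof (cases k)
        case 0
        have "emeasure (distr M borel Z) {of_nat k} = emeasure M {\<omega>\<in>space M. Z \<omega> \<le> of_nat 0}"
          using 0 by (subst emeasure_distr) (auto intro!: arg_cong[where f="emeasure M"])
        then show ?thesis using 0 by (simp add: le F_def del: of_nat_0)
      next
        case (Suc m)
        \<comment> \<open>Almost surely Z is a natural number or infinite, so its mass at k is the
          jump of the distribution function from m = k - 1 to k.\<close>
        have "emeasure M {\<omega>\<in>space M. Z \<omega> \<le> of_nat k} = emeasure M ({\<omega>\<in>space M. Z \<omega> \<le> of_nat m} \<union> {\<omega>\<in>space M. Z \<omega> = of_nat k})"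
        proof (rule emeasure_eq_AE)
          show "AE \<omega> in M. (\<omega> \<in> {\<omega>\<in>space M. Z \<omega> \<le> of_nat k}) = (\<omega> \<in> {\<omega>\<in>space M. Z \<omega> \<le> of_nat m} \<union> {\<omega>\<in>space M. Z \<omega> = of_nat k})"
            using Znat
          proof eventually_elim
            case (elim \<omega>)
            have "(of_nat j :: ennreal) \<le> of_nat k \<longleftrightarrow> of_nat j \<le> (of_nat m :: ennreal) \<or> of_nat j = (of_nat k :: ennreal)" for j
              using Suc by (simp only: of_nat_le_iff of_nat_eq_iff) auto
            then show ?case using elim by (auto simp: top_unique)
          qed
        qed measurable
        also have "\<dots> = emeasure M {\<omega>\<in>space M. Z \<omega> \<le> of_nat m} + emeasure M {\<omega>\<in>space M. Z \<omega> = of_nat k}"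
        proof (rule plus_emeasure[symmetric])
          have "\<not> (of_nat k :: ennreal) \<le> of_nat m" using Suc by (simp only: of_nat_le_iff)
          then show "{\<omega>\<in>space M. Z \<omega> \<le> of_nat m} \<inter> {\<omega>\<in>space M. Z \<omega> = of_nat k} = {}" by auto
        qed measurable
        finally have "ennreal (F m t) + emeasure M {\<omega>\<in>space M. Z \<omega> = of_nat k} = ennreal (F m t) + ennreal (t ^ k / fact k * exp (- t))"
          using Suc real(1) by (simp add: le F_def sum_nonneg del: of_nat_Suc)
        then have "emeasure M {\<omega>\<in>space M. Z \<omega> = of_nat k} = ennreal (t ^ k / fact k * exp (- t))"
          by (simp add: ennreal_add_left_cancel)
        then show ?thesis
          by (subst emeasure_distr) (auto simp: vimage_def Int_def conj_commute)
      qed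
    qed (use real in auto)
    then show ?thesis using real by (simp add: Z_def[abs_def])
  next
    case top
    have "filterlim s at_top sequentially"
    proof (rule filterlim_at_top_mono[OF filterlim_compose[OF _ filterlim_ident]])
      show "filterlim s at_top sequentially"
        unfolding filterlim_at_top
      proof
        fix C :: real
        have "(SUP N. ennreal (s N)) = \<top>" using top sums by (simp only:)
        then have "ennreal C < (SUP N. ennreal (s N))" by (simp only: ennreal_less_top)
        then obtain N where "ennreal C < ennreal (s N)" by (auto simp: less_SUP_iff)
        then have "C \<le> s N" by (metis ennreal_leI leD linear)
        then show "\<forall>\<^sub>F N in sequentially. C \<le> s N"
          using mono_s by (auto simp: eventually_sequentially mono_def intro!: exI[of _ N] order.trans[of C "s N"])
      qed
    qed auto
    then have "(\<lambda>N. ennreal (F k (s N))) \<longlonglongrightarrow> ennreal 0" for k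
      unfolding F_def by (intro tendsto_ennrealI filterlim_compose[OF tendsto_poisson_distr_atMost_at_top])
    then have le: "emeasure M {\<omega>\<in>space M. Z \<omega> \<le> of_nat k} = 0" for k
      using LIMSEQ_unique[OF lim[of k]] by auto
    have "AE \<omega> in M. \<forall>k :: nat. \<not> Z \<omega> \<le> of_nat k"
      using le by (auto simp: AE_all_countable intro!: AE_I[OF _ le])
    then have AE: "AE \<omega> in M. Z \<omega> = \<top>"
      by eventually_elim (metis ennreal_Ex_less_of_nat less_imp_le less_top)
    have "distr M borel Z = distr M borel (\<lambda>_. \<top>)"
      by (rule distr_cong_AE) (use AE in auto)
    also have "\<dots> = return borel \<top>" by (rule distr_const) auto
    finally show ?thesis using top by (simp add: Z_def[abs_def] poisson_distr_def)
  qed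
qed

section \<open>Sigma-finite intensities by superposition\<close>

lemma prod_UNIV_poisson_distr:
  fixes r :: "'i \<Rightarrow> ennreal"
  assumes "finite I" "J \<subseteq> I" "\<And>i. i \<in> I - J \<Longrightarrow> E i = UNIV"
  shows "(\<Prod>i\<in>I. emeasure (poisson_distr (r i)) (E i)) = (\<Prod>i\<in>J. emeasure (poisson_distr (r i)) (E i))"
  using assms prob_space.emeasure_space_1[OF prob_space_poisson_distr]
  by (intro prod.mono_neutral_right) auto

lemma measurable_sets_Collect_emeasure_All:
  fixes m :: nat
  assumes "\<And>i. i < m \<Longrightarrow> B i \<in> sets S" "\<And>i. i < m \<Longrightarrow> E i \<in> sets borel"
  shows "{\<eta>\<in>point_patterns S. \<forall>i<m. emeasure \<eta> (B i) \<in> E i} \<in> sets (point_pattern_space S)"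
proof -
  have "{\<eta>\<in>space (point_pattern_space S). \<forall>i\<in>{..<m}. emeasure \<eta> (B i) \<in> E i} \<in> sets (point_pattern_space S)"
    using assms by (intro sets.sets_Collect_finite_All) (auto intro!: measurable_sets_Collect_emeasure)
  also have "{\<eta>\<in>space (point_pattern_space S). \<forall>i\<in>{..<m}. emeasure \<eta> (B i) \<in> E i}
      = {\<eta>\<in>point_patterns S. \<forall>i<m. emeasure \<eta> (B i) \<in> E i}"
    by auto
  finally show ?thesis .
qed

text \<open>Independent Poisson processes with the finite intensities \<open>L n\<close>, the
  restrictions of \<Lambda> to \<open>A n\<close>, are superposed. Countable sums of independent
  Poisson counts are Poisson, also when the total mean is infinite.\<close>

lemma ex_poisson_pp_distr:
  assumes A: "range A \<subseteq> sets \<Lambda>" "disjoint_family A" "(\<Union>n. A n) = space \<Lambda>"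
    and fin: "\<And>n :: nat. emeasure \<Lambda> (A n) < \<infinity>"
  shows "\<exists>P. is_poisson_pp_distr \<Lambda> P"
proof -
  let ?\<Pi> = "point_pattern_space \<Lambda>"
  have A' [measurable]: "A n \<in> sets \<Lambda>" for n using A by auto
  define L where "L n = density \<Lambda> (indicator (A n))" for n
  have L_sets: "sets (L n) = sets \<Lambda>" and L_space: "space (L n) = space \<Lambda>" for n by (simp_all add: L_def)
  have L_em: "emeasure (L n) B = emeasure \<Lambda> (A n \<inter> B)" if "B \<in> sets \<Lambda>" for n B
  proof -
    have "emeasure (L n) B = (\<integral>\<^sup>+x. indicator (A n \<inter> B) x \<partial>\<Lambda>)"
      using that unfolding L_def
      by (subst emeasure_density, simp, simp, intro nn_integral_cong) (auto split: split_indicator)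
    then show ?thesis using that by (simp only: nn_integral_indicator sets.Int A')
  qed
  have L_fin: "finite_measure (L n)" for n
    using fin[of n] A'[of n] sets.sets_into_space[of "A n" \<Lambda>]
    by (intro finite_measureI) (auto simp: L_space L_em Int_absorb2)
  have L_real: "emeasure (L n) B = ennreal (measure (L n) B)" for n B
    by (rule finite_measure.emeasure_eq_measure[OF L_fin])
  define F where "F n = finite_poisson (L n)" for n
  have F_prob: "prob_space (F n)" for n unfolding F_def by (rule finite_measure.prob_space_finite_poisson[OF L_fin])
  have F_sets [measurable_cong]: "sets (F n) = sets ?\<Pi>" for n
    unfolding F_def by (simp add: finite_measure.sets_finite_poisson[OF L_fin] point_pattern_space_cong[OF L_sets])
  have F_space: "space (F n) = point_patterns \<Lambda>" for n
    using sets_eq_imp_space_eq[OF F_sets] by simp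
  have F_joint: "emeasure (F n) {\<eta>\<in>point_patterns \<Lambda>. \<forall>i<m. emeasure \<eta> (B i) \<in> E i}
       = (\<Prod>i<m. emeasure (poisson_distr (emeasure (L n) (B i))) (E i))"
    if "\<And>i. i < m \<Longrightarrow> B i \<in> sets \<Lambda>" "disjoint_family_on B {..<m}" "\<And>i. i < m \<Longrightarrow> E i \<in> sets borel" for n and m :: nat and B E
    using poisson_jointD[OF finite_measure.poisson_joint_finite_poisson[OF L_fin], of m B n E] that
    by (simp add: F_def L_sets point_patterns_cong[OF L_sets])
  interpret product_prob_space F UNIV
    by (intro product_prob_spaceI F_prob)
  let ?\<Omega> = "PiM UNIV F"
  have coord [measurable]: "(\<lambda>\<omega>. \<omega> n) \<in> measurable ?\<Omega> ?\<Pi>" for n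
    using measurable_component_singleton[of n UNIV F] by (simp add: measurable_cong_sets[OF refl F_sets])
  have coord_space: "\<omega> n \<in> point_patterns \<Lambda>" if "\<omega> \<in> space ?\<Omega>" for \<omega> n
    using measurable_space[OF coord that] by simp
  define \<phi> where "\<phi> = countable_sum \<Lambda>"
  have \<phi>_em: "emeasure (\<phi> \<omega>) B = (\<Sum>n. emeasure (\<omega> n) B)" if "\<omega> \<in> space ?\<Omega>" "B \<in> sets \<Lambda>" for \<omega> B
    unfolding \<phi>_def using that coord_space by (intro emeasure_countable_sum sets_point_pattern) auto
  have \<phi> [measurable]: "\<phi> \<in> measurable ?\<Omega> ?\<Pi>"
  proof (rule measurable_point_pattern_spaceI)
    fix \<omega> assume "\<omega> \<in> space ?\<Omega>"
    then show "\<phi> \<omega> \<in> point_patterns \<Lambda>" unfolding \<phi>_def by (intro countable_sum_point_pattern coord_space)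
  next
    fix B assume [measurable]: "B \<in> sets \<Lambda>"
    have "(\<lambda>\<omega>. \<Sum>n. emeasure (\<omega> n) B) \<in> borel_measurable ?\<Omega>" by measurable
    then show "(\<lambda>\<omega>. emeasure (\<phi> \<omega>) B) \<in> borel_measurable ?\<Omega>"
      by (rule measurable_cong[THEN iffD1, rotated]) (simp add: \<phi>_em)
  qed
  have joint: "poisson_joint \<Lambda> (distr ?\<Omega> ?\<Pi> \<phi>)"
    unfolding poisson_joint_def
  proof (intro allI impI)
    fix m :: nat and B E
    assume B: "\<forall>i<m. B i \<in> sets \<Lambda>" "disjoint_family_on B {..<m}" and E: "\<forall>i<m. E i \<in> sets (borel :: ennreal measure)"
    \<comment> \<open>Count of the n-th process in the i-th set, indexed by p = (n, i): independent
      over n by the product construction and over i within each process.\<close>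
    define X where "X p \<omega> = emeasure (\<omega> (fst p)) (B (snd p))" for p and \<omega> :: "nat \<Rightarrow> 'a measure"
    let ?K = "UNIV \<times> {..<m}"
    have X_rv [measurable]: "X p \<in> borel_measurable ?\<Omega>" if "p \<in> ?K" for p
      unfolding X_def[abs_def] using that B by (intro measurable_emeasure_point_pattern[OF coord]) auto
    have X_law: "distr ?\<Omega> borel (X p) = poisson_distr (emeasure (L (fst p)) (B (snd p)))" if p: "p \<in> ?K" for p
    proof (rule measure_eqI)
      fix C assume "C \<in> sets (distr ?\<Omega> borel (X p))"
      then have C [measurable]: "C \<in> sets borel" by simp
      have Bp: "B (snd p) \<in> sets \<Lambda>" using p B by auto
      have S: "{\<eta>\<in>point_patterns \<Lambda>. emeasure \<eta> (B (snd p)) \<in> C} \<in> sets (F (fst p))"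
        using measurable_sets_Collect_emeasure[OF Bp C] by (simp add: F_sets)
      have "emeasure (distr ?\<Omega> borel (X p)) C = emeasure ?\<Omega> {\<omega>\<in>space ?\<Omega>. \<omega> (fst p) \<in> {\<eta>\<in>point_patterns \<Lambda>. emeasure \<eta> (B (snd p)) \<in> C}}"
        using p by (subst emeasure_distr) (auto simp: X_def coord_space intro!: arg_cong[where f="emeasure ?\<Omega>"])
      also have "\<dots> = emeasure (F (fst p)) {\<eta>\<in>point_patterns \<Lambda>. emeasure \<eta> (B (snd p)) \<in> C}"
        by (rule emeasure_PiM_Collect_single[OF _ S]) simp
      also have "\<dots> = emeasure (poisson_distr (emeasure (L (fst p)) (B (snd p)))) C"
        using F_joint[of 1 "\<lambda>_. B (snd p)" "\<lambda>_. C" "fst p"] Bp C by (simp add: disjoint_family_on_def)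
      finally show "emeasure (distr ?\<Omega> borel (X p)) C = emeasure (poisson_distr (emeasure (L (fst p)) (B (snd p)))) C" .
    qed simp
    have X_indep: "P.indep_vars (\<lambda>_. borel) X ?K"
      unfolding P.indep_vars_def2
    proof (intro conjI ballI P.indep_setsI)
      fix A' J assume J: "J \<noteq> {}" "J \<subseteq> ?K" "finite J" and "\<forall>j\<in>J. A' j \<in> {X j -` A \<inter> space ?\<Omega> |A. A \<in> sets borel}"
      then have "\<forall>j\<in>J. \<exists>C. C \<in> sets borel \<and> A' j = X j -` C \<inter> space ?\<Omega>" by auto
      then obtain C where C: "\<And>j. j \<in> J \<Longrightarrow> C j \<in> sets borel" "\<And>j. j \<in> J \<Longrightarrow> A' j = X j -` C j \<inter> space ?\<Omega>"
        by metis
      define D where "D j = (if j \<in> J then C j else UNIV)" for j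
      have D: "D j \<in> sets borel" for j using C by (simp add: D_def)
      \<comment> \<open>The finite index set J lies in the rectangle of N processes and m sets; the
        entries outside J carry the event \<open>UNIV\<close> and contribute factors 1.\<close>
      define N where "N = Suc (Max (fst ` J))"
      have JN: "J \<subseteq> {..<N} \<times> {..<m}"
        using J unfolding N_def by (auto simp: less_Suc_eq_le intro!: Max_ge) force
      define G where "G n = {\<eta>\<in>point_patterns \<Lambda>. \<forall>i<m. emeasure \<eta> (B i) \<in> D (n, i)}" for n
      have G: "G n \<in> sets (F n)" for n
        unfolding G_def F_sets using B D by (intro measurable_sets_Collect_emeasure_All) auto
      have "(\<Inter>j\<in>J. A' j) = {\<omega>\<in>space ?\<Omega>. \<forall>n\<in>{..<N}. \<omega> n \<in> G n}"
      proof (intro set_eqI iffI)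
        fix \<omega> assume "\<omega> \<in> (\<Inter>j\<in>J. A' j)"
        then show "\<omega> \<in> {\<omega>\<in>space ?\<Omega>. \<forall>n\<in>{..<N}. \<omega> n \<in> G n}"
          using J(1) C(2) by (auto simp: G_def D_def X_def coord_space)
      next
        fix \<omega> assume \<omega>: "\<omega> \<in> {\<omega>\<in>space ?\<Omega>. \<forall>n\<in>{..<N}. \<omega> n \<in> G n}"
        show "\<omega> \<in> (\<Inter>j\<in>J. A' j)"
        proof
          fix j assume j: "j \<in> J"
          then have "fst j < N" "snd j < m" using JN by auto
          then have "emeasure (\<omega> (fst j)) (B (snd j)) \<in> D (fst j, snd j)" using \<omega> unfolding G_def by blast
          then show "\<omega> \<in> A' j" using j \<omega> by (auto simp: C(2) D_def X_def)
        qed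
      qed
      then have "emeasure ?\<Omega> (\<Inter>j\<in>J. A' j) = (\<Prod>n<N. emeasure (F n) (G n))"
        using G by (subst emeasure_PiM_Collect[symmetric]) auto
      also have "\<dots> = (\<Prod>n<N. \<Prod>i<m. emeasure (poisson_distr (emeasure (L n) (B i))) (D (n, i)))"
      proof (intro prod.cong refl)
        fix n
        show "emeasure (F n) (G n) = (\<Prod>i<m. emeasure (poisson_distr (emeasure (L n) (B i))) (D (n, i)))"
          unfolding G_def using F_joint[of m B "\<lambda>i. D (n, i)" n] B D by blast
      qed
      also have "\<dots> = (\<Prod>p\<in>{..<N} \<times> {..<m}. emeasure (poisson_distr (emeasure (L (fst p)) (B (snd p)))) (D p))"
        by (simp add: prod.cartesian_product split_beta)
      also have "\<dots> = (\<Prod>p\<in>J. emeasure (poisson_distr (emeasure (L (fst p)) (B (snd p)))) (D p))"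
        using JN by (intro prod_UNIV_poisson_distr) (auto simp: D_def)
      also have "\<dots> = (\<Prod>p\<in>J. emeasure ?\<Omega> (A' p))"
      proof (intro prod.cong refl)
        fix p assume p: "p \<in> J"
        then have "p \<in> ?K" using J by auto
        then show "emeasure (poisson_distr (emeasure (L (fst p)) (B (snd p)))) (D p) = emeasure ?\<Omega> (A' p)"
          using p C X_rv by (simp add: D_def emeasure_distr flip: X_law)
      qed
      finally show "P.prob (\<Inter>j\<in>J. A' j) = (\<Prod>j\<in>J. P.prob (A' j))"
        by (simp add: P.emeasure_eq_measure prod_ennreal prod_nonneg)
    next
      show "{X i -` A \<inter> space ?\<Omega> |A. A \<in> sets borel} \<subseteq> P.events" if "i \<in> ?K" for i
        using X_rv[OF that] by (auto intro: measurable_sets)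
    qed (rule X_rv)
    \<comment> \<open>The counts of the superposition. Different i use disjoint blocks of X, which
      preserves independence.\<close>
    define Y where "Y i \<omega> = (\<Sum>n. X (n, i) \<omega>)" for i \<omega>
    have X_sub: "P.indep_vars (\<lambda>_. borel) (\<lambda>n. X (n, i)) UNIV" if "i < m" for i
    proof -
      have "P.indep_vars (\<lambda>n. PiM {(n, i)} (\<lambda>_. borel)) (\<lambda>n \<omega>. restrict (\<lambda>p. X p \<omega>) {(n, i)}) UNIV"
        using that by (intro P.indep_vars_restrict[OF X_indep]) (auto simp: disjoint_family_on_def)
      then have "P.indep_vars (\<lambda>_. borel) (\<lambda>n \<omega>. (restrict (\<lambda>p. X p \<omega>) {(n, i)}) (n, i)) UNIV"
        by (rule P.indep_vars_compose2[where Y = "\<lambda>n f. f (n, i)"]) auto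
      then show ?thesis by (simp cong: P.indep_vars_cong)
    qed
    have Y_law: "distr ?\<Omega> borel (Y i) = poisson_distr (emeasure \<Lambda> (B i))" if i: "i < m" for i
    proof -
      have "distr ?\<Omega> borel (Y i) = poisson_distr (\<Sum>n. ennreal (measure (L n) (B i)))"
        unfolding Y_def[abs_def]
        using i by (intro poisson_distr_suminf[OF P.prob_space_axioms X_sub]) (auto simp: X_law L_real)
      also have "(\<Sum>n. ennreal (measure (L n) (B i))) = (\<Sum>n. emeasure \<Lambda> (A n \<inter> B i))"
        using B i by (simp add: L_real[symmetric] L_em)
      also have "\<dots> = emeasure \<Lambda> (\<Union>n. A n \<inter> B i)"
        using B i disjoint_family_on_bisimulation[OF A(2), of "\<lambda>n. A n \<inter> B i"] 
        by (intro suminf_emeasure) auto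
      also have "(\<Union>n. A n \<inter> B i) = B i"
        using B(1) i A(3) sets.sets_into_space[of "B i" \<Lambda>] by auto
      finally show ?thesis .
    qed
    have Y_indep: "P.indep_vars (\<lambda>_. borel) Y {..<m}"
    proof -
      have "P.indep_vars (\<lambda>i. PiM (UNIV \<times> {i}) (\<lambda>_. borel)) (\<lambda>i \<omega>. restrict (\<lambda>p. X p \<omega>) (UNIV \<times> {i})) {..<m}"
        by (intro P.indep_vars_restrict[OF X_indep]) (auto simp: disjoint_family_on_def)
      then have "P.indep_vars (\<lambda>_. borel) (\<lambda>i \<omega>. (\<Sum>n. (restrict (\<lambda>p. X p \<omega>) (UNIV \<times> {i})) (n, i))) {..<m}"
        by (rule P.indep_vars_compose2[where Y = "\<lambda>i f. \<Sum>n. f (n, i)"]) auto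
      then show ?thesis by (simp add: Y_def[abs_def] cong: P.indep_vars_cong)
    qed
    have Y_rv: "Y i \<in> borel_measurable ?\<Omega>" if "i < m" for i
      using Y_indep that by (auto simp: P.indep_vars_def2)
    have "{\<eta>\<in>point_patterns \<Lambda>. \<forall>i<m. emeasure \<eta> (B i) \<in> E i} \<in> sets ?\<Pi>"
      using B E by (intro measurable_sets_Collect_emeasure_All) auto
    then have "emeasure (distr ?\<Omega> ?\<Pi> \<phi>) {\<eta>\<in>point_patterns \<Lambda>. \<forall>i<m. emeasure \<eta> (B i) \<in> E i}
        = emeasure ?\<Omega> {\<omega>\<in>space ?\<Omega>. \<forall>i<m. Y i \<omega> \<in> E i}"
    proof (subst emeasure_distr[OF \<phi>])
      have e: "emeasure (\<phi> \<omega>) (B i) = Y i \<omega>" if "\<omega> \<in> space ?\<Omega>" "i < m" for \<omega> i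
        using that B by (simp add: Y_def X_def \<phi>_em)
      have "(\<forall>i<m. emeasure (\<phi> \<omega>) (B i) \<in> E i) \<longleftrightarrow> (\<forall>i<m. Y i \<omega> \<in> E i)" if "\<omega> \<in> space ?\<Omega>" for \<omega>
        by (simp add: e[OF that])
      moreover have "\<phi> \<omega> \<in> point_patterns \<Lambda>" if "\<omega> \<in> space ?\<Omega>" for \<omega>
        using measurable_space[OF \<phi> that] by simp
      ultimately have "\<phi> -` {\<eta>\<in>point_patterns \<Lambda>. \<forall>i<m. emeasure \<eta> (B i) \<in> E i} \<inter> space ?\<Omega>
          = {\<omega>\<in>space ?\<Omega>. \<forall>i<m. Y i \<omega> \<in> E i}"
        by (auto simp only: vimage_eq Int_iff mem_Collect_eq)
      then show "emeasure ?\<Omega> (\<phi> -` {\<eta>\<in>point_patterns \<Lambda>. \<forall>i<m. emeasure \<eta> (B i) \<in> E i} \<inter> space ?\<Omega>)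
          = emeasure ?\<Omega> {\<omega>\<in>space ?\<Omega>. \<forall>i<m. Y i \<omega> \<in> E i}"
        by (rule arg_cong)
    qed
    also have "\<dots> = (\<Prod>i<m. emeasure (poisson_distr (emeasure \<Lambda> (B i))) (E i))"
    proof (cases "m = 0")
      case False
      have "{\<omega>\<in>space ?\<Omega>. \<forall>i<m. Y i \<omega> \<in> E i} = (\<Inter>i\<in>{..<m}. Y i -` E i \<inter> space ?\<Omega>)"
        using False by auto
      also have "emeasure ?\<Omega> \<dots> = ennreal (\<Prod>i<m. P.prob (Y i -` E i \<inter> space ?\<Omega>))"
        using False E by (subst P.indep_varsD_finite[OF Y_indep, symmetric]) (auto simp: P.emeasure_eq_measure)
      also have "\<dots> = (\<Prod>i<m. emeasure ?\<Omega> (Y i -` E i \<inter> space ?\<Omega>))"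
        by (simp add: P.emeasure_eq_measure prod_ennreal)
      also have "\<dots> = (\<Prod>i<m. emeasure (poisson_distr (emeasure \<Lambda> (B i))) (E i))"
        using E Y_rv by (intro prod.cong refl) (simp add: emeasure_distr flip: Y_law)
      finally show ?thesis .
    qed (simp add: P.emeasure_space_1)
    finally show "emeasure (distr ?\<Omega> ?\<Pi> \<phi>) {\<eta>\<in>point_patterns \<Lambda>. \<forall>i<m. emeasure \<eta> (B i) \<in> E i}
      = (\<Prod>i<m. emeasure (poisson_distr (emeasure \<Lambda> (B i))) (E i))" .
  qed
  have "is_poisson_pp_distr \<Lambda> (distr ?\<Omega> ?\<Pi> \<phi>)"
    by (rule is_poisson_pp_distrI[OF P.prob_space_distr[OF \<phi>] _ joint]) simp
  then show ?thesis by blast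
qed

section \<open>Divergences of Poisson point processes\<close>

text \<open>Pushing forward keeps exactly the events that are preimages under f, so the divergence
  of image laws is a partition supremum over a smaller algebra on the original space.\<close>

lemma partition_div_distr:
  assumes f: "f \<in> measurable P N" and sets: "sets Q = sets P"
  shows "partition_div \<alpha> (sets N) (distr P N f) (distr Q N f) = partition_div \<alpha> {f -` A \<inter> space P | A. A \<in> sets N} P Q"
proof (rule antisym)
  have f': "f \<in> measurable Q N" using f by (simp add: measurable_cong_sets[OF sets refl])
  have sp: "space Q = space P" by (rule sets_eq_imp_space_eq[OF sets])
  have m: "measure (distr P N f) A = measure P (f -` A \<inter> space P)" "measure (distr Q N f) A = measure Q (f -` A \<inter> space P)"
    if "A \<in> sets N" for A
    using that f f' by (simp_all add: measure_distr sp)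
  show "partition_div \<alpha> (sets N) (distr P N f) (distr Q N f) \<le> partition_div \<alpha> {f -` A \<inter> space P | A. A \<in> sets N} P Q"
  proof (rule partition_div_least)
    fix n :: nat and B assume B: "\<And>i. i < n \<Longrightarrow> B i \<in> sets N" "disjoint_family_on B {..<n}"
    have "(\<Sum>i<n. tsallis_fun \<alpha> (measure (distr P N f) (B i)) (measure (distr Q N f) (B i)))
        = (\<Sum>i<n. tsallis_fun \<alpha> (measure P (f -` B i \<inter> space P)) (measure Q (f -` B i \<inter> space P)))"
      using B by (intro sum.cong refl) (simp add: m)
    also have "\<dots> \<le> partition_div \<alpha> {f -` A \<inter> space P | A. A \<in> sets N} P Q"
      using B by (intro partition_div_upper) (auto simp: disjoint_family_on_def)
    finally show "(\<Sum>i<n. tsallis_fun \<alpha> (measure (distr P N f) (B i)) (measure (distr Q N f) (B i))) \<le> \<dots>" .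
  qed
  show "partition_div \<alpha> {f -` A \<inter> space P | A. A \<in> sets N} P Q \<le> partition_div \<alpha> (sets N) (distr P N f) (distr Q N f)"
  proof (rule partition_div_least)
    fix n :: nat and B assume B: "\<And>i. i < n \<Longrightarrow> B i \<in> {f -` A \<inter> space P | A. A \<in> sets N}" "disjoint_family_on B {..<n}"
    have "\<forall>i\<in>{..<n}. \<exists>A. A \<in> sets N \<and> B i = f -` A \<inter> space P"
    proof
      fix i assume "i \<in> {..<n}"
      then show "\<exists>A. A \<in> sets N \<and> B i = f -` A \<inter> space P" using B(1)[of i] by auto
    qed
    then obtain A where A: "\<And>i. i < n \<Longrightarrow> A i \<in> sets N" "\<And>i. i < n \<Longrightarrow> B i = f -` A i \<inter> space P"
      by (metis lessThan_iff)
    \<comment> \<open>Disjoint preimages may come from sets that overlap off the range of f.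
      Removing the earlier sets makes them disjoint and leaves the preimages unchanged.\<close>
    define C where "C i = A i - (\<Union>j<i. A j)" for i
    have C: "C i \<in> sets N" if "i < n" for i using A(1) that by (auto simp: C_def)
    have disj: "disjoint_family_on C {..<n}"
      unfolding disjoint_family_on_def
    proof safe
      fix i j x assume "i < n" "j < n" "i \<noteq> j" "x \<in> C i" "x \<in> C j"
      then show "x \<in> {}" by (cases i j rule: linorder_cases) (auto simp: C_def)
    qed
    have BC: "B i = f -` C i \<inter> space P" if i: "i < n" for i
    proof
      show "B i \<subseteq> f -` C i \<inter> space P"
      proof
        fix x assume x: "x \<in> B i"
        have "x \<notin> B j" if "j < i" for j
          using disjoint_family_onD[OF B(2), of i j] that i x by auto
        then show "x \<in> f -` C i \<inter> space P" using x i A(2) by (auto simp: C_def)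
      qed
    qed (use A(2)[OF i] in \<open>auto simp: C_def\<close>)
    have "(\<Sum>i<n. tsallis_fun \<alpha> (measure P (B i)) (measure Q (B i)))
        = (\<Sum>i<n. tsallis_fun \<alpha> (measure (distr P N f) (C i)) (measure (distr Q N f) (C i)))"
      using C by (intro sum.cong refl) (simp add: m BC)
    also have "\<dots> \<le> partition_div \<alpha> (sets N) (distr P N f) (distr Q N f)"
      using C disj by (intro partition_div_upper) auto
    finally show "(\<Sum>i<n. tsallis_fun \<alpha> (measure P (B i)) (measure Q (B i))) \<le> \<dots>" .
  qed
qed

lemma partition_div_upper_finite:
  assumes "finite I" and B: "\<And>i. i \<in> I \<Longrightarrow> B i \<in> \<A>" "disjoint_family_on B I"
  shows "(\<Sum>i\<in>I. tsallis_fun \<alpha> (measure P (B i)) (measure Q (B i))) \<le> partition_div \<alpha> \<A> P Q"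
proof -
  obtain h where h: "bij_betw h {..<card I} I"
    using ex_bij_betw_nat_finite[OF assms(1)] by (auto simp: atLeast0LessThan)
  have "(\<Sum>i\<in>I. tsallis_fun \<alpha> (measure P (B i)) (measure Q (B i)))
      = (\<Sum>i<card I. tsallis_fun \<alpha> (measure P (B (h i))) (measure Q (B (h i))))"
    by (rule sum.reindex_bij_betw[OF h, symmetric])
  also have "\<dots> \<le> partition_div \<alpha> \<A> P Q"
  proof (rule partition_div_upper)
    show "B (h i) \<in> \<A>" if "i < card I" for i
      using B(1) bij_betwE[OF h] that by auto
    show "disjoint_family_on (\<lambda>i. B (h i)) {..<card I}"
      unfolding disjoint_family_on_def
    proof (intro ballI impI)
      fix i j assume "i \<in> {..<card I}" "j \<in> {..<card I}" "i \<noteq> j"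
      then show "B (h i) \<inter> B (h j) = {}"
        using bij_betwE[OF h] bij_betw_imp_inj_on[OF h] 
        by (intro disjoint_family_onD[OF B(2)]) (auto dest: inj_onD)
    qed
  qed
  finally show ?thesis .
qed

lemma is_poisson_pp_distr_sets: "is_poisson_pp_distr \<Lambda> P \<Longrightarrow> sets P = sets (point_pattern_space \<Lambda>)"
  by (simp add: is_poisson_pp_distr_def)

lemma is_poisson_pp_distr_space: "is_poisson_pp_distr \<Lambda> P \<Longrightarrow> space P = point_patterns \<Lambda>"
  using sets_eq_imp_space_eq[OF is_poisson_pp_distr_sets] by simp

lemma measurable_counts:
  assumes "\<And>i. i \<in> I \<Longrightarrow> B i \<in> sets \<Lambda>"
  shows "(\<lambda>\<eta>. \<lambda>i\<in>I. emeasure \<eta> (B i)) \<in> measurable (point_pattern_space \<Lambda>) (PiM I (\<lambda>_. borel))"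
  using assms by (intro measurable_restrict) measurable

text \<open>Independence, given for families indexed by \<open>{..<n}\<close>, is carried to any
  finite index set by an enumeration; with the marginal laws it makes the joint law a
  product.\<close>

lemma distr_counts:
  assumes P: "is_poisson_pp_distr \<Lambda> P" and I: "finite I"
    and B: "\<And>i. i \<in> I \<Longrightarrow> B i \<in> sets \<Lambda>" "disjoint_family_on B I"
  shows "distr P (PiM I (\<lambda>_. borel)) (\<lambda>\<eta>. \<lambda>i\<in>I. emeasure \<eta> (B i)) = PiM I (\<lambda>i. poisson_distr (emeasure \<Lambda> (B i)))"
proof -
  interpret pp: product_prob_space "\<lambda>i. poisson_distr (emeasure \<Lambda> (B i))" I
    by (intro product_prob_spaceI prob_space_poisson_distr)
  interpret P: prob_space P using P by (simp add: is_poisson_pp_distr_def)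
  note sets = is_poisson_pp_distr_sets[OF P] and sp = is_poisson_pp_distr_space[OF P]
  note sets [measurable_cong]
  have V [measurable]: "(\<lambda>\<eta>. \<lambda>i\<in>I. emeasure \<eta> (B i)) \<in> measurable P (PiM I (\<lambda>_. borel))"
    using measurable_counts[of I B \<Lambda>] B(1) by (simp add: measurable_cong_sets[OF sets refl])
  show ?thesis
  proof (rule pp.PiM_eqI[OF I])
    show "sets (distr P (PiM I (\<lambda>_. borel)) (\<lambda>\<eta>. \<lambda>i\<in>I. emeasure \<eta> (B i))) = sets (PiM I (\<lambda>i. poisson_distr (emeasure \<Lambda> (B i))))"
      by (auto intro!: sets_PiM_cong)
    fix E assume "\<And>i. i \<in> I \<Longrightarrow> E i \<in> sets (poisson_distr (emeasure \<Lambda> (B i)))"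
    then have E: "\<And>i. i \<in> I \<Longrightarrow> E i \<in> sets borel" by simp
    obtain h where h: "bij_betw h {..<card I} I"
      using ex_bij_betw_nat_finite[OF I] by (auto simp: atLeast0LessThan)
    have hI: "h i \<in> I" if "i < card I" for i using bij_betwE[OF h] that by auto
    have PE: "PiE I E \<in> sets (PiM I (\<lambda>_. borel))" using I E by (intro sets_PiM_I_finite) auto
    have marg: "P.prob ((\<lambda>\<eta>. emeasure \<eta> (B i)) -` E i \<inter> space P) = measure (poisson_distr (emeasure \<Lambda> (B i))) (E i)" if "i \<in> I" for i
    proof -
      have "(\<lambda>\<eta>. emeasure \<eta> (B i)) \<in> borel_measurable P" using B(1)[OF that] by measurable
      moreover have "distr P borel (\<lambda>\<eta>. emeasure \<eta> (B i)) = poisson_distr (emeasure \<Lambda> (B i))"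
        using P B(1)[OF that] unfolding is_poisson_pp_distr_def by blast
      ultimately show ?thesis
        using measure_distr[of "\<lambda>\<eta>. emeasure \<eta> (B i)" P borel "E i"] E[OF that] by simp
    qed
    show "emeasure (distr P (PiM I (\<lambda>_. borel)) (\<lambda>\<eta>. \<lambda>i\<in>I. emeasure \<eta> (B i))) (PiE I E)
        = (\<Prod>i\<in>I. emeasure (poisson_distr (emeasure \<Lambda> (B i))) (E i))"
    proof (cases "I = {}")
      case True
      then have "(\<lambda>\<eta>. \<lambda>i\<in>I. emeasure \<eta> (B i)) -` PiE I E \<inter> space P = space P" by auto
      then show ?thesis
        using True emeasure_distr[OF V PE] by (simp add: P.emeasure_space_1)
    next
      case False
      have ind: "P.indep_vars (\<lambda>_. borel) (\<lambda>i \<eta>. emeasure \<eta> (B (h i))) {..<card I}"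
      proof -
        have "disjoint_family_on (\<lambda>i. B (h i)) {..<card I}"
          unfolding disjoint_family_on_def
        proof (intro ballI impI)
          fix i j assume "i \<in> {..<card I}" "j \<in> {..<card I}" "i \<noteq> j"
          then show "B (h i) \<inter> B (h j) = {}"
            using hI bij_betw_imp_inj_on[OF h] 
            by (intro disjoint_family_onD[OF B(2)]) (auto dest: inj_onD)
        qed
        then show ?thesis using P B(1) hI unfolding is_poisson_pp_distr_def by simp
      qed
      have "emeasure (distr P (PiM I (\<lambda>_. borel)) (\<lambda>\<eta>. \<lambda>i\<in>I. emeasure \<eta> (B i))) (PiE I E)
          = emeasure P (\<Inter>i\<in>I. (\<lambda>\<eta>. emeasure \<eta> (B i)) -` E i \<inter> space P)"
      proof -
        have "(\<lambda>\<eta>. \<lambda>i\<in>I. emeasure \<eta> (B i)) -` PiE I E \<inter> space P = (\<Inter>i\<in>I. (\<lambda>\<eta>. emeasure \<eta> (B i)) -` E i \<inter> space P)"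
          using False by (auto simp: PiE_iff)
        then show ?thesis using emeasure_distr[OF V PE] by simp
      qed
      also have "(\<Inter>i\<in>I. (\<lambda>\<eta>. emeasure \<eta> (B i)) -` E i \<inter> space P) = (\<Inter>i\<in>{..<card I}. (\<lambda>\<eta>. emeasure \<eta> (B (h i))) -` E (h i) \<inter> space P)"
      proof -
        have "(\<Inter>i\<in>I. (\<lambda>\<eta>. emeasure \<eta> (B i)) -` E i \<inter> space P) = (\<Inter>i\<in>h ` {..<card I}. (\<lambda>\<eta>. emeasure \<eta> (B i)) -` E i \<inter> space P)"
          by (simp only: bij_betw_imp_surj_on[OF h])
        then show ?thesis by (simp only: image_image)
      qed
      also have "emeasure P \<dots> = ennreal (\<Prod>i<card I. P.prob ((\<lambda>\<eta>. emeasure \<eta> (B (h i))) -` E (h i) \<inter> space P))"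
        using False I hI E by (subst P.indep_varsD_finite[OF ind, symmetric]) (auto simp: P.emeasure_eq_measure card_eq_0_iff lessThan_empty_iff)
      also have "(\<Prod>i<card I. P.prob ((\<lambda>\<eta>. emeasure \<eta> (B (h i))) -` E (h i) \<inter> space P))
          = (\<Prod>i\<in>I. P.prob ((\<lambda>\<eta>. emeasure \<eta> (B i)) -` E i \<inter> space P))"
        by (rule prod.reindex_bij_betw[OF h])
      also have "\<dots> = (\<Prod>i\<in>I. measure (poisson_distr (emeasure \<Lambda> (B i))) (E i))"
        using marg by (intro prod.cong) auto
      also have "ennreal \<dots> = (\<Prod>i\<in>I. emeasure (poisson_distr (emeasure \<Lambda> (B i))) (E i))"
        by (simp add: prod_ennreal[symmetric] pp.M.emeasure_eq_measure)
      finally show ?thesis .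
    qed
  qed
qed

section \<open>Events depending on finitely many counts\<close>

definition atom :: "'a measure \<Rightarrow> 'a set set \<Rightarrow> 'a set set \<Rightarrow> 'a set" where
  "atom \<Lambda> \<F> J = {x\<in>space \<Lambda>. {B\<in>\<F>. x \<in> B} = J}"

text \<open>The pattern {} of the points in no member of \<F> is left out, because the complement of
  the union of \<F> may have infinite intensity. Every other atom lies inside a member of \<F>, and
  the members are unions of such atoms.\<close>

abbreviation atoms :: "'a set set \<Rightarrow> 'a set set set" where
  "atoms \<F> \<equiv> Pow \<F> - {{}}"

definition atom_counts :: "'a measure \<Rightarrow> 'a set set \<Rightarrow> 'a measure \<Rightarrow> 'a set set \<Rightarrow> ennreal" where
  "atom_counts \<Lambda> \<F> \<eta> = (\<lambda>J\<in>atoms \<F>. emeasure \<eta> (atom \<Lambda> \<F> J))"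

definition cylinders :: "'a measure \<Rightarrow> 'a set set \<Rightarrow> 'a measure set set" where
  "cylinders \<Lambda> \<F> = {atom_counts \<Lambda> \<F> -` E \<inter> point_patterns \<Lambda> | E. E \<in> sets (PiM (atoms \<F>) (\<lambda>_. borel))}"

lemma atom_sets:
  assumes "finite \<F>" "\<F> \<subseteq> sets \<Lambda>" "J \<in> atoms \<F>"
  shows "atom \<Lambda> \<F> J \<in> sets \<Lambda>"
proof -
  have "atom \<Lambda> \<F> J = (\<Inter>B\<in>J. B) - (\<Union>B\<in>\<F> - J. B)"
  proof (intro set_eqI iffI)
    fix x assume x: "x \<in> (\<Inter>B\<in>J. B) - (\<Union>B\<in>\<F> - J. B)"
    obtain C where "C \<in> J" "C \<in> \<F>" using assms(3) by auto
    then have "x \<in> space \<Lambda>" using x assms(2) sets.sets_into_space[of C \<Lambda>] by auto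
    moreover have "{B\<in>\<F>. x \<in> B} = J" using x assms(3) by auto
    ultimately show "x \<in> atom \<Lambda> \<F> J" by (simp add: atom_def)
  qed (auto simp: atom_def)
  moreover have "(\<Inter>B\<in>J. B) \<in> sets \<Lambda>"
    using assms by (intro sets.finite_INT) (auto intro: finite_subset)
  ultimately show ?thesis using assms by (auto intro!: sets.Diff sets.finite_UN)
qed

lemma disjoint_atoms: "disjoint_family_on (atom \<Lambda> \<F>) (atoms \<F>)"
  by (auto simp: disjoint_family_on_def atom_def)

lemma measurable_atom_counts:
  "finite \<F> \<Longrightarrow> \<F> \<subseteq> sets \<Lambda> \<Longrightarrow>
    atom_counts \<Lambda> \<F> \<in> measurable (point_pattern_space \<Lambda>) (PiM (atoms \<F>) (\<lambda>_. borel))"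
  unfolding atom_counts_def[abs_def] by (intro measurable_counts atom_sets)

lemma cylinders_subset_sets:
  "finite \<F> \<Longrightarrow> \<F> \<subseteq> sets \<Lambda> \<Longrightarrow> cylinders \<Lambda> \<F> \<subseteq> sets (point_pattern_space \<Lambda>)"
  using measurable_sets[OF measurable_atom_counts] by (auto simp: cylinders_def)

lemma cylinders_algebra:
  assumes "finite \<F>" "\<F> \<subseteq> sets \<Lambda>" "X \<in> cylinders \<Lambda> \<F>" "Y \<in> cylinders \<Lambda> \<F>"
  shows "X \<union> Y \<in> cylinders \<Lambda> \<F>" "X \<inter> Y \<in> cylinders \<Lambda> \<F>" "point_patterns \<Lambda> - X \<in> cylinders \<Lambda> \<F>"
proof -
  obtain E F where E: "E \<in> sets (PiM (atoms \<F>) (\<lambda>_. borel))" "X = atom_counts \<Lambda> \<F> -` E \<inter> point_patterns \<Lambda>"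
    and F: "F \<in> sets (PiM (atoms \<F>) (\<lambda>_. borel))" "Y = atom_counts \<Lambda> \<F> -` F \<inter> point_patterns \<Lambda>"
    using assms by (auto simp: cylinders_def)
  show "X \<union> Y \<in> cylinders \<Lambda> \<F>" unfolding cylinders_def using E F by (intro CollectI exI[of _ "E \<union> F"]) auto
  show "X \<inter> Y \<in> cylinders \<Lambda> \<F>" unfolding cylinders_def using E F by (intro CollectI exI[of _ "E \<inter> F"]) auto
  show "point_patterns \<Lambda> - X \<in> cylinders \<Lambda> \<F>"
    unfolding cylinders_def using E measurable_space[OF measurable_atom_counts[OF assms(1,2)]]
    by (intro CollectI exI[of _ "space (PiM (atoms \<F>) (\<lambda>_. borel)) - E"]) auto
qed

text \<open>An atom of \<F> is a finite disjoint union of atoms of \<G>, so the coarser counts are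
  sums of the finer ones.\<close>

lemma cylinders_mono:
  assumes fin: "finite \<G>" and sub: "\<F> \<subseteq> \<G>" and \<G>: "\<G> \<subseteq> sets \<Lambda>"
  shows "cylinders \<Lambda> \<F> \<subseteq> cylinders \<Lambda> \<G>"
proof
  fix X assume "X \<in> cylinders \<Lambda> \<F>"
  then obtain E where E: "E \<in> sets (PiM (atoms \<F>) (\<lambda>_. borel))" "X = atom_counts \<Lambda> \<F> -` E \<inter> point_patterns \<Lambda>"
    by (auto simp: cylinders_def)
  \<comment> \<open>The patterns over \<G> that restrict to J. As J is nonempty, the excluded empty
    pattern is not among those required.\<close>
  define R where "R J = {J'\<in>atoms \<G>. J' \<inter> \<F> = J}" for J
  define \<phi> where "\<phi> v = (\<lambda>J\<in>atoms \<F>. \<Sum>J'\<in>R J. v J')" for v :: "'a set set \<Rightarrow> ennreal"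
  have \<phi>: "\<phi> \<in> measurable (PiM (atoms \<G>) (\<lambda>_. borel)) (PiM (atoms \<F>) (\<lambda>_. borel))"
    unfolding \<phi>_def by (intro measurable_restrict borel_measurable_sum) (auto simp: R_def)
  have finR: "finite (R J)" for J using fin by (auto simp: R_def)
  have at: "atom \<Lambda> \<F> J = (\<Union>J'\<in>R J. atom \<Lambda> \<G> J')" if "J \<in> atoms \<F>" for J
  proof (rule set_eqI)
    fix x
    have "{B\<in>\<G>. x \<in> B} \<inter> \<F> = {B\<in>\<F>. x \<in> B}" using sub by auto
    then have "{B\<in>\<G>. x \<in> B} \<in> R J \<longleftrightarrow> {B\<in>\<F>. x \<in> B} = J" using that by (auto simp: R_def)
    then show "x \<in> atom \<Lambda> \<F> J \<longleftrightarrow> x \<in> (\<Union>J'\<in>R J. atom \<Lambda> \<G> J')" by (auto simp: atom_def)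
  qed
  have eq: "atom_counts \<Lambda> \<F> \<eta> = \<phi> (atom_counts \<Lambda> \<G> \<eta>)" if \<eta>: "\<eta> \<in> point_patterns \<Lambda>" for \<eta>
  proof
    fix J
    show "atom_counts \<Lambda> \<F> \<eta> J = \<phi> (atom_counts \<Lambda> \<G> \<eta>) J"
    proof (cases "J \<in> atoms \<F>")
      case True
      have "emeasure \<eta> (\<Union>J'\<in>R J. atom \<Lambda> \<G> J') = (\<Sum>J'\<in>R J. emeasure \<eta> (atom \<Lambda> \<G> J'))"
      proof (rule sum_emeasure[symmetric])
        show "atom \<Lambda> \<G> ` R J \<subseteq> sets \<eta>"
          using atom_sets[OF fin \<G>] by (auto simp: R_def sets_point_pattern[OF \<eta>])
        show "disjoint_family_on (atom \<Lambda> \<G>) (R J)"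
          by (auto simp: disjoint_family_on_def atom_def)
      qed (rule finR)
      then show ?thesis using True by (simp add: atom_counts_def \<phi>_def at[OF True]) (auto simp: R_def intro!: sum.cong)
    next
      case False
      then show ?thesis by (simp only: atom_counts_def \<phi>_def restrict_apply if_False)
    qed
  qed
  show "X \<in> cylinders \<Lambda> \<G>"
    unfolding cylinders_def
  proof (intro CollectI exI conjI)
    show "\<phi> -` E \<inter> space (PiM (atoms \<G>) (\<lambda>_. borel)) \<in> sets (PiM (atoms \<G>) (\<lambda>_. borel))"
      by (rule measurable_sets[OF \<phi> E(1)])
    show "X = atom_counts \<Lambda> \<G> -` (\<phi> -` E \<inter> space (PiM (atoms \<G>) (\<lambda>_. borel))) \<inter> point_patterns \<Lambda>"
      using measurable_space[OF measurable_atom_counts[OF fin \<G>]] by (auto simp: E(2) eq)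
  qed
qed

lemma count_in_cylinders:
  assumes "B \<in> sets \<Lambda>" "E \<in> sets borel"
  shows "{\<eta>\<in>point_patterns \<Lambda>. emeasure \<eta> B \<in> E} \<in> cylinders \<Lambda> {B}"
  unfolding cylinders_def
proof (intro CollectI exI conjI)
  have "atom \<Lambda> {B} {B} = B" using assms(1) sets.sets_into_space by (auto simp: atom_def)
  then show "{\<eta>\<in>point_patterns \<Lambda>. emeasure \<eta> B \<in> E} = atom_counts \<Lambda> {B} -` {v\<in>space (PiM (atoms {B}) (\<lambda>_. borel)). v {B} \<in> E} \<inter> point_patterns \<Lambda>"
    by (auto simp: atom_counts_def space_PiM)
  show "{v\<in>space (PiM (atoms {B}) (\<lambda>_. borel)). v {B} \<in> E} \<in> sets (PiM (atoms {B}) (\<lambda>_. borel))"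
    using assms(2) by measurable
qed

text \<open>The union is directed, as refining \<F> enlarges its cylinders, so finitely many events
  always share one family. \<R> will be all measurable sets for uniqueness and those of finite
  intensity for the divergence.\<close>

definition cylinder_algebra :: "'a measure \<Rightarrow> 'a set set \<Rightarrow> 'a measure set set" where
  "cylinder_algebra \<Lambda> \<R> = (\<Union>\<F>\<in>{\<F>. finite \<F> \<and> \<F> \<subseteq> \<R>}. cylinders \<Lambda> \<F>)"

lemma cylinder_algebra_common:
  fixes n :: nat
  assumes \<R>: "\<R> \<subseteq> sets \<Lambda>" and B: "\<And>i. i < n \<Longrightarrow> B i \<in> cylinder_algebra \<Lambda> \<R>"
  shows "\<exists>\<F>. finite \<F> \<and> \<F> \<subseteq> \<R> \<and> (\<forall>i<n. B i \<in> cylinders \<Lambda> \<F>)"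
  using B
proof (induction n)
  case (Suc n)
  then obtain \<F> where \<F>: "finite \<F>" "\<F> \<subseteq> \<R>" "\<And>i. i < n \<Longrightarrow> B i \<in> cylinders \<Lambda> \<F>" by auto
  obtain \<G> where \<G>: "finite \<G>" "\<G> \<subseteq> \<R>" "B n \<in> cylinders \<Lambda> \<G>"
    using Suc.prems[of n] by (auto simp: cylinder_algebra_def)
  have "cylinders \<Lambda> \<F> \<subseteq> cylinders \<Lambda> (\<F> \<union> \<G>)" "cylinders \<Lambda> \<G> \<subseteq> cylinders \<Lambda> (\<F> \<union> \<G>)"
    using \<F> \<G> \<R> by (auto intro!: cylinders_mono del: subsetI)
  then show ?case using \<F> \<G> by (intro exI[of _ "\<F> \<union> \<G>"]) (auto simp: less_Suc_eq)
qed auto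

lemma algebra_cylinder_algebra:
  assumes "\<R> \<subseteq> sets \<Lambda>"
  shows "algebra (point_patterns \<Lambda>) (cylinder_algebra \<Lambda> \<R>)"
  unfolding algebra_iff_Un
proof (intro conjI ballI)
  show "cylinder_algebra \<Lambda> \<R> \<subseteq> Pow (point_patterns \<Lambda>)"
    by (auto simp: cylinder_algebra_def cylinders_def)
  show "{} \<in> cylinder_algebra \<Lambda> \<R>"
    by (auto simp: cylinder_algebra_def cylinders_def intro!: exI[of _ "{}"])
  fix X assume X: "X \<in> cylinder_algebra \<Lambda> \<R>"
  then obtain \<F> where "finite \<F>" "\<F> \<subseteq> \<R>" "X \<in> cylinders \<Lambda> \<F>"
    by (auto simp: cylinder_algebra_def)
  then show "point_patterns \<Lambda> - X \<in> cylinder_algebra \<Lambda> \<R>"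
    using cylinders_algebra(3)[of \<F> \<Lambda> X X] assms by (auto simp: cylinder_algebra_def)
  fix Y assume Y: "Y \<in> cylinder_algebra \<Lambda> \<R>"
  have "\<exists>\<F>. finite \<F> \<and> \<F> \<subseteq> \<R> \<and> (\<forall>i<2. (if i = (0 :: nat) then X else Y) \<in> cylinders \<Lambda> \<F>)"
    by (rule cylinder_algebra_common[OF assms]) (use X Y in auto)
  then obtain \<F> where "finite \<F>" "\<F> \<subseteq> \<R>"
    and *: "\<And>i. i < 2 \<Longrightarrow> (if i = (0 :: nat) then X else Y) \<in> cylinders \<Lambda> \<F>" by blast
  moreover have "X \<in> cylinders \<Lambda> \<F>" "Y \<in> cylinders \<Lambda> \<F>" using *[of 0] *[of 1] by auto
  ultimately show "X \<union> Y \<in> cylinder_algebra \<Lambda> \<R>"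
    using cylinders_algebra(1)[of \<F> \<Lambda> X Y] assms by (auto simp: cylinder_algebra_def)
qed

lemma cylinder_algebra_subset_sets:
  "\<R> \<subseteq> sets \<Lambda> \<Longrightarrow> cylinder_algebra \<Lambda> \<R> \<subseteq> sets (point_pattern_space \<Lambda>)"
  using cylinders_subset_sets[of _ \<Lambda>] by (fastforce simp: cylinder_algebra_def)

text \<open>B itself may be too large to belong to \<R>; its count is the increasing limit of the
  counts of \<open>B \<inter> S k\<close>.\<close>

lemma sets_subset_sigma_cylinder_algebra:
  assumes \<R>: "\<R> \<subseteq> sets \<Lambda>" and S: "range S \<subseteq> sets \<Lambda>" "incseq S" "(\<Union>k :: nat. S k) = space \<Lambda>"
    and B\<R>: "\<And>B k. B \<in> sets \<Lambda> \<Longrightarrow> B \<inter> S k \<in> \<R>"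
  shows "sets (point_pattern_space \<Lambda>) \<subseteq> sigma_sets (point_patterns \<Lambda>) (cylinder_algebra \<Lambda> \<R>)"
proof -
  define N where "N = sigma (point_patterns \<Lambda>) (cylinder_algebra \<Lambda> \<R>)"
  have sub: "cylinder_algebra \<Lambda> \<R> \<subseteq> Pow (point_patterns \<Lambda>)"
    by (auto simp: cylinder_algebra_def cylinders_def)
  have N: "space N = point_patterns \<Lambda>" "sets N = sigma_sets (point_patterns \<Lambda>) (cylinder_algebra \<Lambda> \<R>)"
    using sub by (simp_all add: N_def)
  have "(\<lambda>\<eta>. \<eta>) \<in> measurable N (point_pattern_space \<Lambda>)"
  proof (rule measurable_point_pattern_spaceI)
    fix B assume B: "B \<in> sets \<Lambda>"
    have "(\<lambda>\<eta>. SUP k. emeasure \<eta> (B \<inter> S k)) \<in> borel_measurable N"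
    proof (intro borel_measurable_SUP measurableI)
      fix k and E :: "ennreal set" assume E: "E \<in> sets borel"
      have "{\<eta>\<in>point_patterns \<Lambda>. emeasure \<eta> (B \<inter> S k) \<in> E} \<in> cylinder_algebra \<Lambda> \<R>"
        using count_in_cylinders[of "B \<inter> S k" \<Lambda> E] E B\<R>[OF B, of k] \<R> by (auto simp: cylinder_algebra_def)
      then show "(\<lambda>\<eta>. emeasure \<eta> (B \<inter> S k)) -` E \<inter> space N \<in> sets N"
        by (auto simp: N vimage_def Int_def conj_commute intro: sigma_sets.Basic)
    qed auto
    then show "(\<lambda>\<eta>. emeasure \<eta> B) \<in> borel_measurable N"
    proof (rule measurable_cong[THEN iffD1, rotated])
      fix \<eta> assume "\<eta> \<in> space N"
      then have \<eta>: "sets \<eta> = sets \<Lambda>" by (simp add: N sets_point_pattern)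
      have "(SUP k. emeasure \<eta> (B \<inter> S k)) = emeasure \<eta> (\<Union>k. B \<inter> S k)"
        using S(1,2) B by (intro SUP_emeasure_incseq) (auto simp: \<eta> incseq_def)
      also have "(\<Union>k. B \<inter> S k) = B" using S(3) sets.sets_into_space[OF B] by auto
      finally show "(SUP k. emeasure \<eta> (B \<inter> S k)) = emeasure \<eta> B" .
    qed
  qed (simp add: N)
  from measurable_sets[OF this] show ?thesis
    using sets.sets_into_space[of _ "point_pattern_space \<Lambda>"]
    by (auto simp: N) (metis Int_absorb2 vimage_ident)
qed

text \<open>Atoms are disjoint, so their counts have a prescribed product law. Two solutions
  therefore agree on the cylinder algebra, which is stable under intersections and
  generates.\<close>

lemma is_poisson_pp_distr_unique:
  assumes P: "is_poisson_pp_distr \<Lambda> P" and Q: "is_poisson_pp_distr \<Lambda> Q"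
  shows "P = Q"
proof -
  interpret P: prob_space P using P by (simp add: is_poisson_pp_distr_def)
  interpret A: algebra "point_patterns \<Lambda>" "cylinder_algebra \<Lambda> (sets \<Lambda>)"
    by (rule algebra_cylinder_algebra) simp
  have stable: "Int_stable (cylinder_algebra \<Lambda> (sets \<Lambda>))" unfolding Int_stable_def by (intro ballI A.Int)
  have sub: "cylinder_algebra \<Lambda> (sets \<Lambda>) \<subseteq> Pow (point_patterns \<Lambda>)" by (rule A.space_closed)
  have gen: "sets (point_pattern_space \<Lambda>) = sigma_sets (point_patterns \<Lambda>) (cylinder_algebra \<Lambda> (sets \<Lambda>))"
  proof (rule antisym)
    show "sets (point_pattern_space \<Lambda>) \<subseteq> sigma_sets (point_patterns \<Lambda>) (cylinder_algebra \<Lambda> (sets \<Lambda>))"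
      by (rule sets_subset_sigma_cylinder_algebra[where S = "\<lambda>_. space \<Lambda>"])
        (simp_all add: incseq_def sets.Int)
    show "sigma_sets (point_patterns \<Lambda>) (cylinder_algebra \<Lambda> (sets \<Lambda>)) \<subseteq> sets (point_pattern_space \<Lambda>)"
      using sets.sigma_sets_subset[OF cylinder_algebra_subset_sets[OF subset_refl]]
      by (simp only: space_point_pattern_space)
  qed
  have sPQ: "sets P = sigma_sets (point_patterns \<Lambda>) (cylinder_algebra \<Lambda> (sets \<Lambda>))"
    "sets Q = sigma_sets (point_patterns \<Lambda>) (cylinder_algebra \<Lambda> (sets \<Lambda>))"
    unfolding gen[symmetric] by (rule is_poisson_pp_distr_sets[OF P] is_poisson_pp_distr_sets[OF Q])+
  have eq: "emeasure P X = emeasure Q X" if "X \<in> cylinder_algebra \<Lambda> (sets \<Lambda>)" for X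
  proof -
    from that obtain \<F> E where \<F>: "finite \<F>" "\<F> \<subseteq> sets \<Lambda>" and E: "E \<in> sets (PiM (atoms \<F>) (\<lambda>_. borel))"
      and X: "X = atom_counts \<Lambda> \<F> -` E \<inter> point_patterns \<Lambda>"
      unfolding cylinder_algebra_def cylinders_def by blast
    have *: "emeasure M X = emeasure (PiM (atoms \<F>) (\<lambda>J. poisson_distr (emeasure \<Lambda> (atom \<Lambda> \<F> J)))) E"
      if M: "is_poisson_pp_distr \<Lambda> M" for M
    proof -
      have meas: "atom_counts \<Lambda> \<F> \<in> measurable M (PiM (atoms \<F>) (\<lambda>_. borel))"
        using measurable_atom_counts[OF \<F>] by (simp add: measurable_cong_sets[OF is_poisson_pp_distr_sets[OF M] refl])
      have "emeasure M X = emeasure (distr M (PiM (atoms \<F>) (\<lambda>_. borel)) (atom_counts \<Lambda> \<F>)) E"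
        by (simp add: emeasure_distr[OF meas E] X is_poisson_pp_distr_space[OF M])
      also have "distr M (PiM (atoms \<F>) (\<lambda>_. borel)) (atom_counts \<Lambda> \<F>) = PiM (atoms \<F>) (\<lambda>J. poisson_distr (emeasure \<Lambda> (atom \<Lambda> \<F> J)))"
        unfolding atom_counts_def[abs_def]
        using \<F> by (intro distr_counts[OF M] atom_sets disjoint_atoms) auto
      finally show ?thesis .
    qed
    show ?thesis using *[OF P] *[OF Q] by simp
  qed
  show ?thesis
  proof (rule measure_eqI_generator_eq[OF stable sub eq sPQ])
    show "range (\<lambda>_ :: nat. point_patterns \<Lambda>) \<subseteq> cylinder_algebra \<Lambda> (sets \<Lambda>)" by auto
    show "(\<Union>i :: nat. point_patterns \<Lambda>) = point_patterns \<Lambda>" by simp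
    show "emeasure P (point_patterns \<Lambda>) \<noteq> \<infinity>" by simp
  qed
qed

lemma is_poisson_poisson_pp_distr:
  assumes "range A \<subseteq> sets \<Lambda>" "disjoint_family A" "(\<Union>n. A n) = space \<Lambda>"
    and "\<And>n :: nat. emeasure \<Lambda> (A n) < \<infinity>"
  shows "is_poisson_pp_distr \<Lambda> (poisson_pp_distr \<Lambda>)"
  unfolding poisson_pp_distr_def
proof (rule theI')
  show "\<exists>!P. is_poisson_pp_distr \<Lambda> P"
    using ex_poisson_pp_distr[OF assms] by (rule ex_ex1I) (rule is_poisson_pp_distr_unique)
qed

text \<open>The pushforwards under the counts are Poisson vectors, for which the divergence has been
  computed.\<close>

lemma partition_div_counts:
  assumes "0 < \<alpha>" and P: "is_poisson_pp_distr \<Lambda> P" and Q: "is_poisson_pp_distr \<Lambda>' Q" and sets: "sets \<Lambda>' = sets \<Lambda>"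
    and I: "finite I" and B: "\<And>i. i \<in> I \<Longrightarrow> B i \<in> sets \<Lambda> \<and> emeasure \<Lambda> (B i) < \<infinity> \<and> emeasure \<Lambda>' (B i) < \<infinity>" "disjoint_family_on B I"
  shows "partition_div \<alpha> {(\<lambda>\<eta>. \<lambda>i\<in>I. emeasure \<eta> (B i)) -` E \<inter> point_patterns \<Lambda> | E. E \<in> sets (PiM I (\<lambda>_. borel))} P Q
    = tsallis_of_renyi \<alpha> (\<Sum>i\<in>I. tsallis_fun \<alpha> (measure \<Lambda> (B i)) (measure \<Lambda>' (B i)))"
proof -
  interpret V: poisson_vector_pair I "\<lambda>i. measure \<Lambda> (B i)" "\<lambda>i. measure \<Lambda>' (B i)"
    by standard (use I in auto)
  let ?f = "\<lambda>\<eta>. \<lambda>i\<in>I. emeasure \<eta> (B i)" and ?N = "PiM I (\<lambda>_. borel :: ennreal measure)"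
  have law: "distr M ?N ?f = PiM I (\<lambda>i. poisson_distr (ennreal (measure M' (B i))))"
    if "is_poisson_pp_distr M' M" "sets M' = sets \<Lambda>" "\<And>i. i \<in> I \<Longrightarrow> emeasure M' (B i) < \<infinity>" for M M'
  proof -
    have "distr M ?N ?f = PiM I (\<lambda>i. poisson_distr (emeasure M' (B i)))"
      using that B by (intro distr_counts I) auto
    also have "\<dots> = PiM I (\<lambda>i. poisson_distr (ennreal (measure M' (B i))))"
      using that(3) by (intro PiM_cong refl, subst emeasure_eq_ennreal_measure) (auto simp: less_top)
    finally show ?thesis .
  qed
  have PQ: "sets Q = sets P"
    using is_poisson_pp_distr_sets[OF P] is_poisson_pp_distr_sets[OF Q] point_pattern_space_cong[OF sets] by simp
  have meas: "?f \<in> measurable P ?N"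
    using measurable_counts[of I B \<Lambda>] B by (simp add: measurable_cong_sets[OF is_poisson_pp_distr_sets[OF P] refl])
  have "partition_div \<alpha> (sets ?N) (distr P ?N ?f) (distr Q ?N ?f) = partition_div \<alpha> {?f -` E \<inter> space P | E. E \<in> sets ?N} P Q"
    by (rule partition_div_distr[OF meas PQ])
  moreover have "distr P ?N ?f = V.A.law" "distr Q ?N ?f = V.B.law"
    using law[OF P refl] law[OF Q sets] B by (simp_all add: V.A.law_def V.B.law_def)
  ultimately show ?thesis
    using V.partition_div_law[OF assms(1)] V.A.sets_law by (simp add: is_poisson_pp_distr_space[OF P])
qed

text \<open>Upper bound: finitely many cylinder events depend on the counts of disjoint atoms of
  finite intensity, and the Tsallis terms of these atoms form one partition sum of the intensities.
  Lower bound: every finite disjoint family of sets of finite intensity gives, through its counts, a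
  smaller family of events whose divergence is known.\<close>

theorem partition_div_poisson:
  assumes "0 < \<alpha>" and P: "is_poisson_pp_distr \<Lambda> P" and Q: "is_poisson_pp_distr \<Lambda>' Q" and sets: "sets \<Lambda>' = sets \<Lambda>"
    and S: "cofinite_cover \<Lambda> \<Lambda>' S"
  shows "partition_div \<alpha> (sets P) P Q
    = tsallis_of_renyi \<alpha> (partition_div \<alpha> {B\<in>sets \<Lambda>. emeasure \<Lambda> B < \<infinity> \<and> emeasure \<Lambda>' B < \<infinity>} \<Lambda> \<Lambda>')"
    (is "_ = tsallis_of_renyi \<alpha> (partition_div \<alpha> ?R \<Lambda> \<Lambda>')")
proof (rule antisym)
  interpret P: prob_space P using P by (simp add: is_poisson_pp_distr_def)
  interpret Q: prob_space Q using Q by (simp add: is_poisson_pp_distr_def)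
  note Ps = is_poisson_pp_distr_sets[OF P] and Psp = is_poisson_pp_distr_space[OF P]
  have PQ: "sets Q = sets P"
    using Ps is_poisson_pp_distr_sets[OF Q] point_pattern_space_cong[OF sets] by simp
  have alg: "algebra (space P) (cylinder_algebra \<Lambda> ?R)"
    unfolding Psp by (rule algebra_cylinder_algebra) auto
  have sub: "cylinder_algebra \<Lambda> ?R \<subseteq> sets P"
    unfolding Ps by (rule cylinder_algebra_subset_sets) auto
  have gen: "sets P \<subseteq> sigma_sets (space P) (cylinder_algebra \<Lambda> ?R)"
    unfolding Ps Psp
  proof (rule sets_subset_sigma_cylinder_algebra[where S = S])
    fix B k assume B: "B \<in> sets \<Lambda>"
    have "emeasure \<Lambda> (B \<inter> S k) \<le> emeasure \<Lambda> (S k)" "emeasure \<Lambda>' (B \<inter> S k) \<le> emeasure \<Lambda>' (S k)"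
      using S B sets by (auto intro!: emeasure_mono simp: cofinite_cover_def)
    then show "B \<inter> S k \<in> ?R"
      using S B by (auto simp: cofinite_cover_def intro: le_less_trans)
  qed (use S in \<open>auto simp: cofinite_cover_def\<close>)
  note fin = P.finite_measure_axioms Q.finite_measure_axioms
  have app: "approximable (cylinder_algebra \<Lambda> ?R) P Q A" if "A \<in> sets P" for A
    by (rule approximable_sigma_sets[OF fin PQ alg sub sub sigma_algebra_approximable subsetD[OF gen that]])
  have "partition_div \<alpha> (sets P) P Q = partition_div \<alpha> (cylinder_algebra \<Lambda> ?R) P Q"
    by (rule partition_div_algebra[symmetric, OF assms(1) fin PQ alg sub app])
  also have "\<dots> \<le> tsallis_of_renyi \<alpha> (partition_div \<alpha> ?R \<Lambda> \<Lambda>')"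
  proof (rule partition_div_least)
    fix n :: nat and B
    assume B: "\<And>i. i < n \<Longrightarrow> B i \<in> cylinder_algebra \<Lambda> ?R" "disjoint_family_on B {..<n}"
    obtain \<F> where \<F>: "finite \<F>" "\<F> \<subseteq> ?R" "\<And>i. i < n \<Longrightarrow> B i \<in> cylinders \<Lambda> \<F>"
      using cylinder_algebra_common[of ?R \<Lambda> n B] B(1) by auto
    \<comment> \<open>A nonempty pattern places its atom inside some C in \<F>, whose finite
      intensities it inherits.\<close>
    have at: "atom \<Lambda> \<F> J \<in> ?R" if J: "J \<in> atoms \<F>" for J
    proof -
      obtain C where "C \<in> J" "C \<in> \<F>" using J by auto
      moreover from this have "atom \<Lambda> \<F> J \<subseteq> C" by (auto simp: atom_def)
      moreover have "atom \<Lambda> \<F> J \<in> sets \<Lambda>" using \<F> J by (intro atom_sets) auto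
      moreover have "C \<in> ?R" using \<open>C \<in> \<F>\<close> \<F> by auto
      ultimately show ?thesis
        using emeasure_mono[of "atom \<Lambda> \<F> J" C \<Lambda>] emeasure_mono[of "atom \<Lambda> \<F> J" C \<Lambda>'] sets
        by (auto intro: le_less_trans)
    qed
    have "(\<Sum>i<n. tsallis_fun \<alpha> (measure P (B i)) (measure Q (B i))) \<le> partition_div \<alpha> (cylinders \<Lambda> \<F>) P Q"
      using \<F>(3) B(2) by (rule partition_div_upper)
    also have "\<dots> = tsallis_of_renyi \<alpha> (\<Sum>J\<in>atoms \<F>. tsallis_fun \<alpha> (measure \<Lambda> (atom \<Lambda> \<F> J)) (measure \<Lambda>' (atom \<Lambda> \<F> J)))"
      unfolding cylinders_def atom_counts_def[abs_def]
      using \<F>(1) at disjoint_atoms by (intro partition_div_counts[OF assms(1) P Q sets]) auto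
    also have "\<dots> \<le> tsallis_of_renyi \<alpha> (partition_div \<alpha> ?R \<Lambda> \<Lambda>')"
      using \<F>(1) at disjoint_atoms by (intro tsallis_of_renyi_mono partition_div_upper_finite) auto
    finally show "(\<Sum>i<n. tsallis_fun \<alpha> (measure P (B i)) (measure Q (B i))) \<le> \<dots>" .
  qed
  finally show "partition_div \<alpha> (sets P) P Q \<le> tsallis_of_renyi \<alpha> (partition_div \<alpha> ?R \<Lambda> \<Lambda>')" .
  show "tsallis_of_renyi \<alpha> (partition_div \<alpha> ?R \<Lambda> \<Lambda>') \<le> partition_div \<alpha> (sets P) P Q"
    unfolding partition_div_def[of _ ?R]
  proof (rule tsallis_of_renyi_SUP_le, clarify)
    fix n :: nat and B
    assume B: "\<forall>i<n. B i \<in> ?R" "disjoint_family_on B {..<n}"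
    have "tsallis_of_renyi \<alpha> (\<Sum>i<n. tsallis_fun \<alpha> (measure \<Lambda> (B i)) (measure \<Lambda>' (B i)))
      = partition_div \<alpha> {(\<lambda>\<eta>. \<lambda>i\<in>{..<n}. emeasure \<eta> (B i)) -` E \<inter> point_patterns \<Lambda> | E. E \<in> sets (PiM {..<n} (\<lambda>_. borel))} P Q"
      using B by (intro partition_div_counts[OF assms(1) P Q sets, symmetric]) auto
    also have "\<dots> \<le> partition_div \<alpha> (sets P) P Q"
      using measurable_sets[OF measurable_counts[of "{..<n}" B \<Lambda>]] B(1)
      by (intro partition_div_mono) (auto simp: Ps)
    finally show "tsallis_of_renyi \<alpha> (\<Sum>i<n. tsallis_fun \<alpha> (measure \<Lambda> (B i)) (measure \<Lambda>' (B i))) \<le> partition_div \<alpha> (sets P) P Q" .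
  qed
qed

section \<open>Compound Poisson paths\<close>

abbreviation jump_space :: "(real \<times> 'a :: euclidean_space) measure" where
  "jump_space \<equiv> time_axis \<Otimes>\<^sub>M borel"

lemma space_jump_space: "space (jump_space :: (real \<times> 'a :: euclidean_space) measure) = {0..} \<times> UNIV"
  by (simp add: space_pair_measure)

lemma time_interval_sets: "{0..t} \<in> sets time_axis" "0 \<le> s \<Longrightarrow> {s<..t} \<in> sets time_axis"
  by (auto simp: sets_restrict_space_iff)

lemma jump_sets: "U \<in> sets borel \<Longrightarrow> {0..t} \<times> U \<in> sets jump_space"
  "0 \<le> s \<Longrightarrow> U \<in> sets borel \<Longrightarrow> {s<..t} \<times> U \<in> sets jump_space"
  by (auto intro!: pair_measureI time_interval_sets)

lemma measurable_nn_integral_point_pattern: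
  assumes f: "f \<in> borel_measurable S"
  shows "(\<lambda>\<eta>. \<integral>\<^sup>+z. f z \<partial>\<eta>) \<in> borel_measurable (point_pattern_space S)"
  using f
proof induct
  case (cong f g)
  have "(\<integral>\<^sup>+z. f z \<partial>\<eta>) = (\<integral>\<^sup>+z. g z \<partial>\<eta>)" if "\<eta> \<in> space (point_pattern_space S)" for \<eta>
    using that cong(3) by (intro nn_integral_cong) (simp add: space_point_pattern)
  then show ?case using cong(4) by (subst measurable_cong) auto
next
  case (set B)
  then have "(\<lambda>\<eta>. emeasure \<eta> B) \<in> borel_measurable (point_pattern_space S)" by measurable
  then show ?case
    by (rule measurable_cong[THEN iffD1, rotated]) (use set in \<open>simp add: sets_point_pattern\<close>)
next
  case (mult u c)
  then have "(\<lambda>\<eta>. c * (\<integral>\<^sup>+z. u z \<partial>\<eta>)) \<in> borel_measurable (point_pattern_space S)" by measurable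
  then show ?case
    by (rule measurable_cong[THEN iffD1, rotated])
      (use mult in \<open>simp add: nn_integral_cmult measurable_cong_sets[OF sets_point_pattern refl]\<close>)
next
  case (add u v)
  then have "(\<lambda>\<eta>. (\<integral>\<^sup>+z. v z \<partial>\<eta>) + (\<integral>\<^sup>+z. u z \<partial>\<eta>)) \<in> borel_measurable (point_pattern_space S)" by measurable
  then show ?case
    by (rule measurable_cong[THEN iffD1, rotated])
      (use add in \<open>simp add: nn_integral_add measurable_cong_sets[OF sets_point_pattern refl]\<close>)
next
  case (seq U)
  then have "(\<lambda>\<eta>. SUP i. (\<integral>\<^sup>+z. U i z \<partial>\<eta>)) \<in> borel_measurable (point_pattern_space S)" by measurable
  then show ?case
  proof (rule measurable_cong[THEN iffD1, rotated])
    fix \<eta> assume "\<eta> \<in> space (point_pattern_space S)"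
    then show "(SUP i. (\<integral>\<^sup>+z. U i z \<partial>\<eta>)) = (\<integral>\<^sup>+z. (SUP i. U i) z \<partial>\<eta>)"
      using seq unfolding SUP_apply
      by (intro nn_integral_monotone_convergence_SUP[symmetric])
        (auto simp: measurable_cong_sets[OF sets_point_pattern refl])
  qed
qed

section \<open>From point patterns to step paths\<close>

definition locally_finite :: "(real \<times> 'a) measure \<Rightarrow> bool" where
  "locally_finite \<eta> \<longleftrightarrow> (\<forall>t\<ge>0. emeasure \<eta> ({0..t} \<times> UNIV) < \<infinity>)"

lemma locally_finite_iff_nat:
  assumes "\<eta> \<in> point_patterns (jump_space :: (real \<times> 'a :: euclidean_space) measure)"
  shows "locally_finite \<eta> \<longleftrightarrow> (\<forall>n :: nat. emeasure \<eta> ({0..real n} \<times> UNIV) < \<infinity>)"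
  unfolding locally_finite_def
proof safe
  fix t :: real assume fin: "\<forall>n :: nat. emeasure \<eta> ({0..real n} \<times> UNIV) < \<infinity>" and "0 \<le> t"
  obtain n :: nat where "t \<le> real n" using real_arch_simple by blast
  then have "emeasure \<eta> ({0..t} \<times> UNIV) \<le> emeasure \<eta> ({0..real n} \<times> UNIV)"
    using assms by (intro emeasure_mono) (auto simp: sets_point_pattern jump_sets)
  then show "emeasure \<eta> ({0..t} \<times> UNIV) < \<infinity>" using fin le_less_trans by blast
qed auto

text \<open>Integer values force bounded jumps: the parts of A with jump norm above n decrease to
  the empty set, and a count below 1 is 0.\<close>

lemma point_pattern_set_integrable_snd:
  fixes \<eta> :: "(real \<times> 'a :: euclidean_space) measure"
  assumes \<eta>: "\<eta> \<in> point_patterns jump_space" and A: "A \<in> sets jump_space" "emeasure \<eta> A < \<infinity>"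
  shows "set_integrable \<eta> A snd"
proof -
  note sets = sets_point_pattern[OF \<eta>]
  have snd [measurable]: "snd \<in> borel_measurable \<eta>"
    by (simp add: measurable_cong_sets[OF sets refl])
  have [measurable]: "A \<in> sets \<eta>" using A sets by simp
  define D where "D n = {z\<in>space \<eta>. z \<in> A \<and> real n < norm (snd z)}" for n
  have D: "D n \<in> sets \<eta>" for n unfolding D_def by measurable
  have "(\<lambda>n. emeasure \<eta> (D n)) \<longlonglongrightarrow> emeasure \<eta> (\<Inter>n. D n)"
  proof (rule Lim_emeasure_decseq)
    show "emeasure \<eta> (D n) \<noteq> \<infinity>" for n
    proof -
      have "D n \<subseteq> A" by (auto simp: D_def)
      then have "emeasure \<eta> (D n) \<le> emeasure \<eta> A" by (rule emeasure_mono) simp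
      then show ?thesis using A(2) by (auto simp: top_unique)
    qed
    show "decseq D" by (auto simp: decseq_def D_def)
  qed (use D in auto)
  moreover have "(\<Inter>n. D n) = {}"
  proof -
    have "\<exists>n. \<not> real n < norm (snd z)" for z :: "real \<times> 'a"
      using real_arch_simple[of "norm (snd z)"] by (auto simp: not_less)
    then show ?thesis by (auto simp: D_def)
  qed
  ultimately have "(\<lambda>n. emeasure \<eta> (D n)) \<longlonglongrightarrow> 0" by simp
  then have "\<forall>\<^sub>F n in sequentially. emeasure \<eta> (D n) < 1"
    by (rule order_tendstoD) simp
  then obtain n where n: "emeasure \<eta> (D n) < 1" by (auto simp: eventually_sequentially)
  obtain k :: nat where "emeasure \<eta> (D n) = of_nat k"
    using point_pattern_nat_valued[OF \<eta>, of "D n"] D sets n by auto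
  with n have "emeasure \<eta> (D n) = 0"
    by (cases k) auto
  then have "AE z in \<eta>. z \<notin> D n" using D by (intro AE_not_in) auto
  then have "AE z in \<eta>. z \<in> A \<longrightarrow> norm (snd z) \<le> real n"
    using AE_space by eventually_elim (auto simp: D_def)
  then show ?thesis
    unfolding set_integrable_def using A by (intro integrableI_bounded_set_indicator) auto
qed

lemma compound_path_eq:
  "locally_finite \<eta> \<Longrightarrow> 0 \<le> t \<Longrightarrow> compound_path \<eta> t = (LINT z:{0..t} \<times> UNIV|\<eta>. snd z)"
  by (simp add: compound_path_def locally_finite_def)

lemma compound_path_not_locally_finite:
  "\<not> locally_finite \<eta> \<Longrightarrow> compound_path \<eta> = (\<lambda>t\<in>{0..}. 0)"
  unfolding compound_path_def locally_finite_def by (rule if_not_P)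

lemma compound_path_extensional: "compound_path \<eta> \<in> extensional {0..}"
  by (simp add: compound_path_def)

lemma strip_sets:
  fixes \<eta> :: "(real \<times> 'a :: euclidean_space) measure"
  assumes "\<eta> \<in> point_patterns jump_space"
  shows "{0..t} \<times> UNIV \<in> sets \<eta>" "0 \<le> s \<Longrightarrow> {s<..t} \<times> UNIV \<in> sets \<eta>"
  using jump_sets[where U = "UNIV :: 'a set"] assms by (auto simp: sets_point_pattern)

lemma strip_finite:
  fixes \<eta> :: "(real \<times> 'a :: euclidean_space) measure"
  assumes \<eta>: "\<eta> \<in> point_patterns jump_space" "locally_finite \<eta>" and "A \<in> sets jump_space" "A \<subseteq> {0..t} \<times> UNIV"
  shows "emeasure \<eta> A < \<infinity>"
proof -
  have "emeasure \<eta> A \<le> emeasure \<eta> ({0..max 0 t} \<times> UNIV)"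
    using assms strip_sets[OF \<eta>(1)] by (intro emeasure_mono) auto
  also have "\<dots> < \<infinity>" using \<eta>(2) by (simp add: locally_finite_def)
  finally show ?thesis .
qed

lemma compound_path_diff:
  fixes \<eta> :: "(real \<times> 'a :: euclidean_space) measure"
  assumes \<eta>: "\<eta> \<in> point_patterns jump_space" "locally_finite \<eta>" and st: "0 \<le> s" "s \<le> t"
  shows "compound_path \<eta> t - compound_path \<eta> s = (LINT z:{s<..t} \<times> UNIV|\<eta>. snd z)"
proof -
  have int: "set_integrable \<eta> A snd" if "A \<in> sets jump_space" "A \<subseteq> {0..t} \<times> UNIV" for A
    by (rule point_pattern_set_integrable_snd[OF \<eta>(1) that(1) strip_finite[OF \<eta> that]])
  have "(LINT z:({0..s} \<times> UNIV) \<union> ({s<..t} \<times> UNIV)|\<eta>. snd z) = (LINT z:{0..s} \<times> UNIV|\<eta>. snd z) + (LINT z:{s<..t} \<times> UNIV|\<eta>. snd z)"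
    using st by (intro set_integral_Un int jump_sets) auto
  moreover have "({0..s} \<times> UNIV) \<union> ({s<..t} \<times> UNIV) = {0..t} \<times> (UNIV :: 'a set)"
    using st by auto
  ultimately show ?thesis
    using \<eta>(2) st by (simp add: compound_path_eq)
qed

lemma compound_path_const:
  fixes \<eta> :: "(real \<times> 'a :: euclidean_space) measure"
  assumes \<eta>: "\<eta> \<in> point_patterns jump_space" "locally_finite \<eta>" and st: "0 \<le> s" "s \<le> t"
    and null: "emeasure \<eta> ({s<..t} \<times> UNIV) = 0"
  shows "compound_path \<eta> s = compound_path \<eta> t"
proof -
  have "AE z in \<eta>. z \<notin> {s<..t} \<times> UNIV"
    using null strip_sets[OF \<eta>(1)] st by (intro AE_not_in) auto
  then have "(LINT z:{s<..t} \<times> UNIV|\<eta>. snd z) = (LINT z|\<eta>. 0)"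
    unfolding set_lebesgue_integral_def
    using strip_sets(2)[OF \<eta>(1) st(1), of t] 
    by (intro integral_cong_AE) (auto simp: measurable_cong_sets[OF sets_point_pattern[OF \<eta>(1)] refl] sets_point_pattern[OF \<eta>(1)])
  then show ?thesis using compound_path_diff[OF \<eta> st] by simp
qed

text \<open>The path of a locally finite pattern can change only when the number N of points up to
  the current time does, and N is nondecreasing, integer-valued and right-continuous.\<close>

lemma compound_path_step_path:
  fixes \<eta> :: "(real \<times> 'a :: euclidean_space) measure"
  assumes \<eta>: "\<eta> \<in> point_patterns jump_space"
  shows "compound_path \<eta> \<in> step_paths"
proof (cases "locally_finite \<eta>")
  case False
  have "continuous (at_right t) (\<lambda>t\<in>{0..}. 0 :: 'a)" if "0 \<le> t" for t :: real
  proof -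
    have "\<forall>\<^sub>F u in at_right t. (\<lambda>t\<in>{0..}. 0 :: 'a) u = (\<lambda>t\<in>{0..}. 0 :: 'a) t"
      unfolding eventually_at_filter using that by (auto intro!: always_eventually)
    then show ?thesis
      unfolding continuous_within using tendsto_eventually by blast
  qed
  then show ?thesis
    unfolding compound_path_not_locally_finite[OF False] step_paths_def by (auto intro!: exI[of _ "{}"])
next
  case lf: True
  define N where "N t = nat_of_ennreal (emeasure \<eta> ({0..t} \<times> UNIV))" for t
  note ss = strip_sets[OF \<eta>]
  have N: "emeasure \<eta> ({0..t} \<times> UNIV) = of_nat (N t)" if "0 \<le> t" for t
    unfolding N_def using lf that jump_sets(1)[of "UNIV :: 'a set" t]
    by (intro point_pattern_nat[OF \<eta>]) (auto simp: locally_finite_def)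
  have split: "emeasure \<eta> ({0..t} \<times> UNIV) = emeasure \<eta> ({0..s} \<times> UNIV) + emeasure \<eta> ({s<..t} \<times> UNIV)" if "0 \<le> s" "s \<le> t" for s t
  proof -
    have "({0..s} \<times> UNIV) \<union> ({s<..t} \<times> UNIV) = {0..t} \<times> (UNIV :: 'a set)" using that by auto
    moreover have "({0..s} \<times> UNIV) \<inter> ({s<..t} \<times> UNIV) = ({} :: (real \<times> 'a) set)" by auto
    ultimately show ?thesis
      using plus_emeasure[OF ss(1)[of s] ss(2)[OF that(1), of t]] by simp
  qed
  have mono: "N s \<le> N t" if "0 \<le> s" "s \<le> t" for s t
  proof -
    have "of_nat (N s) \<le> (of_nat (N t) :: ennreal)"
      using split[OF that] N[of s] N[of t] that by (simp only: le_iff_add) auto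
    then show ?thesis by simp
  qed
  have eq: "compound_path \<eta> s = compound_path \<eta> t" if "0 \<le> s" "s \<le> t" "N s = N t" for s t
  proof (rule compound_path_const[OF \<eta> lf that(1,2)])
    show "emeasure \<eta> ({s<..t} \<times> UNIV) = 0"
    proof -
      have "(of_nat (N t) :: ennreal) + 0 = of_nat (N t) + emeasure \<eta> ({s<..t} \<times> UNIV)"
        using split[OF that(1,2)] N[of s] N[of t] that by simp
      then show ?thesis unfolding ennreal_add_left_cancel by simp
    qed
  qed
  have right: "\<exists>d>0. \<forall>u. t \<le> u \<and> u < t + d \<longrightarrow> N u = N t" if t: "0 \<le> t" for t
  proof -
    \<comment> \<open>Windows to the right of t that shrink to the empty set. One of them has a
      count below 1, so N is constant on it.\<close>
    define D where "D n = {t<..t + 1 / real (Suc n)} \<times> (UNIV :: 'a set)" for n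
    have "(\<lambda>n. emeasure \<eta> (D n)) \<longlonglongrightarrow> emeasure \<eta> (\<Inter>n. D n)"
    proof (rule Lim_emeasure_decseq)
      show "range D \<subseteq> sets \<eta>" using ss(2)[OF t] by (auto simp: D_def)
      have "1 / real (Suc n) \<le> 1 / real (Suc m)" if "m \<le> n" for m n
        using that by (simp add: frac_le)
      then show "decseq D" unfolding decseq_def D_def by (fastforce intro: order.trans)
      show "emeasure \<eta> (D n) \<noteq> \<infinity>" for n
      proof -
        have "D n \<subseteq> {0..t + 1 / real (Suc n)} \<times> UNIV" using t unfolding D_def by (intro Sigma_mono) auto
        moreover have "D n \<in> sets jump_space" unfolding D_def by (rule jump_sets(2)[OF t]) simp
        ultimately show ?thesis using strip_finite[OF \<eta> lf, of "D n" "t + 1 / real (Suc n)"] by auto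
      qed
    qed
    moreover have "(\<Inter>n. D n) = {}"
    proof -
      have "\<exists>n. \<not> u \<le> t + 1 / real (Suc n)" if "t < u" for u
        using reals_Archimedean[of "u - t"] that by (auto simp: inverse_eq_divide not_le algebra_simps)
      then show ?thesis unfolding D_def by fastforce
    qed
    ultimately have "(\<lambda>n. emeasure \<eta> (D n)) \<longlonglongrightarrow> 0" by simp
    then have "\<forall>\<^sub>F n in sequentially. emeasure \<eta> (D n) < 1"
      by (rule order_tendstoD) simp
    then obtain n where n: "emeasure \<eta> (D n) < 1" by (auto simp: eventually_sequentially)
    have Nu: "N u = N t" if u: "t \<le> u" "u < t + 1 / real (Suc n)" for u
    proof (rule antisym[OF _ mono[OF t u(1)]])
      have "emeasure \<eta> ({t<..u} \<times> UNIV) \<le> emeasure \<eta> (D n)"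
        using u ss(2)[OF t] by (intro emeasure_mono) (auto simp: D_def)
      then have "emeasure \<eta> ({t<..u} \<times> UNIV) < 1" using n by (rule le_less_trans)
      then have "(of_nat (N u) :: ennreal) < of_nat (N t) + 1"
      proof -
        have "of_nat (N u) = (of_nat (N t) :: ennreal) + emeasure \<eta> ({t<..u} \<times> UNIV)"
          using split[OF t u(1)] N[of u] N[of t] t u(1) by simp
        also have "\<dots> < of_nat (N t) + 1"
          using \<open>emeasure \<eta> ({t<..u} \<times> UNIV) < 1\<close>
          by (simp only: ennreal_add_left_cancel_less) simp
        finally show ?thesis .
      qed
      also have "(of_nat (N t) :: ennreal) + 1 = of_nat (Suc (N t))" by (simp add: add.commute)
      finally show "N u \<le> N t" unfolding of_nat_less_iff by simp
    qed
    show ?thesis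
    proof (intro exI conjI allI impI)
      show "0 < 1 / real (Suc n)" by simp
      show "N u = N t" if "t \<le> u \<and> u < t + 1 / real (Suc n)" for u
        using that by (intro Nu) blast+
    qed
  qed
  show ?thesis
    unfolding step_paths_def
  proof (intro CollectI conjI allI impI compound_path_extensional)
    fix t :: real assume t: "0 \<le> t"
    obtain d where d: "0 < d" "\<And>u. t \<le> u \<Longrightarrow> u < t + d \<Longrightarrow> N u = N t" using right[OF t] by auto
    have "\<forall>\<^sub>F u in at_right t. compound_path \<eta> u = compound_path \<eta> t"
    proof (rule eventually_at_rightI[of t "t + d"])
      fix u assume "u \<in> {t<..<t + d}"
      then have u: "t \<le> u" "u < t + d" by auto
      show "compound_path \<eta> u = compound_path \<eta> t"
        by (rule eq[symmetric, OF t u(1)]) (use d(2)[OF u] in simp)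
    qed (use d(1) in simp)
    then show "continuous (at_right t) (compound_path \<eta>)"
      unfolding continuous_within using tendsto_eventually by blast
  next
    fix T :: real assume T: "0 \<le> T"
    \<comment> \<open>The times at which N exceeds all its earlier values. N is injective on them
      with values at most \<open>N T\<close>, so they are finitely many.\<close>
    define D where "D = {u\<in>{0..T}. \<forall>s\<in>{0..<u}. N s < N u}"
    have "inj_on N D"
    proof (rule linorder_inj_onI)
      fix u v assume "u < v" "u \<in> D" "v \<in> D"
      then have "N u < N v" by (auto simp: D_def)
      then show "N u \<noteq> N v" by simp
    qed auto
    moreover have "N ` D \<subseteq> {..N T}" using mono by (auto simp: D_def)
    ultimately have "finite D" by (metis finite_atMost finite_imageD finite_subset)
    moreover have "compound_path \<eta> s = compound_path \<eta> t" if st: "0 \<le> s" "s \<le> t" "t \<le> T" and disj: "{s..t} \<inter> D = {}" for s t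
    proof (rule eq[OF st(1,2)], rule ccontr)
      assume "N s \<noteq> N t"
      then have lt: "N s < N t" using mono[OF st(1,2)] by simp
      \<comment> \<open>If N increases between s and t, the value \<open>N t\<close> is reached for
        the first time at the infimum u of V, which belongs to V by right-continuity; then u is a
        member of D in [s, t].\<close>
      define V where "V = {v\<in>{s..t}. N v = N t}"
      have tV: "t \<in> V" using st by (auto simp: V_def)
      have bdd: "bdd_below V" by (auto simp: V_def bdd_below_def)
      define u where "u = Inf V"
      have u: "s \<le> u" "u \<le> t" 
        unfolding u_def using tV bdd by (auto intro!: cInf_greatest cInf_lower simp: V_def)
      have below: "N v \<noteq> N t" if "s \<le> v" "v < u" for v
        using cInf_lower[OF _ bdd, of v] that u by (force simp: u_def V_def)
      have "N u = N t"
      proof -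
        obtain d where d: "0 < d" "\<And>v. u \<le> v \<Longrightarrow> v < u + d \<Longrightarrow> N v = N u" using right[of u] u st by auto
        obtain v where "v \<in> V" "v < u + d"
          using cInf_lessD[of V "u + d"] tV d(1) by (auto simp: u_def)
        moreover have "u \<le> v" unfolding u_def by (rule cInf_lower[OF \<open>v \<in> V\<close> bdd])
        ultimately show ?thesis using d(2)[of v] by (simp add: V_def)
      qed
      moreover have "N v < N u" if v: "0 \<le> v" "v < u" for v
      proof (cases "s \<le> v")
        case True
        then show ?thesis using below[OF True v(2)] mono[of v u] v \<open>N u = N t\<close> by simp
      next
        case False
        then show ?thesis using mono[of v s] v lt \<open>N u = N t\<close> by simp
      qed
      ultimately have "u \<in> D" using u st by (auto simp: D_def)
      then show False using disj u by auto
    qed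
    ultimately show "\<exists>D. finite D \<and> (\<forall>s t. 0 \<le> s \<and> s \<le> t \<and> t \<le> T \<and> {s..t} \<inter> D = {} \<longrightarrow> compound_path \<eta> s = compound_path \<eta> t)"
      by blast
  qed
qed

text \<open>Each coordinate of the Bochner integral is a difference of two nonnegative integrals,
  and those are measurable in the pattern.\<close>

lemma measurable_compound_path:
  "compound_path \<in> measurable (point_pattern_space (jump_space :: (real \<times> 'a :: euclidean_space) measure)) path_space"
  unfolding path_space_def
proof (rule measurable_restrict_space2)
  let ?\<Pi> = "point_pattern_space (jump_space :: (real \<times> 'a) measure)"
  show "compound_path \<in> space ?\<Pi> \<rightarrow> step_paths" by (auto intro: compound_path_step_path)
  \<comment> \<open>Local finiteness tested at integer times, a countable and therefore measurable
    condition.\<close>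
  define lf where "lf \<eta> \<longleftrightarrow> (\<forall>n :: nat. emeasure \<eta> ({0..real n} \<times> UNIV) < \<infinity>)" for \<eta> :: "(real \<times> 'a) measure"
  have lf: "Measurable.pred ?\<Pi> lf"
    unfolding lf_def by (intro pred_intros_countable) (use jump_sets(1)[of UNIV] in measurable)
  show "compound_path \<in> measurable ?\<Pi> (PiM {0..} (\<lambda>_. borel))"
  proof (rule measurable_PiM_single')
    show "compound_path \<in> space ?\<Pi> \<rightarrow> ({0..} \<rightarrow>\<^sub>E space (borel :: 'a measure))"
      using compound_path_extensional by (auto simp: PiE_def)
    fix t :: real assume t: "t \<in> {0..}"
    show "(\<lambda>\<eta>. compound_path \<eta> t :: 'a) \<in> borel_measurable ?\<Pi>"
      unfolding borel_measurable_euclidean_space[of "\<lambda>\<eta>. compound_path \<eta> t"]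
    proof
      fix b :: 'a assume "b \<in> Basis"
      define u where "u z = indicator ({0..t} \<times> UNIV) z * (snd z \<bullet> b)" for z :: "real \<times> 'a"
      have [measurable]: "{0..t} \<times> (UNIV :: 'a set) \<in> sets jump_space" by (simp add: jump_sets)
      have u [measurable]: "u \<in> borel_measurable jump_space" unfolding u_def by measurable
      let ?I = "\<lambda>\<eta>. if lf \<eta> then enn2real (\<integral>\<^sup>+z. ennreal (u z) \<partial>\<eta>) - enn2real (\<integral>\<^sup>+z. ennreal (- u z) \<partial>\<eta>) else 0"
      have "?I \<in> borel_measurable ?\<Pi>"
        by (intro measurable_If[OF _ _ lf[unfolded pred_def]] borel_measurable_diff borel_measurable_enn2real
            measurable_nn_integral_point_pattern measurable_compose[OF _ measurable_ennreal]) measurable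
      then show "(\<lambda>\<eta>. compound_path \<eta> t \<bullet> b) \<in> borel_measurable ?\<Pi>"
      proof (rule measurable_cong[THEN iffD1, rotated])
        fix \<eta> :: "(real \<times> 'a) measure" assume "\<eta> \<in> space ?\<Pi>"
        then have \<eta>: "\<eta> \<in> point_patterns jump_space" by simp
        have lf_iff: "lf \<eta> \<longleftrightarrow> locally_finite \<eta>" using locally_finite_iff_nat[OF \<eta>] by (simp add: lf_def)
        show "?I \<eta> = compound_path \<eta> t \<bullet> b"
        proof (cases "lf \<eta>")
          case True
          then have lf': "locally_finite \<eta>" by (simp add: lf_iff)
          have "set_integrable \<eta> ({0..t} \<times> UNIV) snd"
            using lf' t by (intro point_pattern_set_integrable_snd[OF \<eta>] jump_sets) (auto simp: locally_finite_def)
          then have int: "integrable \<eta> (\<lambda>z. indicator ({0..t} \<times> UNIV) z *\<^sub>R snd z)"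
            by (simp add: set_integrable_def)
          have "compound_path \<eta> t \<bullet> b = (LINT z|\<eta>. (indicator ({0..t} \<times> UNIV) z *\<^sub>R snd z) \<bullet> b)"
          proof -
            have "(LINT z|\<eta>. (indicator ({0..t} \<times> UNIV) z *\<^sub>R snd z) \<bullet> b) = (LINT z|\<eta>. indicator ({0..t} \<times> UNIV) z *\<^sub>R snd z) \<bullet> b"
              by (rule integral_inner_left) (rule int)
            then show ?thesis using lf' t by (simp only: compound_path_eq set_lebesgue_integral_def atLeast_iff)
          qed
          also have "\<dots> = (LINT z|\<eta>. u z)" by (simp add: u_def)
          also have "\<dots> = enn2real (\<integral>\<^sup>+z. ennreal (u z) \<partial>\<eta>) - enn2real (\<integral>\<^sup>+z. ennreal (- u z) \<partial>\<eta>)"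
          proof (rule real_lebesgue_integral_def)
            show "integrable \<eta> u"
              using integrable_inner_left[OF int, of b] by (simp add: u_def[abs_def])
          qed
          finally show ?thesis using True by simp
        next
          case False
          then show ?thesis using compound_path_not_locally_finite[of \<eta>] t by (simp add: lf_iff)
        qed
      qed
    qed
  qed
qed

section \<open>Recovering counts from increments\<close>

lemma zero_one_measure_dirac:
  fixes M :: "'a :: euclidean_space measure"
  assumes sets: "sets M = sets borel" and one: "emeasure M UNIV = 1"
    and zo: "\<And>U. U \<in> sets borel \<Longrightarrow> emeasure M U = 0 \<or> emeasure M U = 1"
  obtains y where "AE x in M. x = y"
proof -
  obtain \<B> :: "'a set set" where \<B>: "countable \<B>" "topological_basis \<B>"
    using ex_countable_basis by blast
  have op: "B \<in> sets M" if "B \<in> \<B>" for B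
    using topological_basis_open[OF \<B>(2) that] by (simp add: sets)
  \<comment> \<open>The null members of a countable basis have a null union. A point y outside it
    has only basic neighbourhoods of positive measure, hence of measure 1.\<close>
  define Z where "Z = {B\<in>\<B>. emeasure M B = 0}"
  have "countable Z" using \<B>(1) by (auto simp: Z_def)
  have "emeasure M (\<Union>B\<in>Z. B) = 0"
    by (intro null_setsD1 null_sets_UN' \<open>countable Z\<close>) (use op in \<open>auto simp: Z_def null_sets_def\<close>)
  moreover have "emeasure M UNIV \<noteq> 0" using one by simp
  ultimately have "(\<Union>B\<in>Z. B) \<noteq> UNIV" by auto
  then obtain y where y: "y \<notin> (\<Union>B\<in>Z. B)" by auto
  have ball: "AE x in M. dist y x < e" if e: "0 < e" for e
  proof -
    obtain B where B: "B \<in> \<B>" "y \<in> B" "B \<subseteq> ball y e"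
      by (rule topological_basisE[OF \<B>(2) open_ball, of y y e]) (use e in auto)
    then have "emeasure M B \<noteq> 0" using y by (auto simp: Z_def)
    then have "emeasure M B = 1" using zo[of B] op[OF B(1)] sets by simp
    moreover have "emeasure M (space M) = 1" using one sets_eq_imp_space_eq[OF sets] by simp
    ultimately have "emeasure M (space M - B) = 0"
      using op[OF B(1)] by (subst emeasure_compl) auto
    then have "AE x in M. x \<notin> space M - B"
      using op[OF B(1)] by (intro AE_not_in) auto
    then show ?thesis using AE_space by eventually_elim (use B in auto)
  qed
  have "AE x in M. \<forall>n. dist y x < 1 / real (Suc n)"
    unfolding AE_all_countable by (auto intro!: ball)
  then have "AE x in M. x = y"
  proof eventually_elim
    case (elim x)
    show ?case
    proof (rule ccontr)
      assume "x \<noteq> y"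
      then have "0 < dist y x" by simp
      then obtain n where "inverse (real (Suc n)) < dist y x" using reals_Archimedean by blast
      then show False using elim by (metis inverse_eq_divide not_less_iff_gr_or_eq)
    qed
  qed
  then show ?thesis by (rule that)
qed

text \<open>If the cell holds one point, the jump sizes in it have a zero-one law, hence a point
  mass at some y, and the increment is y. An empty cell has increment 0, which U avoids.\<close>

lemma single_jump:
  fixes \<eta> :: "(real \<times> 'a :: euclidean_space) measure"
  assumes \<eta>: "\<eta> \<in> point_patterns jump_space" "locally_finite \<eta>" and st: "0 \<le> s" "s \<le> t"
    and le: "emeasure \<eta> ({s<..t} \<times> UNIV) \<le> 1" and U: "U \<in> sets borel" "0 \<notin> U"
  shows "emeasure \<eta> ({s<..t} \<times> U) = of_bool (compound_path \<eta> t - compound_path \<eta> s \<in> U)"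
proof -
  let ?C = "{s<..t} \<times> (UNIV :: 'a set)"
  note sets = sets_point_pattern[OF \<eta>(1)]
  have C [measurable]: "?C \<in> sets \<eta>" by (rule strip_sets(2)[OF \<eta>(1) st(1)])
  have sU: "{s<..t} \<times> V \<in> sets \<eta>" if "V \<in> sets borel" for V :: "'a set"
    using jump_sets(2)[OF st(1) that] sets by simp
  have zo: "emeasure \<eta> ({s<..t} \<times> V) = 0 \<or> emeasure \<eta> ({s<..t} \<times> V) = 1" if V: "V \<in> sets borel" for V :: "'a set"
  proof -
    have "emeasure \<eta> ({s<..t} \<times> V) \<le> 1"
      using emeasure_mono[of "{s<..t} \<times> V" ?C \<eta>] C le by (auto intro: order.trans)
    moreover from this obtain k :: nat where k: "emeasure \<eta> ({s<..t} \<times> V) = of_nat k"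
      using point_pattern_nat_valued[OF \<eta>(1), of "{s<..t} \<times> V"] sU[OF V] sets by (auto simp: top_unique)
    ultimately have "(of_nat k :: ennreal) \<le> of_nat 1" by simp
    then have "k \<le> 1" by (simp only: of_nat_le_iff)
    then show ?thesis using k by (cases k) auto
  qed
  note inc = compound_path_diff[OF \<eta> st]
  consider "emeasure \<eta> ?C = 0" | "emeasure \<eta> ?C = 1" using zo[of UNIV] by auto
  then show ?thesis
  proof cases
    case 1
    have "emeasure \<eta> ({s<..t} \<times> U) \<le> emeasure \<eta> ?C" by (rule emeasure_mono) auto
    moreover have "compound_path \<eta> t - compound_path \<eta> s = 0"
      using compound_path_const[OF \<eta> st 1] by simp
    ultimately show ?thesis using 1 U by simp
  next
    case 2
    \<comment> \<open>The law of the jump size in the cell.\<close>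
    define M where "M = distr (density \<eta> (indicator ?C)) borel snd"
    have snd [measurable]: "snd \<in> borel_measurable \<eta>" by (simp add: measurable_cong_sets[OF sets refl])
    have sp: "space \<eta> = {0..} \<times> UNIV" using sets_eq_imp_space_eq[OF sets] by (simp add: space_jump_space)
    have M: "emeasure M V = emeasure \<eta> ({s<..t} \<times> V)" if V: "V \<in> sets borel" for V
    proof -
      have "emeasure M V = emeasure (density \<eta> (indicator ?C)) (snd -` V \<inter> space \<eta>)"
        unfolding M_def using V by (subst emeasure_distr) auto
      also have "\<dots> = (\<integral>\<^sup>+z. indicator ({s<..t} \<times> V) z \<partial>\<eta>)"
        using V measurable_sets[OF snd V]
        by (subst emeasure_density) (auto intro!: nn_integral_cong simp del: nn_integral_indicator split: split_indicator)
      finally show ?thesis using sU[OF V] by simp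
    qed
    have "sets M = sets borel" by (simp add: M_def)
    moreover have "emeasure M UNIV = 1" using M[of UNIV] 2 by simp
    moreover have "emeasure M V = 0 \<or> emeasure M V = 1" if "V \<in> sets borel" for V
      using zo[OF that] M[OF that] by simp
    ultimately obtain y where y: "AE x in M. x = y" by (rule zero_one_measure_dirac)
    then have "AE z in density \<eta> (indicator ?C). snd z = y"
      unfolding M_def by (subst (asm) AE_distr_iff) auto
    then have y': "AE z in \<eta>. z \<in> ?C \<longrightarrow> snd z = y"
      by (subst (asm) AE_density) (auto simp: indicator_def)
    have "(LINT z:?C|\<eta>. snd z) = (LINT z:?C|\<eta>. y)"
      using y' by (intro set_lebesgue_integral_cong_AE) auto
    also have "\<dots> = y"
      using 2 by (simp add: set_integral_const measure_def)
    finally have inc_y: "compound_path \<eta> t - compound_path \<eta> s = y" by (simp add: inc)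
    have "emeasure \<eta> ({s<..t} \<times> U) = emeasure \<eta> (if y \<in> U then ?C else {})"
    proof (rule emeasure_eq_AE)
      show "AE z in \<eta>. (z \<in> {s<..t} \<times> U) = (z \<in> (if y \<in> U then ?C else {}))"
        using y' by eventually_elim auto
    qed (use sU[OF U(1)] C in auto)
    then show ?thesis using 2 by (simp add: inc_y)
  qed
qed

definition grid :: "real \<Rightarrow> nat \<Rightarrow> nat \<Rightarrow> real" where
  "grid T n i = T * real i / 2 ^ n"

abbreviation cell :: "real \<Rightarrow> nat \<Rightarrow> nat \<Rightarrow> real set" where
  "cell T n i \<equiv> {grid T n i<..grid T n (Suc i)}"

lemma grid_mono: "0 \<le> T \<Longrightarrow> i \<le> j \<Longrightarrow> grid T n i \<le> grid T n j"
  by (auto simp: grid_def intro!: divide_right_mono mult_left_mono)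

lemma grid_nonneg: "0 \<le> T \<Longrightarrow> 0 \<le> grid T n i"
  by (simp add: grid_def)

lemma UN_cell:
  assumes "0 \<le> T"
  shows "(\<Union>i<m. cell T n i) = {0<..grid T n m}"
proof (induction m)
  case (Suc m)
  have "{0<..grid T n m} \<union> cell T n m = {0<..grid T n (Suc m)}"
    using grid_mono[OF assms, of m "Suc m" n] grid_nonneg[OF assms, of n m] by auto
  then show ?case using Suc by (simp add: lessThan_Suc Un_commute)
qed (simp add: grid_def)

lemma UN_cell_all: "0 \<le> T \<Longrightarrow> (\<Union>i<2 ^ n. cell T n i) = {0<..T}"
  by (simp add: UN_cell) (simp add: grid_def)

lemma disjoint_cell: "0 \<le> T \<Longrightarrow> disjoint_family_on (cell T n) I"
  unfolding disjoint_family_on_def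
proof (intro ballI impI)
  fix i j :: nat assume "0 \<le> T" "i \<noteq> j"
  then show "cell T n i \<inter> cell T n j = {}"
    using grid_mono[of T "Suc i" j n] grid_mono[of T "Suc j" i n] by (cases i j rule: linorder_cases) fastforce+
qed

lemma cell_refine:
  assumes "0 \<le> T"
  shows "cell T (Suc n) i \<subseteq> cell T n (i div 2)"
proof -
  have 1: "2 * (i div 2) \<le> i" "Suc i \<le> 2 * Suc (i div 2)" by presburger+
  have "grid T n (i div 2) = grid T (Suc n) (2 * (i div 2))" "grid T n (Suc (i div 2)) = grid T (Suc n) (2 * Suc (i div 2))"
    by (simp_all add: grid_def field_simps)
  then have "grid T n (i div 2) \<le> grid T (Suc n) i" "grid T (Suc n) (Suc i) \<le> grid T n (Suc (i div 2))"
    using 1 grid_mono[OF assms] by auto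
  then show ?thesis by auto
qed

definition separated :: "real \<Rightarrow> nat \<Rightarrow> (real \<times> 'a) measure \<Rightarrow> bool" where
  "separated T n \<eta> \<longleftrightarrow> (\<forall>i<2 ^ n. emeasure \<eta> (cell T n i \<times> UNIV) \<le> 1)"

lemma separated_Suc:
  fixes \<eta> :: "(real \<times> 'a :: euclidean_space) measure"
  assumes "\<eta> \<in> point_patterns jump_space" "0 \<le> T" "separated T n \<eta>"
  shows "separated T (Suc n) \<eta>"
  unfolding separated_def
proof (intro allI impI)
  fix i :: nat assume "i < 2 ^ Suc n"
  then have "i div 2 < 2 ^ n" by auto
  then have "emeasure \<eta> (cell T n (i div 2) \<times> UNIV) \<le> 1" using assms by (auto simp: separated_def)
  moreover have "emeasure \<eta> (cell T (Suc n) i \<times> UNIV) \<le> emeasure \<eta> (cell T n (i div 2) \<times> UNIV)"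
    using cell_refine[OF assms(2), of n i] strip_sets(2)[OF assms(1) grid_nonneg[OF assms(2)]] by (intro emeasure_mono) auto
  ultimately show "emeasure \<eta> (cell T (Suc n) i \<times> UNIV) \<le> 1" by (rule order.trans[rotated])
qed

text \<open>The limit inferior exists and is measurable for every path, while for separated patterns
  the sums are eventually constant. Removing 0 from U ignores the cells without a point.\<close>

definition jump_count :: "real \<Rightarrow> 'a :: euclidean_space set \<Rightarrow> (real \<Rightarrow> 'a) \<Rightarrow> ennreal" where
  "jump_count T U x = liminf (\<lambda>n. \<Sum>i<2 ^ n. of_bool (x (grid T n (Suc i)) - x (grid T n i) \<in> U - {0}))"

lemma measurable_jump_count:
  assumes "0 \<le> T" and U: "U \<in> sets borel"
  shows "jump_count T U \<in> borel_measurable path_space"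
proof -
  have comp: "(\<lambda>x. x t) \<in> borel_measurable path_space" if "0 \<le> t" for t :: real
    unfolding path_space_def using that
    by (intro measurable_restrict_space1 measurable_component_singleton) auto
  have "(\<lambda>x :: real \<Rightarrow> 'a. of_bool (x (grid T n (Suc i)) - x (grid T n i) \<in> U - {0}) :: ennreal) \<in> borel_measurable path_space" for n i
  proof -
    have [measurable]: "(\<lambda>x :: real \<Rightarrow> 'a. x (grid T n (Suc i)) - x (grid T n i)) \<in> borel_measurable path_space"
      by (intro borel_measurable_diff comp grid_nonneg assms)
    have "U - {0} \<in> sets borel" using U by auto
    then show ?thesis
      unfolding of_bool_def by measurable
  qed
  then show ?thesis
    unfolding jump_count_def[abs_def] by (intro borel_measurable_liminf borel_measurable_sum)
qed

text \<open>Refining a separated partition keeps it separated, so from level n on the sum counts the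
  points of (0, T] with nonzero jump in U. The two null conditions deal with time 0, which no cell
  contains, and with jumps of size 0, which the path does not show.\<close>

lemma jump_count_compound_path:
  fixes \<eta> :: "(real \<times> 'a :: euclidean_space) measure"
  assumes \<eta>: "\<eta> \<in> point_patterns jump_space" "locally_finite \<eta>" and T: "0 \<le> T"
    and sep: "separated T n \<eta>" and U: "U \<in> sets borel"
    and 0: "emeasure \<eta> ({0..0} \<times> UNIV) = 0" "emeasure \<eta> ({0..T} \<times> {0}) = 0"
  shows "jump_count T U (compound_path \<eta>) = emeasure \<eta> ({0..T} \<times> U)"
proof -
  note sets = sets_point_pattern[OF \<eta>(1)]
  have U0: "U - {0} \<in> sets borel" using U by auto
  have sep_ge: "separated T m \<eta>" if "n \<le> m" for m
    using that sep by (induction m rule: dec_induct) (auto intro: separated_Suc[OF \<eta>(1) T])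
  have "(\<Sum>i<2 ^ m. of_bool (compound_path \<eta> (grid T m (Suc i)) - compound_path \<eta> (grid T m i) \<in> U - {0})) = emeasure \<eta> ({0..T} \<times> U)"
    if "n \<le> m" for m
  proof -
    have "(\<Sum>i<2 ^ m. of_bool (compound_path \<eta> (grid T m (Suc i)) - compound_path \<eta> (grid T m i) \<in> U - {0}))
        = (\<Sum>i<2 ^ m. emeasure \<eta> (cell T m i \<times> (U - {0})))"
      using sep_ge[OF that] grid_mono[OF T] U0
      by (intro sum.cong refl single_jump[symmetric] \<eta> grid_nonneg T) (auto simp: separated_def)
    also have "\<dots> = emeasure \<eta> (\<Union>i<2 ^ m. cell T m i \<times> (U - {0}))"
    proof (rule sum_emeasure)
      show "(\<lambda>i. cell T m i \<times> (U - {0})) ` {..<2 ^ m} \<subseteq> sets \<eta>"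
        using jump_sets(2)[OF grid_nonneg[OF T] U0] sets by auto
      show "disjoint_family_on (\<lambda>i. cell T m i \<times> (U - {0})) {..<2 ^ m}"
        using disjoint_cell[OF T, of m "{..<2 ^ m}"] unfolding disjoint_family_on_def by blast
    qed simp
    also have "(\<Union>i<2 ^ m. cell T m i \<times> (U - {0})) = {0<..T} \<times> (U - {0})"
    proof -
      have "(\<Union>i<2 ^ m. cell T m i \<times> (U - {0})) = (\<Union>i<2 ^ m. cell T m i) \<times> (U - {0})" by blast
      then show ?thesis by (simp only: UN_cell_all[OF T])
    qed
    also have "emeasure \<eta> \<dots> = emeasure \<eta> ({0..T} \<times> U)"
    proof (rule emeasure_eq_AE)
      have "AE z in \<eta>. z \<notin> {0..0} \<times> UNIV" "AE z in \<eta>. z \<notin> {0..T} \<times> {0}"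
        using 0 jump_sets(1)[of UNIV 0] jump_sets(1)[of "{0}" T] sets by (auto intro!: AE_not_in)
      then show "AE z in \<eta>. (z \<in> {0<..T} \<times> (U - {0})) = (z \<in> {0..T} \<times> U)"
        by eventually_elim (auto simp: less_le)
    qed (use jump_sets(1)[OF U, of T] jump_sets(2)[OF order_refl U0, of T] sets in auto)
    finally show ?thesis .
  qed
  then have "(\<lambda>m. \<Sum>i<2 ^ m. of_bool (compound_path \<eta> (grid T m (Suc i)) - compound_path \<eta> (grid T m i) \<in> U - {0})) \<longlonglongrightarrow> emeasure \<eta> ({0..T} \<times> U)"
    by (intro tendsto_eventually) (auto simp: eventually_sequentially)
  then show ?thesis
    unfolding jump_count_def by (intro lim_imp_Liminf) auto
qed

section \<open>Separation of the points by dyadic cells\<close>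

lemma poisson_distr_ge_2:
  assumes "0 \<le> r"
  shows "emeasure (poisson_distr (ennreal r)) {x. 1 < x} \<le> ennreal (r\<^sup>2)"
proof -
  interpret prob_space "poisson_distr (ennreal r)" by (rule prob_space_poisson_distr)
  have "{x :: ennreal. 1 < x} = space (poisson_distr (ennreal r)) - {..of_nat 1}" by auto
  then have "prob {x. 1 < x} = 1 - prob {..of_nat 1}"
    by (simp only:) (rule prob_compl, simp)
  also have "prob {..of_nat 1} = (1 + r) * exp (- r)"
  proof -
    have "(\<Sum>j\<le>1 :: nat. r ^ j / fact j * exp (- r)) = (1 + r) * exp (- r)" by (simp add: algebra_simps)
    then show ?thesis
      using emeasure_poisson_distr_atMost[OF assms, of 1] assms by (simp only: measure_def) simp
  qed
  \<comment> \<open>From \<open>exp (- r) \<ge> 1 - r\<close>. The bound is quadratic in the mean,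
    which is what makes a union bound over many small cells effective.\<close>
  also have "1 - (1 + r) * exp (- r) \<le> r\<^sup>2"
  proof -
    have "(1 + r) * (1 - r) \<le> (1 + r) * exp (- r)"
      using exp_ge_add_one_self[of "- r"] assms by (intro mult_left_mono) auto
    then show ?thesis by (simp add: power2_eq_square algebra_simps)
  qed
  finally show ?thesis by (simp add: emeasure_eq_measure ennreal_leI)
qed

text \<open>The properties of the intensity \<lambda> \<otimes> K on which the path arguments
  rest.\<close>

definition jump_intensity :: "(real \<times> 'a :: euclidean_space) measure \<Rightarrow> bool" where
  "jump_intensity \<Lambda> \<longleftrightarrow> sets \<Lambda> = sets jump_space \<and>
     (\<forall>t\<ge>0. emeasure \<Lambda> ({0..t} \<times> UNIV) < \<infinity> \<and> emeasure \<Lambda> ({t} \<times> UNIV) = 0 \<and> emeasure \<Lambda> ({0..t} \<times> {0}) = 0)"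

lemma AE_poisson_count:
  assumes P: "is_poisson_pp_distr \<Lambda> P" and B: "B \<in> sets \<Lambda>"
    and "AE x in poisson_distr (emeasure \<Lambda> B). R x"
  shows "AE \<eta> in P. R (emeasure \<eta> B)"
proof -
  have "distr P borel (\<lambda>\<eta>. emeasure \<eta> B) = poisson_distr (emeasure \<Lambda> B)"
    using P B by (simp add: is_poisson_pp_distr_def)
  then have "AE x in distr P borel (\<lambda>\<eta>. emeasure \<eta> B). R x" using assms(3) by (simp only:)
  moreover have "(\<lambda>\<eta>. emeasure \<eta> B) \<in> measurable P borel"
    using measurable_emeasure_point_pattern[OF measurable_ident_sets[OF is_poisson_pp_distr_sets[OF P]] B] .
  ultimately show ?thesis by (rule AE_distrD[rotated])
qed

lemma AE_poisson_count_finite: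
  assumes P: "is_poisson_pp_distr \<Lambda> P" and B: "B \<in> sets \<Lambda>" "emeasure \<Lambda> B < \<infinity>"
  shows "AE \<eta> in P. emeasure \<eta> B < \<infinity>"
proof (rule AE_poisson_count[OF P B(1)])
  show "AE x in poisson_distr (emeasure \<Lambda> B). x < \<infinity>"
  proof -
    have "AE x in poisson_distr (emeasure \<Lambda> B). x = of_nat (nat_of_ennreal x)"
      using B(2) by (intro AE_poisson_distr_nat) simp
    then show ?thesis
    proof eventually_elim
      case (elim x)
      show ?case by (subst elim) (simp add: of_nat_less_top)
    qed
  qed
qed

lemma AE_poisson_count_0:
  assumes P: "is_poisson_pp_distr \<Lambda> P" and B: "B \<in> sets \<Lambda>" "emeasure \<Lambda> B = 0"
  shows "AE \<eta> in P. emeasure \<eta> B = 0"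
proof (rule AE_poisson_count[OF P B(1)])
  have "AE x in return borel (0 :: ennreal). x = 0"
    by (subst AE_return) auto
  moreover have "poisson_distr (emeasure \<Lambda> B) = return borel 0" using B(2) by (simp add: poisson_distr_def)
  ultimately show "AE x in poisson_distr (emeasure \<Lambda> B). x = 0" by (simp only:)
qed

lemma poisson_count_ge_2:
  assumes P: "is_poisson_pp_distr \<Lambda> P" and B: "B \<in> sets \<Lambda>" "emeasure \<Lambda> B < \<infinity>"
  shows "emeasure P {\<eta>\<in>point_patterns \<Lambda>. 1 < emeasure \<eta> B} \<le> ennreal ((measure \<Lambda> B)\<^sup>2)"
proof -
  have meas: "(\<lambda>\<eta>. emeasure \<eta> B) \<in> measurable P borel"
    using measurable_emeasure_point_pattern[OF measurable_ident_sets[OF is_poisson_pp_distr_sets[OF P]] B(1)] .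
  have "{\<eta>\<in>point_patterns \<Lambda>. 1 < emeasure \<eta> B} = (\<lambda>\<eta>. emeasure \<eta> B) -` {x. 1 < x} \<inter> space P"
    by (auto simp: is_poisson_pp_distr_space[OF P])
  then have "emeasure P {\<eta>\<in>point_patterns \<Lambda>. 1 < emeasure \<eta> B} = emeasure (distr P borel (\<lambda>\<eta>. emeasure \<eta> B)) {x. 1 < x}"
    using emeasure_distr[OF meas, of "{x. 1 < x}"] by simp
  also have "distr P borel (\<lambda>\<eta>. emeasure \<eta> B) = poisson_distr (ennreal (measure \<Lambda> B))"
    using P B by (simp add: is_poisson_pp_distr_def emeasure_eq_ennreal_measure less_top[symmetric])
  also have "emeasure \<dots> {x. 1 < x} \<le> ennreal ((measure \<Lambda> B)\<^sup>2)"
    by (rule poisson_distr_ge_2) simp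
  finally show ?thesis .
qed

text \<open>A finite diffuse measure on [0, T] has a continuous distribution function, and by
  compactness it is uniformly continuous there.\<close>

lemma small_cells:
  fixes \<Lambda> :: "(real \<times> 'a :: euclidean_space) measure"
  assumes \<Lambda>: "jump_intensity \<Lambda>" and T: "0 \<le> T" and e: "0 < e"
  shows "\<exists>n. \<forall>i<2 ^ n. measure \<Lambda> (cell T n i \<times> UNIV) < e"
proof -
  have sets: "sets \<Lambda> = sets jump_space" and fin: "emeasure \<Lambda> ({0..T} \<times> UNIV) < \<infinity>"
    and diff: "\<And>t. 0 \<le> t \<Longrightarrow> emeasure \<Lambda> ({t} \<times> UNIV) = 0"
    using \<Lambda> T by (auto simp: jump_intensity_def)
  \<comment> \<open>The time marginal of \<Lambda> on [0, T].\<close>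
  define M where "M = distr (density \<Lambda> (indicator ({0..T} \<times> UNIV))) borel fst"
  have fst: "fst \<in> borel_measurable jump_space"
    using measurable_compose[OF measurable_fst measurable_restrict_space1[of "\<lambda>x. x" borel borel "{0..}"]] by (simp add: comp_def)
  have fst' [measurable]: "fst \<in> borel_measurable \<Lambda>" using fst by (simp add: measurable_cong_sets[OF sets refl])
  have sp: "space \<Lambda> = {0..} \<times> UNIV" using sets_eq_imp_space_eq[OF sets] by (simp add: space_jump_space)
  have [measurable]: "{0..T} \<times> (UNIV :: 'a set) \<in> sets \<Lambda>" using sets jump_sets(1)[of UNIV T] by simp
  have M: "emeasure M A = emeasure \<Lambda> ((A \<inter> {0..T}) \<times> UNIV)" if A: "A \<in> sets borel" for A
  proof -
    have eq: "(fst -` A \<inter> space \<Lambda>) \<inter> {0..T} \<times> (UNIV :: 'a set) = (A \<inter> {0..T}) \<times> UNIV" by (auto simp: sp)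
    have AT: "(A \<inter> {0..T}) \<times> (UNIV :: 'a set) \<in> sets \<Lambda>"
      using A unfolding sets by (intro pair_measureI) (auto simp: sets_restrict_space_iff)
    have "emeasure M A = emeasure (density \<Lambda> (indicator ({0..T} \<times> UNIV))) (fst -` A \<inter> space \<Lambda>)"
      unfolding M_def using A by (subst emeasure_distr) auto
    also have "\<dots> = (\<integral>\<^sup>+z. indicator ((A \<inter> {0..T}) \<times> UNIV) z \<partial>\<Lambda>)"
      using measurable_sets[OF fst' A]
      by (subst emeasure_density, simp, simp, intro nn_integral_cong) (auto simp: sp split: split_indicator)
    finally show ?thesis using AT by (simp only: nn_integral_indicator)
  qed
  interpret finite_borel_measure M
  proof (intro finite_borel_measure.intro finite_measureI finite_borel_measure_axioms.intro)
    have "emeasure M (space M) < \<infinity>" using M[of UNIV] fin by (simp add: M_def)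
    then show "emeasure M (space M) \<noteq> \<infinity>" by simp
    show "sets M = sets borel" by (simp add: M_def)
  qed
  have cont: "isCont (cdf M) x" for x
  proof -
    have "emeasure M {x} = 0"
    proof (cases "x \<in> {0..T}")
      case True
      then have "{x} \<inter> {0..T} = {x}" by auto
      then show ?thesis using M[of "{x}"] diff[of x] True by simp
    next
      case False
      then have "{x} \<inter> {0..T} = {}" by auto
      then show ?thesis using M[of "{x}"] by simp
    qed
    then show ?thesis by (simp add: isCont_cdf measure_def)
  qed
  have "uniformly_continuous_on {0..T} (cdf M)"
    using cont by (intro compact_uniformly_continuous continuous_at_imp_continuous_on) auto
  then obtain d where d: "0 < d" "\<And>x y. x \<in> {0..T} \<Longrightarrow> y \<in> {0..T} \<Longrightarrow> dist y x < d \<Longrightarrow> dist (cdf M y) (cdf M x) < e"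
    unfolding uniformly_continuous_on_def using e by metis
  \<comment> \<open>As n < 2^n, the cells at level n have length T / 2^n below d.\<close>
  obtain n :: nat where n: "T / d < real n" using reals_Archimedean2 by blast
  have "real n < 2 ^ n" by simp
  then have "T / d < 2 ^ n" using n by linarith
  then have len: "T / 2 ^ n < d" using d(1) by (simp add: field_simps)
  have "measure \<Lambda> (cell T n i \<times> UNIV) < e" if i: "i < 2 ^ n" for i
  proof -
    have g: "0 \<le> grid T n i" "grid T n i \<le> grid T n (Suc i)" "grid T n (Suc i) \<le> T"
      using grid_nonneg[OF T] grid_mono[OF T, of i "Suc i" n] grid_mono[OF T, of "Suc i" "2 ^ n" n] i
      by (auto simp: grid_def)
    have "grid T n (Suc i) - grid T n i = T / 2 ^ n"
      by (simp add: grid_def field_simps)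
    then have "dist (cdf M (grid T n (Suc i))) (cdf M (grid T n i)) < e"
      using g len T by (intro d(2)) (auto simp: dist_real_def)
    moreover have "cdf M (grid T n (Suc i)) - cdf M (grid T n i) = measure M (cell T n i)"
    proof (cases "grid T n i = grid T n (Suc i)")
      case False
      then show ?thesis using g by (intro cdf_diff_eq) simp
    qed simp
    moreover have "measure M (cell T n i) = measure \<Lambda> (cell T n i \<times> UNIV)"
    proof -
      have "cell T n i \<inter> {0..T} = cell T n i" using g by auto
      then show ?thesis using M[of "cell T n i"] by (simp add: measure_def)
    qed
    ultimately show ?thesis by (simp add: dist_real_def)
  qed
  then show ?thesis by blast
qed

text \<open>A cell of mean r holds two or more points with probability at most r^2. The sum of these
  squares is at most the largest mean times the total mass, and the largest mean can be made
  arbitrarily small.\<close>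

lemma AE_separated:
  fixes \<Lambda> :: "(real \<times> 'a :: euclidean_space) measure"
  assumes \<Lambda>: "jump_intensity \<Lambda>" and P: "is_poisson_pp_distr \<Lambda> P" and T: "0 \<le> T"
  shows "AE \<eta> in P. \<exists>n. separated T n \<eta>"
proof -
  have sets: "sets \<Lambda> = sets jump_space" and fin: "emeasure \<Lambda> ({0..T} \<times> UNIV) < \<infinity>"
    using \<Lambda> T by (auto simp: jump_intensity_def)
  interpret prob_space P using P by (simp add: is_poisson_pp_distr_def)
  define bad where "bad n i = {\<eta>\<in>point_patterns \<Lambda>. 1 < emeasure \<eta> (cell T n i \<times> UNIV)}" for n i
  have cell_sets: "cell T n i \<times> UNIV \<in> sets \<Lambda>" for n i
    unfolding sets by (intro jump_sets grid_nonneg T) simp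
  have cell_sub: "cell T n i \<times> (UNIV :: 'a set) \<subseteq> {0..T} \<times> UNIV" if "i < 2 ^ n" for n i
    using grid_nonneg[OF T, of n i] grid_mono[OF T, of "Suc i" "2 ^ n" n] that by (auto simp: grid_def)
  have strip: "{0..T} \<times> UNIV \<in> sets \<Lambda>" unfolding sets by (intro jump_sets) simp
  have cell_fin: "emeasure \<Lambda> (cell T n i \<times> UNIV) < \<infinity>" if "i < 2 ^ n" for n i
    using emeasure_mono[OF cell_sub[OF that] strip] fin by (rule le_less_trans)
  have bad_sets: "bad n i \<in> sets P" for n i
    using measurable_sets_Collect_emeasure[OF cell_sets, of "{x. 1 < x}" n i]
    by (simp add: bad_def is_poisson_pp_distr_sets[OF P])
  \<comment> \<open>The patterns that have a cell with more than one point at every dyadic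
    level.\<close>
  define Bad where "Bad = (\<Inter>n. \<Union>i<2 ^ n. bad n i)"
  have Bad_sets: "Bad \<in> sets P" unfolding Bad_def using bad_sets by auto
  define c where "c = measure \<Lambda> ({0..T} \<times> UNIV)"
  have small: "emeasure P Bad \<le> ennreal (e * c)" if e: "0 < e" for e
  proof -
    obtain n where n: "\<And>i. i < 2 ^ n \<Longrightarrow> measure \<Lambda> (cell T n i \<times> UNIV) < e"
      using small_cells[OF \<Lambda> T e] by blast
    let ?r = "\<lambda>i. measure \<Lambda> (cell T n i \<times> UNIV)"
    have "emeasure P Bad \<le> emeasure P (\<Union>i<2 ^ n. bad n i)"
      unfolding Bad_def using bad_sets by (intro emeasure_mono) auto
    also have "\<dots> \<le> (\<Sum>i<2 ^ n. emeasure P (bad n i))"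
      using bad_sets by (intro emeasure_subadditive_finite) auto
    also have "\<dots> \<le> (\<Sum>i<2 ^ n. ennreal ((?r i)\<^sup>2))"
      unfolding bad_def using cell_sets cell_fin by (intro sum_mono poisson_count_ge_2[OF P]) auto
    also have "\<dots> = ennreal (\<Sum>i<2 ^ n. (?r i)\<^sup>2)" by (simp add: sum_ennreal)
    also have "\<dots> \<le> ennreal (\<Sum>i<2 ^ n. e * ?r i)"
      unfolding power2_eq_square by (intro ennreal_leI sum_mono mult_right_mono less_imp_le[OF n]) auto
    also have "(\<Sum>i<2 ^ n. e * ?r i) = e * measure \<Lambda> (\<Union>i<2 ^ n. cell T n i \<times> UNIV)"
    proof -
      have "disjoint_family_on (\<lambda>i. cell T n i \<times> (UNIV :: 'a set)) {..<2 ^ n}"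
        using disjoint_cell[OF T, of n "{..<2 ^ n}"] unfolding disjoint_family_on_def by blast
      then have "measure \<Lambda> (\<Union>i<2 ^ n. cell T n i \<times> UNIV) = (\<Sum>i<2 ^ n. ?r i)"
        using cell_sets cell_fin by (intro measure_finite_Union) (auto simp: less_top[symmetric])
      then show ?thesis by (simp add: sum_distrib_left)
    qed
    also have "\<dots> \<le> e * c"
      unfolding c_def using e cell_sub strip fin cell_sets
      by (intro mult_left_mono measure_mono_fmeasurable) (auto simp: fmeasurable_def)
    finally show ?thesis by (simp add: ennreal_leI)
  qed
  have "emeasure P Bad \<le> 0 + ennreal e" if e: "0 < e" for e
  proof -
    have c: "0 \<le> c" by (simp add: c_def)
    \<comment> \<open>The tolerance e / (c + 1) brings the bound below e, also when the total mass c
      is 0.\<close>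
    have "emeasure P Bad \<le> ennreal (e / (c + 1) * c)" using e c by (intro small) simp
    also have "e / (c + 1) * c \<le> e" using e c by (simp add: field_simps)
    finally show ?thesis by (simp add: ennreal_leI)
  qed
  then have "emeasure P Bad = 0"
    using ennreal_le_epsilon[of 0 "emeasure P Bad"] by auto
  then have "AE \<eta> in P. \<eta> \<notin> Bad" using Bad_sets by (intro AE_not_in) auto
  then show ?thesis
    using AE_space
  proof eventually_elim
    case (elim \<eta>)
    then obtain n where "\<forall>i<2 ^ n. \<eta> \<notin> bad n i" by (auto simp: Bad_def)
    then have "separated T n \<eta>"
      using elim by (auto simp: separated_def bad_def is_poisson_pp_distr_space[OF P] not_less)
    then show ?case ..
  qed
qed

lemma AE_locally_finite:
  fixes \<Lambda> :: "(real \<times> 'a :: euclidean_space) measure"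
  assumes \<Lambda>: "jump_intensity \<Lambda>" and P: "is_poisson_pp_distr \<Lambda> P"
  shows "AE \<eta> in P. locally_finite \<eta>"
proof -
  have sets: "sets \<Lambda> = sets jump_space" using \<Lambda> by (simp add: jump_intensity_def)
  have "AE \<eta> in P. \<forall>n :: nat. emeasure \<eta> ({0..real n} \<times> UNIV) < \<infinity>"
    unfolding AE_all_countable
    using \<Lambda> jump_sets(1)[of UNIV] sets by (intro allI AE_poisson_count_finite[OF P]) (auto simp: jump_intensity_def)
  then show ?thesis
    using AE_space
  proof eventually_elim
    case (elim \<eta>)
    then have "\<eta> \<in> point_patterns jump_space"
      by (simp add: is_poisson_pp_distr_space[OF P] point_patterns_cong[OF sets])
    then show ?case using elim(1) by (simp add: locally_finite_iff_nat)
  qed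
qed

lemma AE_jump_count:
  fixes \<Lambda> :: "(real \<times> 'a :: euclidean_space) measure"
  assumes \<Lambda>: "jump_intensity \<Lambda>" and P: "is_poisson_pp_distr \<Lambda> P" and T: "0 \<le> T" and U: "U \<in> sets borel"
  shows "AE \<eta> in P. emeasure \<eta> ({0..T} \<times> U) = jump_count T U (compound_path \<eta>)"
proof -
  have sets: "sets \<Lambda> = sets jump_space" using \<Lambda> by (simp add: jump_intensity_def)
  have "AE \<eta> in P. emeasure \<eta> ({0..0} \<times> UNIV) = 0"
    using \<Lambda> jump_sets(1)[of "UNIV :: 'a set" 0] sets by (intro AE_poisson_count_0[OF P]) (auto simp: jump_intensity_def)
  moreover have "AE \<eta> in P. emeasure \<eta> ({0..T} \<times> {0}) = 0"
    using \<Lambda> T jump_sets(1)[of "{0 :: 'a}" T] sets by (intro AE_poisson_count_0[OF P]) (auto simp: jump_intensity_def)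
  ultimately show ?thesis
    using AE_separated[OF \<Lambda> P T] AE_locally_finite[OF \<Lambda> P] AE_space
  proof eventually_elim
    case (elim \<eta>)
    then obtain n where "separated T n \<eta>" by blast
    moreover have "\<eta> \<in> point_patterns jump_space"
      using elim by (simp add: is_poisson_pp_distr_space[OF P] point_patterns_cong[OF sets])
    ultimately show ?case
      using jump_count_compound_path[of \<eta> T n U] elim T U by simp
  qed
qed

section \<open>Counts as functions of the path\<close>

lemma sets_jump_space:
  "sets (jump_space :: (real \<times> 'a :: euclidean_space) measure)
    = sigma_sets ({0..} \<times> UNIV) {{0..T} \<times> U | T U. U \<in> sets (borel :: 'a measure)}" (is "_ = sigma_sets _ ?G")
proof (rule antisym)
  let ?N = "sigma ({0..} \<times> UNIV) ?G :: (real \<times> 'a) measure"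
  have G: "?G \<subseteq> Pow ({0..} \<times> UNIV)" by auto
  have N: "space ?N = {0..} \<times> UNIV" "sets ?N = sigma_sets ({0..} \<times> UNIV) ?G" using G by simp_all
  have rect: "{0..T} \<times> U \<in> sets ?N" if "U \<in> sets borel" for T and U :: "'a set"
    unfolding N using that by (intro sigma_sets.Basic) auto
  have UN: "(\<Union>n :: nat. {0..real n}) = {0..}" by (auto simp: real_arch_simple)
  have "(\<lambda>z. z) \<in> measurable ?N jump_space"
  proof (rule measurable_pair)
    have "fst \<in> borel_measurable ?N"
    proof (rule borel_measurableI_le)
      fix T :: real
      have "{z\<in>space ?N. fst z \<le> T} = {0..T} \<times> UNIV" by (auto simp: N)
      then show "{z\<in>space ?N. fst z \<le> T} \<in> sets ?N" using rect[of UNIV T] by simp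
    qed
    then show "fst \<circ> (\<lambda>z. z) \<in> measurable ?N time_axis"
      by (intro measurable_restrict_space2) (auto simp: N comp_def)
    show "snd \<circ> (\<lambda>z. z) \<in> measurable ?N borel"
    proof (rule measurableI)
      fix U :: "'a set" assume U: "U \<in> sets borel"
      have "(snd \<circ> (\<lambda>z. z)) -` U \<inter> space ?N = (\<Union>n :: nat. {0..real n}) \<times> U"
        unfolding UN by (auto simp: N)
      also have "\<dots> = (\<Union>n :: nat. {0..real n} \<times> U)" by blast
      also have "\<dots> \<in> sets ?N" by (intro sets.countable_UN') (use rect[OF U] in auto)
      finally show "(snd \<circ> (\<lambda>z. z)) -` U \<inter> space ?N \<in> sets ?N" .
    qed simp
  qed
  from measurable_sets[OF this] have "A \<inter> space ?N \<in> sets ?N" if "A \<in> sets jump_space" for A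
    using that by fastforce
  moreover have "A \<inter> space ?N = A" if "A \<in> sets jump_space" for A
    using sets.sets_into_space[OF that] by (auto simp: N space_jump_space)
  ultimately show "sets jump_space \<subseteq> sigma_sets ({0..} \<times> UNIV) ?G" unfolding N(2)[symmetric] by auto
  show "sigma_sets ({0..} \<times> UNIV) ?G \<subseteq> sets (jump_space :: (real \<times> 'a) measure)"
    using sets.sigma_sets_subset[of ?G "jump_space :: (real \<times> 'a) measure"] jump_sets(1) by (auto simp: space_jump_space)
qed

text \<open>The same \<psi> for both laws: the event of paths built from it has to match the event
  of patterns under P and Q simultaneously.\<close>

definition path_determined :: "(real \<times> 'a :: euclidean_space) measure measure \<Rightarrow> (real \<times> 'a) measure measure \<Rightarrow>
    ((real \<times> 'a) measure \<Rightarrow> ennreal) \<Rightarrow> bool" where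
  "path_determined P Q F \<longleftrightarrow> (\<exists>\<psi>\<in>borel_measurable path_space.
     (AE \<eta> in P. F \<eta> = \<psi> (compound_path \<eta>)) \<and> (AE \<eta> in Q. F \<eta> = \<psi> (compound_path \<eta>)))"

text \<open>A Dynkin argument starting from the sets \<open>{0..T} \<times> U\<close>, whose counts
  the path determines. Intersecting with a strip keeps counts almost surely finite, so that the
  count of a complement is a difference.\<close>

lemma path_determined_strip_count:
  fixes \<Lambda> \<Lambda>' :: "(real \<times> 'a :: euclidean_space) measure"
  assumes \<Lambda>: "jump_intensity \<Lambda>" "jump_intensity \<Lambda>'"
    and P: "is_poisson_pp_distr \<Lambda> P" and Q: "is_poisson_pp_distr \<Lambda>' Q" and k: "0 \<le> k"
    and B: "B \<in> sets (jump_space :: (real \<times> 'a) measure)"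
  shows "path_determined P Q (\<lambda>\<eta>. emeasure \<eta> (B \<inter> {0..k} \<times> UNIV))"
proof -
  let ?G = "{{0..T :: real} \<times> U | T U. U \<in> sets (borel :: 'a measure)}"
  let ?S = "{0..k} \<times> (UNIV :: 'a set)"
  have sets: "sets \<Lambda> = sets jump_space" "sets \<Lambda>' = sets jump_space" using \<Lambda> by (auto simp: jump_intensity_def)
  have corner: "path_determined P Q (\<lambda>\<eta>. emeasure \<eta> ({0..T} \<times> U))" if "0 \<le> T" "U \<in> sets borel" for T and U :: "'a set"
    unfolding path_determined_def
    using AE_jump_count[OF \<Lambda>(1) P that] AE_jump_count[OF \<Lambda>(2) Q that] measurable_jump_count[OF that] by blast
  have none: "path_determined P Q (\<lambda>\<eta>. emeasure \<eta> {})"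
    unfolding path_determined_def by (intro bexI[of _ "\<lambda>_. 0"]) auto
  have "Int_stable ?G"
  proof (rule Int_stableI)
    fix a b assume "a \<in> ?G" "b \<in> ?G"
    then obtain T U T' U' where "a = {0..T} \<times> U" "b = {0..T'} \<times> U'" "U \<in> sets borel" "U' \<in> sets borel" by auto
    then show "a \<inter> b \<in> ?G"
      by (intro CollectI exI[of _ "min T T'"] exI[of _ "U \<inter> U'"]) auto
  qed
  moreover have "?G \<subseteq> Pow ({0..} \<times> UNIV)" by auto
  moreover have "B \<in> sigma_sets ({0..} \<times> UNIV) ?G" using B by (simp add: sets_jump_space)
  ultimately show ?thesis
  proof (induction rule: sigma_sets_induct_disjoint)
    case (basic A)
    then obtain T U where A: "A = {0..T} \<times> U" "U \<in> sets borel" by auto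
    show ?case
    proof (cases "0 \<le> T")
      case True
      have "A \<inter> ?S = {0..min T k} \<times> U" using A by auto
      then show ?thesis using corner[of "min T k" U] True k A by simp
    qed (use none A in simp)
  next
    case empty
    then show ?case using none by simp
  next
    case (compl A)
    have A: "A \<in> sets jump_space" using compl(1) by (simp add: sets_jump_space)
    obtain \<psi> where \<psi>: "\<psi> \<in> borel_measurable path_space" 
      "AE \<eta> in P. emeasure \<eta> (A \<inter> ?S) = \<psi> (compound_path \<eta>)" "AE \<eta> in Q. emeasure \<eta> (A \<inter> ?S) = \<psi> (compound_path \<eta>)"
      using compl(2) by (auto simp: path_determined_def)
    obtain \<psi>' where \<psi>': "\<psi>' \<in> borel_measurable path_space" 
      "AE \<eta> in P. emeasure \<eta> ?S = \<psi>' (compound_path \<eta>)" "AE \<eta> in Q. emeasure \<eta> ?S = \<psi>' (compound_path \<eta>)"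
      using corner[OF k, of UNIV] by (auto simp: path_determined_def)
    have *: "AE \<eta> in M. emeasure \<eta> (({0..} \<times> UNIV - A) \<inter> ?S) = \<psi>' (compound_path \<eta>) - \<psi> (compound_path \<eta>)"
      if M: "is_poisson_pp_distr L M" "jump_intensity L" "AE \<eta> in M. emeasure \<eta> (A \<inter> ?S) = \<psi> (compound_path \<eta>)"
        "AE \<eta> in M. emeasure \<eta> ?S = \<psi>' (compound_path \<eta>)" for M L
      using M(3,4) AE_locally_finite[OF M(2,1)] AE_space
    proof eventually_elim
      case (elim \<eta>)
      have sL: "sets L = sets jump_space" using M(2) by (simp add: jump_intensity_def)
      have \<eta>: "\<eta> \<in> point_patterns jump_space"
        using elim by (simp add: is_poisson_pp_distr_space[OF M(1)] point_patterns_cong[OF sL])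
      have S: "?S \<in> sets \<eta>" "A \<in> sets \<eta>" using strip_sets(1)[OF \<eta>] A sets_point_pattern[OF \<eta>] by auto
      have "emeasure \<eta> (?S - A \<inter> ?S) = emeasure \<eta> ?S - emeasure \<eta> (A \<inter> ?S)"
        using strip_finite[OF \<eta> _ _, of "A \<inter> ?S" k] elim S sets_point_pattern[OF \<eta>] by (intro emeasure_Diff) auto
      moreover have "?S - A \<inter> ?S = ({0..} \<times> UNIV - A) \<inter> ?S" by auto
      ultimately show ?case using elim by simp
    qed
    show ?case
      unfolding path_determined_def
    proof (intro bexI[of _ "\<lambda>x. \<psi>' x - \<psi> x"] conjI)
      show "(\<lambda>x. \<psi>' x - \<psi> x) \<in> borel_measurable path_space"
        using \<psi>(1) \<psi>'(1) by (intro borel_measurable_minus_ennreal)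
    qed (rule *[OF P \<Lambda>(1) \<psi>(2) \<psi>'(2)], rule *[OF Q \<Lambda>(2) \<psi>(3) \<psi>'(3)])
  next
    case (union A)
    have A: "A i \<in> sets jump_space" for i using union(2) by (auto simp: sets_jump_space)
    have "\<forall>i. \<exists>\<psi>. \<psi> \<in> borel_measurable path_space \<and>
      (AE \<eta> in P. emeasure \<eta> (A i \<inter> ?S) = \<psi> (compound_path \<eta>)) \<and> (AE \<eta> in Q. emeasure \<eta> (A i \<inter> ?S) = \<psi> (compound_path \<eta>))"
      using union(3) by (auto simp: path_determined_def)
    from choice[OF this] obtain \<psi> where \<psi>: "\<And>i. \<psi> i \<in> borel_measurable path_space"
      "\<And>i. AE \<eta> in P. emeasure \<eta> (A i \<inter> ?S) = \<psi> i (compound_path \<eta>)" "\<And>i. AE \<eta> in Q. emeasure \<eta> (A i \<inter> ?S) = \<psi> i (compound_path \<eta>)"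
      by blast
    have *: "AE \<eta> in M. emeasure \<eta> ((\<Union>i. A i) \<inter> ?S) = (\<Sum>i. \<psi> i (compound_path \<eta>))"
      if M: "is_poisson_pp_distr L M" "jump_intensity L" "\<And>i. AE \<eta> in M. emeasure \<eta> (A i \<inter> ?S) = \<psi> i (compound_path \<eta>)" for M L
    proof -
      have "AE \<eta> in M. \<forall>i. emeasure \<eta> (A i \<inter> ?S) = \<psi> i (compound_path \<eta>)"
        unfolding AE_all_countable using M(3) by blast
      then show ?thesis
        using AE_space
      proof eventually_elim
        case (elim \<eta>)
        have sL: "sets L = sets jump_space" using M(2) by (simp add: jump_intensity_def)
        have \<eta>: "\<eta> \<in> point_patterns jump_space"
          using elim by (simp add: is_poisson_pp_distr_space[OF M(1)] point_patterns_cong[OF sL])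
        have "(\<Sum>i. emeasure \<eta> (A i \<inter> ?S)) = emeasure \<eta> (\<Union>i. A i \<inter> ?S)"
          using A strip_sets(1)[OF \<eta>, of k] sets_point_pattern[OF \<eta>] disjoint_family_on_bisimulation[OF union(1), of "\<lambda>i. A i \<inter> ?S"]
          by (intro suminf_emeasure) auto
        then show ?case using elim by simp
      qed
    qed
    show ?case
      unfolding path_determined_def
    proof (intro bexI[of _ "\<lambda>x. \<Sum>i. \<psi> i x"] conjI)
      show "(\<lambda>x. \<Sum>i. \<psi> i x) \<in> borel_measurable path_space"
        using \<psi>(1) by (intro borel_measurable_suminf_order)
    qed (rule *[OF P \<Lambda>(1) \<psi>(2)], rule *[OF Q \<Lambda>(2) \<psi>(3)])
  qed
qed

text \<open>The counts in growing strips increase to the full count.\<close>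

lemma path_determined_count:
  fixes \<Lambda> \<Lambda>' :: "(real \<times> 'a :: euclidean_space) measure"
  assumes \<Lambda>: "jump_intensity \<Lambda>" "jump_intensity \<Lambda>'"
    and P: "is_poisson_pp_distr \<Lambda> P" and Q: "is_poisson_pp_distr \<Lambda>' Q"
    and B: "B \<in> sets (jump_space :: (real \<times> 'a) measure)"
  shows "path_determined P Q (\<lambda>\<eta>. emeasure \<eta> B)"
proof -
  let ?S = "\<lambda>k :: nat. {0..real k} \<times> (UNIV :: 'a set)"
  have "\<forall>k. \<exists>\<psi>. \<psi> \<in> borel_measurable path_space \<and>
      (AE \<eta> in P. emeasure \<eta> (B \<inter> ?S k) = \<psi> (compound_path \<eta>)) \<and> (AE \<eta> in Q. emeasure \<eta> (B \<inter> ?S k) = \<psi> (compound_path \<eta>))"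
    using path_determined_strip_count[OF \<Lambda> P Q of_nat_0_le_iff B] unfolding path_determined_def Bex_def by blast
  from choice[OF this] obtain \<psi> where \<psi>: "\<And>k. \<psi> k \<in> borel_measurable path_space"
      "\<And>k. AE \<eta> in P. emeasure \<eta> (B \<inter> ?S k) = \<psi> k (compound_path \<eta>)" "\<And>k. AE \<eta> in Q. emeasure \<eta> (B \<inter> ?S k) = \<psi> k (compound_path \<eta>)"
    by blast
  have *: "AE \<eta> in M. emeasure \<eta> B = (SUP k. \<psi> k (compound_path \<eta>))"
    if M: "is_poisson_pp_distr L M" "jump_intensity L" "\<And>k. AE \<eta> in M. emeasure \<eta> (B \<inter> ?S k) = \<psi> k (compound_path \<eta>)" for M L
  proof -
    have "AE \<eta> in M. \<forall>k. emeasure \<eta> (B \<inter> ?S k) = \<psi> k (compound_path \<eta>)"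
      unfolding AE_all_countable using M(3) by blast
    then show ?thesis
      using AE_space
    proof eventually_elim
      case (elim \<eta>)
      have sL: "sets L = sets jump_space" using M(2) by (simp add: jump_intensity_def)
      have \<eta>: "\<eta> \<in> point_patterns jump_space"
        using elim by (simp add: is_poisson_pp_distr_space[OF M(1)] point_patterns_cong[OF sL])
      have "(SUP k. emeasure \<eta> (B \<inter> ?S k)) = emeasure \<eta> (\<Union>k. B \<inter> ?S k)"
      proof (rule SUP_emeasure_incseq)
        show "range (\<lambda>k. B \<inter> ?S k) \<subseteq> sets \<eta>"
          using B strip_sets(1)[OF \<eta>] sets_point_pattern[OF \<eta>] by auto
        show "incseq (\<lambda>k. B \<inter> ?S k)" unfolding incseq_def by fastforce
      qed
      also have "(\<Union>k. B \<inter> ?S k) = B"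
        using sets.sets_into_space[OF B] by (fastforce simp: space_jump_space real_arch_simple)
      finally show ?case using elim by simp
    qed
  qed
  show ?thesis
    unfolding path_determined_def
    using *[OF P \<Lambda>(1) \<psi>(2)] *[OF Q \<Lambda>(2) \<psi>(3)] \<psi>(1)
    by (intro bexI[of _ "\<lambda>x. SUP k. \<psi> k x"]) auto
qed

text \<open>Each generating event of the pattern space agrees almost surely, under both laws, with
  one visible from the path. The algebra of visible events therefore approximates every event, and
  passing to paths loses no divergence.\<close>

theorem partition_div_compound_path:
  fixes \<Lambda> \<Lambda>' :: "(real \<times> 'a :: euclidean_space) measure"
  assumes "0 < \<alpha>" and \<Lambda>: "jump_intensity \<Lambda>" "jump_intensity \<Lambda>'"
    and P: "is_poisson_pp_distr \<Lambda> P" and Q: "is_poisson_pp_distr \<Lambda>' Q"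
  shows "partition_div \<alpha> (sets path_space) (distr P path_space compound_path) (distr Q path_space compound_path)
    = partition_div \<alpha> (sets P) P Q"
proof -
  interpret P: prob_space P using P by (simp add: is_poisson_pp_distr_def)
  interpret Q: prob_space Q using Q by (simp add: is_poisson_pp_distr_def)
  note fin = P.finite_measure_axioms Q.finite_measure_axioms
  have L: "sets \<Lambda> = sets jump_space" "sets \<Lambda>' = sets jump_space" using \<Lambda> by (auto simp: jump_intensity_def)
  have Ps: "sets P = sets (point_pattern_space jump_space)" "sets Q = sets (point_pattern_space jump_space)"
    using is_poisson_pp_distr_sets[OF P] is_poisson_pp_distr_sets[OF Q] point_pattern_space_cong[OF L(1)] point_pattern_space_cong[OF L(2)] by simp_all
  have Psp: "space P = point_patterns jump_space" using sets_eq_imp_space_eq[OF Ps(1)] by simp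
  have Qsp: "space Q = space P" using sets_eq_imp_space_eq[OF Ps(2)] Psp by simp
  have C: "compound_path \<in> measurable P path_space"
    using measurable_compound_path by (simp add: measurable_cong_sets[OF Ps(1) refl])
  have PQ: "sets Q = sets P" using Ps by simp
  let ?A = "{compound_path -` A \<inter> space P | A. A \<in> sets path_space}"
  have sub: "?A \<subseteq> sets P" using measurable_sets[OF C] by auto
  have alg: "algebra (space P) ?A"
    unfolding algebra_iff_Un
  proof (intro conjI ballI)
    fix X assume "X \<in> ?A"
    then obtain E where E: "E \<in> sets path_space" "X = compound_path -` E \<inter> space P" by auto
    show "space P - X \<in> ?A"
      using E measurable_space[OF C] by (intro CollectI exI[of _ "space path_space - E"]) auto
    fix Y assume "Y \<in> ?A"
    then obtain F where F: "F \<in> sets path_space" "Y = compound_path -` F \<inter> space P" by auto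
    show "X \<union> Y \<in> ?A"
      using E F by (intro CollectI exI[of _ "E \<union> F"]) auto
  qed auto
  let ?G = "{{\<eta>\<in>space P. emeasure \<eta> B \<in> E} | B E. B \<in> sets jump_space \<and> E \<in> sets borel}"
  have G: "?G \<subseteq> sets P" unfolding Psp Ps using measurable_sets_Collect_emeasure by blast
  have appG: "approximable ?A P Q X" if X: "X \<in> ?G" for X
  proof -
    obtain B E where B: "B \<in> sets jump_space" and E: "E \<in> sets borel" and X: "X = {\<eta>\<in>space P. emeasure \<eta> B \<in> E}"
      using X by auto
    obtain \<psi> where \<psi>: "\<psi> \<in> borel_measurable path_space"
      "AE \<eta> in P. emeasure \<eta> B = \<psi> (compound_path \<eta>)" "AE \<eta> in Q. emeasure \<eta> B = \<psi> (compound_path \<eta>)"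
      using path_determined_count[OF \<Lambda> P Q B] by (auto simp: path_determined_def)
    define Y where "Y = compound_path -` (\<psi> -` E \<inter> space path_space) \<inter> space P"
    have Y: "Y \<in> ?A" unfolding Y_def using measurable_sets[OF \<psi>(1) E] by blast
    have X': "X \<in> sets P" using G that by auto
    have Y': "Y \<in> sets P" using Y sub by auto
    have 0: "measure M (sym_diff X Y) = 0" if M: "sets M = sets P" "AE \<eta> in M. emeasure \<eta> B = \<psi> (compound_path \<eta>)" for M
    proof -
      have "AE \<eta> in M. (\<eta> \<in> sym_diff X Y) = (\<eta> \<in> {})"
        using M(2) AE_space
      proof eventually_elim
        case (elim \<eta>)
        have "\<eta> \<in> space P" using elim(2) sets_eq_imp_space_eq[OF M(1)] by simp
        then show ?case using elim(1) measurable_space[OF C, of \<eta>] by (auto simp: X Y_def)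
      qed
      then have "emeasure M (sym_diff X Y) = emeasure M {}"
        using X' Y' M(1) by (intro emeasure_eq_AE) auto
      then show ?thesis by (simp add: measure_def)
    qed
    show ?thesis
      unfolding approximable_def using 0[OF refl \<psi>(2)] 0[OF PQ \<psi>(3)] Y by (intro allI impI bexI[of _ Y]) simp_all
  qed
  have gen: "sets P = sigma_sets (space P) ?G"
    unfolding Ps(1) Psp by (rule sets_point_pattern_space)
  have app: "approximable ?A P Q X" if "X \<in> sets P" for X
    by (rule approximable_sigma_sets[OF fin PQ alg sub G appG]) (use that gen in auto)
  have "partition_div \<alpha> (sets path_space) (distr P path_space compound_path) (distr Q path_space compound_path) = partition_div \<alpha> ?A P Q"
    by (rule partition_div_distr[OF C PQ])
  also have "\<dots> = partition_div \<alpha> (sets P) P Q"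
    by (rule partition_div_algebra[OF assms(1) fin PQ alg sub app])
  finally show ?thesis .
qed

section \<open>Divergences of compound Poisson processes\<close>

lemma sets_kernel_prod_jump_space:
  "sets lam = sets time_axis \<Longrightarrow> sets (kernel_prod lam borel K) = sets (jump_space :: (real \<times> 'a :: euclidean_space) measure)"
  unfolding sets_kernel_prod by (intro sets_pair_measure_cong) simp_all

lemma emeasure_kernel_prod_Times:
  fixes K :: "real \<Rightarrow> 'a :: euclidean_space measure"
  assumes lam: "sets lam = sets time_axis" and K: "K \<in> time_axis \<rightarrow>\<^sub>M prob_algebra borel"
    and A: "A \<in> sets time_axis" and B: "B \<in> sets borel"
  shows "emeasure (kernel_prod lam borel K) (A \<times> B) = (\<integral>\<^sup>+t\<in>A. emeasure (K t) B \<partial>lam)"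
proof -
  have K': "K \<in> lam \<rightarrow>\<^sub>M prob_algebra borel" using K by (simp add: measurable_cong_sets[OF lam refl])
  have "A \<times> B \<in> sets (lam \<Otimes>\<^sub>M borel)" using A B lam by (intro pair_measureI) auto
  then have "emeasure (kernel_prod lam borel K) (A \<times> B) = (\<integral>\<^sup>+t. emeasure (K t) (Pair t -` (A \<times> B)) \<partial>lam)"
    by (rule emeasure_kernel_prod[OF K'])
  also have "\<dots> = (\<integral>\<^sup>+t\<in>A. emeasure (K t) B \<partial>lam)"
    by (intro nn_integral_cong) (auto split: split_indicator)
  finally show ?thesis .
qed

text \<open>Each \<open>K t\<close> has mass 1, so the time marginal of the product is
  \<open>lam\<close>.\<close>

lemma emeasure_kernel_prod_strip:
  fixes K :: "real \<Rightarrow> 'a :: euclidean_space measure"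
  assumes lam: "sets lam = sets time_axis" and K: "K \<in> time_axis \<rightarrow>\<^sub>M prob_algebra borel"
    and A: "A \<in> sets time_axis"
  shows "emeasure (kernel_prod lam borel K) (A \<times> UNIV) = emeasure lam A"
proof -
  have "emeasure (K t) UNIV = 1" if "t \<in> space lam" for t
  proof -
    have "K t \<in> space (prob_algebra borel)"
      using that sets_eq_imp_space_eq[OF lam] by (intro measurable_space[OF K]) simp
    then have K': "prob_space (K t)" and sets: "sets (K t) = sets borel"
      by (auto simp: space_prob_algebra)
    show ?thesis using prob_space.emeasure_space_1[OF K'] sets_eq_imp_space_eq[OF sets] by simp
  qed
  then have "emeasure (kernel_prod lam borel K) (A \<times> UNIV) = (\<integral>\<^sup>+t. indicator A t \<partial>lam)"
    by (subst emeasure_kernel_prod_Times[OF lam K A], simp, intro nn_integral_cong) (auto split: split_indicator)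
  then show ?thesis using A lam by simp
qed

lemma jump_intensity_kernel_prod:
  fixes K :: "real \<Rightarrow> 'a :: euclidean_space measure"
  assumes lam: "sets lam = sets time_axis" and K: "K \<in> time_axis \<rightarrow>\<^sub>M prob_algebra borel"
    and diffuse: "\<forall>t\<ge>0. emeasure lam {t} = 0" and fin: "\<forall>t\<ge>0. emeasure lam {0..t} < \<infinity>"
    and K0: "\<forall>t\<ge>0. emeasure (K t) {0} = 0"
  shows "jump_intensity (kernel_prod lam borel K)"
  unfolding jump_intensity_def
proof (intro conjI allI impI)
  show "sets (kernel_prod lam borel K) = sets jump_space" using lam by (rule sets_kernel_prod_jump_space)
  fix t :: real assume t: "0 \<le> t"
  have T: "{0..t} \<in> sets time_axis" "{t} \<in> sets time_axis" using t by (auto simp: sets_restrict_space_iff)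
  show "emeasure (kernel_prod lam borel K) ({0..t} \<times> UNIV) < \<infinity>"
    "emeasure (kernel_prod lam borel K) ({t} \<times> UNIV) = 0"
    using emeasure_kernel_prod_strip[OF lam K T(1)] emeasure_kernel_prod_strip[OF lam K T(2)] diffuse fin t by auto
  have "(\<integral>\<^sup>+s\<in>{0..t}. emeasure (K s) {0} \<partial>lam) = (\<integral>\<^sup>+s. 0 \<partial>lam)"
    using K0 by (intro nn_integral_cong) (auto split: split_indicator)
  then show "emeasure (kernel_prod lam borel K) ({0..t} \<times> {0}) = 0"
    using emeasure_kernel_prod_Times[OF lam K T(1), of "{0}"] by simp
qed

text \<open>Slabs of unit time length are disjoint, cover the space and have finite intensity, so
  the existence and uniqueness results apply.\<close>

lemma is_poisson_jump_intensity:
  fixes \<Lambda> :: "(real \<times> 'a :: euclidean_space) measure"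
  assumes \<Lambda>: "jump_intensity \<Lambda>"
  shows "is_poisson_pp_distr \<Lambda> (poisson_pp_distr \<Lambda>)"
proof (rule is_poisson_poisson_pp_distr)
  let ?A = "\<lambda>n :: nat. {real n..<real n + 1} \<times> (UNIV :: 'a set)"
  have sets: "sets \<Lambda> = sets jump_space" using \<Lambda> by (simp add: jump_intensity_def)
  have A: "?A n \<in> sets \<Lambda>" for n
    unfolding sets by (intro pair_measureI) (auto simp: sets_restrict_space_iff)
  show "range ?A \<subseteq> sets \<Lambda>" using A by auto
  show "disjoint_family ?A"
    unfolding disjoint_family_on_def
  proof (intro ballI impI)
    fix m n :: nat assume "m \<noteq> n"
    then have "real m + 1 \<le> real n \<or> real n + 1 \<le> real m" by linarith
    then show "?A m \<inter> ?A n = {}" by auto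
  qed
  have "(\<Union>n. ?A n) = {0..} \<times> UNIV"
  proof (intro equalityI subsetI)
    fix z :: "real \<times> 'a" assume z: "z \<in> {0..} \<times> UNIV"
    then have "z \<in> ?A (nat \<lfloor>fst z\<rfloor>)" by (auto simp: of_nat_nat)
    then show "z \<in> (\<Union>n. ?A n)" by blast
  qed auto
  then show "(\<Union>n. ?A n) = space \<Lambda>" using sets_eq_imp_space_eq[OF sets] by (simp add: space_jump_space)
  fix n
  have "?A n \<subseteq> {0..real n + 1} \<times> UNIV" by auto
  then have "emeasure \<Lambda> (?A n) \<le> emeasure \<Lambda> ({0..real n + 1} \<times> UNIV)"
    by (rule emeasure_mono) (simp add: sets jump_sets)
  also have "\<dots> < \<infinity>" using \<Lambda> by (simp add: jump_intensity_def)
  finally show "emeasure \<Lambda> (?A n) < \<infinity>" .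
qed

lemma cofinite_cover_strips:
  fixes \<Lambda> \<Lambda>' :: "(real \<times> 'a :: euclidean_space) measure"
  assumes \<Lambda>: "jump_intensity \<Lambda>" "jump_intensity \<Lambda>'"
  shows "cofinite_cover \<Lambda> \<Lambda>' (\<lambda>n. {0..real n} \<times> UNIV)"
proof -
  have sets: "sets \<Lambda> = sets jump_space" using \<Lambda> by (simp add: jump_intensity_def)
  have "(\<Union>n. {0..real n} \<times> UNIV) = space \<Lambda>"
    using sets_eq_imp_space_eq[OF sets] by (auto simp: space_jump_space real_arch_simple)
  moreover have "{0..real n} \<times> UNIV \<in> sets \<Lambda>" for n unfolding sets by (intro jump_sets) simp
  moreover have "incseq (\<lambda>n. {0..real n} \<times> (UNIV :: 'a set))" unfolding incseq_def by fastforce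
  ultimately show ?thesis
    using \<Lambda> by (auto simp: cofinite_cover_def jump_intensity_def)
qed

theorem theorem6p3:
  fixes lam mu :: "real measure"
    and K L :: "real \<Rightarrow> 'a :: euclidean_space measure"
    and \<alpha> :: real
  assumes "sets lam = sets time_axis" and "sets mu = sets time_axis"
    and lam_diffuse: "\<forall>t\<ge>0. emeasure lam {t} = 0"
    and mu_diffuse: "\<forall>t\<ge>0. emeasure mu {t} = 0"
    and lam_locally_finite: "\<forall>t\<ge>0. emeasure lam {0..t} < \<infinity>"
    and mu_locally_finite: "\<forall>t\<ge>0. emeasure mu {0..t} < \<infinity>"
    and K_kernel: "K \<in> time_axis \<rightarrow>\<^sub>M prob_algebra borel"
    and L_kernel: "L \<in> time_axis \<rightarrow>\<^sub>M prob_algebra borel"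
    and "\<forall>t\<ge>0. emeasure (K t) {0} = 0"
    and "\<forall>t\<ge>0. emeasure (L t) {0} = 0"
    and "\<alpha> > 0"
  shows "renyi_div \<alpha> (compound_poisson_law lam K) (compound_poisson_law mu L)
       = tsallis_div \<alpha> (kernel_prod lam borel K) (kernel_prod mu borel L)"
proof -
  let ?\<Lambda> = "kernel_prod lam borel K" and ?\<Lambda>' = "kernel_prod mu borel L"
  let ?P = "poisson_pp_distr ?\<Lambda>" and ?Q = "poisson_pp_distr ?\<Lambda>'"
  let ?\<B> = "{B\<in>sets ?\<Lambda>. emeasure ?\<Lambda> B < \<infinity> \<and> emeasure ?\<Lambda>' B < \<infinity>}"
  have \<Lambda>: "jump_intensity ?\<Lambda>"
    using assms(1) K_kernel lam_diffuse lam_locally_finite assms(9) by (rule jump_intensity_kernel_prod)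
  have \<Lambda>': "jump_intensity ?\<Lambda>'"
    using assms(2) L_kernel mu_diffuse mu_locally_finite assms(10) by (rule jump_intensity_kernel_prod)
  have sets: "sets ?\<Lambda> = sets jump_space" "sets ?\<Lambda>' = sets jump_space"
    using \<Lambda> \<Lambda>' unfolding jump_intensity_def by blast+
  then have sets_eq: "sets ?\<Lambda>' = sets ?\<Lambda>" by (rule trans[OF _ sym, rotated])
  note P = is_poisson_jump_intensity[OF \<Lambda>] and Q = is_poisson_jump_intensity[OF \<Lambda>']
  have path: "prob_space (compound_poisson_law \<Lambda> J)"
    if "is_poisson_pp_distr (kernel_prod \<Lambda> borel J) (poisson_pp_distr (kernel_prod \<Lambda> borel J))"
      "sets (kernel_prod \<Lambda> borel J) = sets jump_space" for \<Lambda> and J :: "real \<Rightarrow> 'a measure"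
  proof -
    have "sets (poisson_pp_distr (kernel_prod \<Lambda> borel J)) = sets (point_pattern_space jump_space)"
      using is_poisson_pp_distr_sets[OF that(1)] point_pattern_space_cong[OF that(2)] by simp
    then have "compound_path \<in> measurable (poisson_pp_distr (kernel_prod \<Lambda> borel J)) path_space"
      using measurable_compound_path measurable_cong_sets by blast
    then show ?thesis
      unfolding compound_poisson_law_def
      using that(1) by (intro prob_space.prob_space_distr) (auto simp: is_poisson_pp_distr_def)
  qed
  note cover = cofinite_cover_strips[OF \<Lambda> \<Lambda>']
  have "partition_div \<alpha> (sets (compound_poisson_law lam K)) (compound_poisson_law lam K) (compound_poisson_law mu L)
      = partition_div \<alpha> (sets ?P) ?P ?Q"
    using partition_div_compound_path[OF \<open>\<alpha> > 0\<close> \<Lambda> \<Lambda>' P Q] by (simp add: compound_poisson_law_def)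
  also have "\<dots> = tsallis_of_renyi \<alpha> (partition_div \<alpha> ?\<B> ?\<Lambda> ?\<Lambda>')"
    by (rule partition_div_poisson[OF \<open>\<alpha> > 0\<close> P Q sets_eq cover])
  finally have "renyi_div \<alpha> (compound_poisson_law lam K) (compound_poisson_law mu L)
      = enn2ereal (partition_div \<alpha> ?\<B> ?\<Lambda> ?\<Lambda>')"
    using path[OF P sets(1)] path[OF Q sets(2)]
    by (intro renyi_div_eq_partition_div \<open>\<alpha> > 0\<close>) (simp_all add: compound_poisson_law_def)
  also have "\<dots> = tsallis_div \<alpha> ?\<Lambda> ?\<Lambda>'"
    by (rule tsallis_div_eq_partition_div[OF \<open>\<alpha> > 0\<close> cover sets_eq, symmetric])
  finally show ?thesis .
qed

end
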